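(* There exists an absolute constant $c>0$ such that for any finitely-supported probability measure $\nu$ on $\mathbb{R}$, one has \[ T(\mu_\nu) \ll \|\nu\|_2^{5+c} + \nu(0)^3, \] with an absolute implied constant.
   Context: For a finitely-supported probability measure $\nu$ on $\mathbb{R}$, $\mu_\nu$ is the probability measure on $2\times 2$ real matrices given by $\mu_\nu\big((a_{i,j})_{1\le i,j\le 2}\big)=\nu(a_{1,1})\nu(a_{1,2})\nu(a_{2,1})\nu(a_{2,2})$, and $T(\mu) = \sum_{X,Y\in\mathrm{supp}(\mu)}\mu(X)\mu(Y)\mathbb{1}_{XY=YX}$. $\|\nu\|_2=(\sum_x\nu(x)^2)^{1/2}$. *)

theory Defs
  imports "HOL-Probability.Probability"
begin

definition matrix_pmf :: "real pmf \<Rightarrow> (real^2^2) pmf" where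
  "matrix_pmf \<nu> =
     embed_pmf (\<lambda>A. pmf \<nu> (A $ 1 $ 1) * pmf \<nu> (A $ 1 $ 2) * pmf \<nu> (A $ 2 $ 1) * pmf \<nu> (A $ 2 $ 2))"

(* The weights above do sum to 1, so embed_pmf is not applied outside its domain. *)
lemma pmf_matrix_pmf:
  "pmf (matrix_pmf \<nu>) A =
     pmf \<nu> (A $ 1 $ 1) * pmf \<nu> (A $ 1 $ 2) * pmf \<nu> (A $ 2 $ 1) * pmf \<nu> (A $ 2 $ 2)"
proof -
  define f :: "real \<times> real \<times> real \<times> real \<Rightarrow> real^2^2"
    where "f = (\<lambda>(a, b, c, d). vector [vector [a, b], vector [c, d]])"
  define p where "p = map_pmf f (pair_pmf \<nu> (pair_pmf \<nu> (pair_pmf \<nu> \<nu>)))"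
  have "inj f"
    by (auto simp: inj_def f_def vec_eq_iff forall_2)
  have pmf_p: "pmf p B =
      pmf \<nu> (B $ 1 $ 1) * pmf \<nu> (B $ 1 $ 2) * pmf \<nu> (B $ 2 $ 1) * pmf \<nu> (B $ 2 $ 2)"
    for B :: "real^2^2"
  proof -
    have "B = f (B $ 1 $ 1, B $ 1 $ 2, B $ 2 $ 1, B $ 2 $ 2)"
      by (simp add: f_def vec_eq_iff forall_2)
    then have "pmf p B = pmf (pair_pmf \<nu> (pair_pmf \<nu> (pair_pmf \<nu> \<nu>)))
        (B $ 1 $ 1, B $ 1 $ 2, B $ 2 $ 1, B $ 2 $ 2)"
      unfolding p_def using pmf_map_inj'[OF \<open>inj f\<close>] by metis
    then show ?thesis
      by (simp add: pmf_pair mult.assoc)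
  qed
  then have "matrix_pmf \<nu> = embed_pmf (pmf p)"
    unfolding matrix_pmf_def by (intro arg_cong[of _ _ embed_pmf] ext) simp
  also have "\<dots> = p"
    by (rule type_definition.Rep_inverse[OF td_pmf_embed_pmf])
  finally show ?thesis
    by (simp add: pmf_p)
qed

(* The two sums below are meant for finitely supported measures only: over an infinite
   support they are 0 by convention. *)
definition commuting_prob :: "(real^2^2) pmf \<Rightarrow> real" where
  "commuting_prob \<mu> =
     (\<Sum>X\<in>set_pmf \<mu>. \<Sum>Y\<in>set_pmf \<mu>. pmf \<mu> X * pmf \<mu> Y * of_bool (X ** Y = Y ** X))"

definition l2_norm :: "real pmf \<Rightarrow> real" where
  "l2_norm \<nu> = (\<Sum>x\<in>set_pmf \<nu>. (pmf \<nu> x)\<^sup>2) powr (1/2)"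

end

theory Submission
  imports Defs
begin

text \<open>
  If some off-diagonal entry vanishes, the commuting equations give \<open>O(\<nu>(0)^3 + N^3)\<close> with
  \<open>N = \<parallel>\<nu>\<parallel>\<^sub>2\<^sup>2\<close>. Otherwise \<open>(a b; c d)\<close> and \<open>(e f; g h)\<close> commute iff
  \<open>f / b = g / c = l\<close> and \<open>h - l d = e - l a\<close> for some slope \<open>l\<close>, so one has to bound
  \<open>\<Sum>\<^sub>l r(l)\<^sup>2 \<Sum>\<^sub>t m(l, t)\<^sup>2\<close>, where \<open>m(l, t)\<close> is the \<open>\<nu> \<otimes> \<nu>\<close>-mass of the line \<open>y = l x + t\<close>
  and \<open>r(l)\<close> that of the line \<open>y = l x\<close>. The Szemeredi-Trotter bound for cartesian products, which has an
  elementary cell argument, yields exactly the exponent \<open>N^(5/2)\<close>, with a gain as soon as one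
  of the weights involved lives on atoms much heavier than \<open>N\<close>; these are split off by levels.

  If all atoms are at most \<open>M \<approx> N\<close>, then \<open>r \<le> M\<close>, and it remains to improve the bound \<open>M^(3/2)\<close>
  for \<open>J = \<Sum>\<^sub>z \<phi>(z)\<^sup>2\<close>, where \<open>\<phi>\<close> is the distribution of \<open>(a - a') / b\<close>. Since \<open>\<phi>\<close> is positive definite,
  the triangles \<open>\<phi>(x) \<phi>(y) \<phi>(x + y)\<close> weigh at least \<open>J^3\<close>. By Cauchy-Schwarz they are
  controlled by the number of similar triples, which is a third moment of \<open>m\<close>, and by
  \<open>\<Sum> \<phi>(x)\<^sup>2 \<phi>(y)\<^sup>2 \<phi>(x + y)\<^sup>2\<close>. Expanding one factor \<open>\<phi>\<close> turns the latter into a second moment of lines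
  with slope \<open>b\<close>, to which Szemeredi-Trotter applies once more with a power to spare.
\<close>

section \<open>Fibre sums and masses of lines\<close>

text \<open>The overview leaves out why two truncations are needed. At the critical size,
  \<open>\<phi>\<close> is about \<open>M powr (3/2)\<close> on the set that carries
  \<open>J\<close>. There the square of the triangle sum is at most about
  \<open>M^3 * M powr (25/4) = M powr (37/4)\<close>, against the lower bound
  \<open>J^6 = M^9\<close>, so a factor \<open>M powr (1/4)\<close> is available to pay for all
  losses. The upper bound, however, works for \<open>\<phi> < K\<close> only, and cutting off the
  large values of \<open>\<phi>\<close> destroys positive definiteness. Deleting vertices does not:
  a principal submatrix of a positive semidefinite matrix is again positive semidefinite. So the
  lower bound is taken for the uncut \<open>\<phi>\<close> on the vertices of small squared degree,
  and triangles with a large edge are then bounded through that degree. Few vertices are lost,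
  because the mean squared degree is the third moment of \<open>\<phi>\<close>, which is
  \<open>M^3\<close> up to a small power of \<open>M\<close>.\<close>

definition push :: "'i set \<Rightarrow> ('i \<Rightarrow> real) \<Rightarrow> ('i \<Rightarrow> 'k) \<Rightarrow> 'k \<Rightarrow> real" where
  "push I w k t = (\<Sum>i\<in>{i\<in>I. k i = t}. w i)"

lemma push_alt: "finite I \<Longrightarrow> push I w k t = (\<Sum>i\<in>I. w i * of_bool (k i = t))"
  unfolding push_def by (rule sum.mono_neutral_cong_left) auto

lemma push_nonneg: "(\<And>i. i \<in> I \<Longrightarrow> 0 \<le> w i) \<Longrightarrow> 0 \<le> push I w k t"
  unfolding push_def by (auto intro!: sum_nonneg)

lemma push_eq_0: "t \<notin> k ` I \<Longrightarrow> push I w k t = 0"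
  unfolding push_def by (rule sum.neutral) auto

lemma sum_push_mult:
  assumes "finite I" "finite T" "k ` I \<subseteq> T"
  shows "(\<Sum>t\<in>T. push I w k t * F t) = (\<Sum>i\<in>I. w i * F (k i))"
proof -
  have "(\<Sum>t\<in>T. push I w k t * F t) = (\<Sum>t\<in>T. \<Sum>i\<in>{i\<in>I. k i = t}. w i * F (k i))"
    unfolding push_def sum_distrib_right by (intro sum.cong) auto
  also have "\<dots> = (\<Sum>i\<in>I. w i * F (k i))"
    by (rule sum.group[OF assms])
  finally show ?thesis .
qed

lemma sum_push:
  assumes "finite I" "finite T" "k ` I \<subseteq> T"
  shows "(\<Sum>t\<in>T. push I w k t) = sum w I"
  using sum_push_mult[OF assms, where F = "\<lambda>_. 1"] by simp

lemma sum_push_le: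
  assumes "finite I" "finite T" "\<And>i. i \<in> I \<Longrightarrow> 0 \<le> w i"
  shows "(\<Sum>t\<in>T. push I w k t) \<le> sum w I"
proof -
  have "(\<Sum>t\<in>T. push I w k t) \<le> (\<Sum>t\<in>T \<union> k ` I. push I w k t)"
    by (rule sum_mono2) (use assms in \<open>auto intro: push_nonneg\<close>)
  also have "\<dots> = sum w I"
    by (rule sum_push) (use assms in auto)
  finally show ?thesis .
qed

text \<open>The second moment of a pushforward is the weight of its collisions. This identity, read
  in both directions, turns equations between variables into sums of squared line masses.\<close>

lemma sum_push_sq:
  assumes "finite I" "finite T" "k ` I \<subseteq> T"
  shows "(\<Sum>t\<in>T. (push I w k t)\<^sup>2) = (\<Sum>i\<in>I. \<Sum>j\<in>I. w i * w j * of_bool (k j = k i))"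
  using sum_push_mult[OF assms, where F = "push I w k" and w = w]
  by (simp add: power2_eq_square push_alt[OF assms(1)] sum_distrib_left mult.assoc)

lemma Cauchy_Schwarz_weighted:
  fixes w a b :: "'i \<Rightarrow> real"
  assumes "\<And>i. i \<in> I \<Longrightarrow> 0 \<le> w i"
  shows "(\<Sum>i\<in>I. w i * a i * b i)\<^sup>2 \<le> (\<Sum>i\<in>I. w i * (a i)\<^sup>2) * (\<Sum>i\<in>I. w i * (b i)\<^sup>2)"
proof -
  have "(\<Sum>i\<in>I. w i * a i * b i) = (\<Sum>i\<in>I. (sqrt (w i) * a i) * (sqrt (w i) * b i))"
    using assms by (intro sum.cong) (auto simp: algebra_simps)
  then have "(\<Sum>i\<in>I. w i * a i * b i)\<^sup>2
      \<le> (\<Sum>i\<in>I. (sqrt (w i) * a i)\<^sup>2) * (\<Sum>i\<in>I. (sqrt (w i) * b i)\<^sup>2)"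
    by (simp add: Cauchy_Schwarz_ineq_sum)
  also have "\<dots> = (\<Sum>i\<in>I. w i * (a i)\<^sup>2) * (\<Sum>i\<in>I. w i * (b i)\<^sup>2)"
    using assms by (simp add: power_mult_distrib)
  finally show ?thesis .
qed

lemma square_sum_le_card_image:
  fixes v :: "'i \<Rightarrow> real"
  assumes "finite S"
  shows "(\<Sum>x\<in>S. v x)\<^sup>2 \<le> card (k ` S) * (\<Sum>x\<in>S. \<Sum>x'\<in>S. v x * v x' * of_bool (k x' = k x))"
proof -
  have "(\<Sum>x\<in>S. v x) = (\<Sum>t\<in>k ` S. 1 * push S v k t)"
    using sum_push[of S "k ` S" k v] assms by simp
  then have "(\<Sum>x\<in>S. v x)\<^sup>2 \<le> (\<Sum>t\<in>k ` S. 1\<^sup>2) * (\<Sum>t\<in>k ` S. (push S v k t)\<^sup>2)"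
    by (simp only: Cauchy_Schwarz_ineq_sum)
  then show ?thesis
    using sum_push_sq[of S "k ` S" k v] assms by simp
qed

text \<open>Encoded as a fibre sum of \<open>y - l * x\<close>, so that the lines of one slope
  partition \<open>A \<times> B\<close> and everything about \<open>push\<close> applies.\<close>

definition line_mass :: "(real \<Rightarrow> real) \<Rightarrow> real set \<Rightarrow> (real \<Rightarrow> real) \<Rightarrow> real set \<Rightarrow> real \<Rightarrow> real \<Rightarrow> real" where
  "line_mass p A q B l t = push (A \<times> B) (\<lambda>(x, y). p x * q y) (\<lambda>(x, y). y - l * x) t"

lemma line_mass_alt:
  assumes "finite A" "finite B"
  shows "line_mass p A q B l t = (\<Sum>x\<in>{x\<in>A. l * x + t \<in> B}. p x * q (l * x + t))"
  unfolding line_mass_def push_def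
  by (rule sum.reindex_bij_witness[where i = "\<lambda>x. (x, l * x + t)" and j = fst]) (auto simp: algebra_simps)

text \<open>Numbers consecutive blocks of \<open>A\<close> of \<open>p\<close>-mass about \<open>d\<close>.\<close>

definition cell :: "(real \<Rightarrow> real) \<Rightarrow> real set \<Rightarrow> real \<Rightarrow> real \<Rightarrow> int" where
  "cell p A d x = \<lfloor>(\<Sum>x'\<in>{x'\<in>A. x' < x}. p x') / d\<rfloor>"

lemma cell_mono:
  assumes "finite A" "\<And>x. x \<in> A \<Longrightarrow> 0 \<le> p x" "0 < d" "x \<le> y"
  shows "cell p A d x \<le> cell p A d y"
  unfolding cell_def
  by (intro floor_mono divide_right_mono sum_mono2) (use assms in auto)

lemma cell_nonneg:
  assumes "\<And>x. x \<in> A \<Longrightarrow> 0 \<le> p x" "0 < d"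
  shows "0 \<le> cell p A d x"
  unfolding cell_def using assms by (auto intro!: divide_nonneg_pos sum_nonneg)

lemma cell_le:
  assumes "finite A" "\<And>x. x \<in> A \<Longrightarrow> 0 \<le> p x" "0 < d" "sum p A \<le> w"
  shows "cell p A d x \<le> \<lfloor>w / d\<rfloor>"
  unfolding cell_def
proof (intro floor_mono divide_right_mono)
  have "(\<Sum>x'\<in>{x'\<in>A. x' < x}. p x') \<le> sum p A"
    by (rule sum_mono2) (use assms in auto)
  then show "(\<Sum>x'\<in>{x'\<in>A. x' < x}. p x') \<le> w"
    using assms by simp
qed (use assms in auto)

text \<open>All points of a block except its largest one, \<open>hi\<close>, lie in the half-open
  interval from \<open>lo\<close> to \<open>hi\<close>. Their mass is at most
  \<open>F hi - F lo\<close>, which is at most \<open>d\<close> because both quotients have integer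
  part \<open>k\<close>. Only \<open>hi\<close> itself costs the extra \<open>M\<close>.\<close>

lemma cell_mass_le:
  assumes "finite A" "\<And>x. x \<in> A \<Longrightarrow> 0 \<le> p x" "\<And>x. x \<in> A \<Longrightarrow> p x \<le> M" "0 < d" "0 \<le> M"
  shows "(\<Sum>x\<in>{x\<in>A. cell p A d x = k}. p x) \<le> d + M"
proof (cases "{x\<in>A. cell p A d x = k} = {}")
  case False
  define S where "S = {x\<in>A. cell p A d x = k}"
  have fS: "finite S" "S \<noteq> {}" using False assms(1) by (auto simp: S_def)
  define hi where "hi = Max S"
  define lo where "lo = Min S"
  have hi: "hi \<in> S" and lo: "lo \<in> S" using fS by (auto simp: hi_def lo_def)
  define F where "F x = (\<Sum>x'\<in>{x'\<in>A. x' < x}. p x')" for x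
  have k: "real_of_int k \<le> F x / d" "F x / d < k + 1" if "x \<in> S" for x
    using that floor_correct[of "F x / d"] unfolding S_def cell_def F_def by auto
  have "F hi < (k + 1) * d" "k * d \<le> F lo"
    using k[OF hi] k[OF lo] assms(4) by (auto simp: field_simps)
  then have *: "F hi - F lo \<le> d" by (simp add: algebra_simps)
  have sub: "S - {hi} \<subseteq> {x'\<in>A. x' < hi} - {x'\<in>A. x' < lo}"
  proof
    fix x assume "x \<in> S - {hi}"
    then have "x \<in> A" "x \<le> hi" "x \<noteq> hi" "lo \<le> x"
      using fS unfolding hi_def lo_def by (auto simp: S_def)
    then show "x \<in> {x'\<in>A. x' < hi} - {x'\<in>A. x' < lo}" by auto
  qed
  have "lo \<le> hi" using fS hi by (simp add: lo_def)
  have "sum p (S - {hi}) \<le> sum p ({x'\<in>A. x' < hi} - {x'\<in>A. x' < lo})"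
    by (rule sum_mono2) (use assms sub in auto)
  also have "\<dots> = F hi - F lo"
    unfolding F_def by (rule sum_diff) (use assms \<open>lo \<le> hi\<close> in auto)
  also have "\<dots> \<le> d" by (rule *)
  finally have "sum p (S - {hi}) \<le> d" .
  moreover have "p hi \<le> M" using hi assms(3) by (auto simp: S_def)
  moreover have "sum p S = p hi + sum p (S - {hi})"
    using fS hi by (simp add: sum.remove)
  ultimately show ?thesis unfolding S_def by simp
qed (use assms in \<open>simp only: sum.empty; simp\<close>)

section \<open>Rich lines in a weighted cartesian product\<close>

lemma cell_pair_mass_le:
  assumes "finite A" "\<And>x. x \<in> A \<Longrightarrow> 0 \<le> p x" "\<And>x. x \<in> A \<Longrightarrow> p x \<le> M" "0 < d" "0 \<le> M"
    "sum p A \<le> w"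
  shows "(\<Sum>x\<in>A. \<Sum>x'\<in>A. p x * p x' * of_bool (cell p A d x' = cell p A d x)) \<le> w * (d + M)"
proof -
  have "(\<Sum>x'\<in>A. p x * p x' * of_bool (cell p A d x' = cell p A d x)) \<le> p x * (d + M)" if "x \<in> A" for x
  proof -
    have "(\<Sum>x'\<in>A. p x * p x' * of_bool (cell p A d x' = cell p A d x))
        = p x * (\<Sum>x'\<in>{x'\<in>A. cell p A d x' = cell p A d x}. p x')"
      unfolding sum_distrib_left
      by (rule sum.mono_neutral_cong_right) (use assms(1) in auto)
    also have "\<dots> \<le> p x * (d + M)"
      by (intro mult_left_mono cell_mass_le) (use assms that in auto)
    finally show ?thesis .
  qed
  then have "(\<Sum>x\<in>A. \<Sum>x'\<in>A. p x * p x' * of_bool (cell p A d x' = cell p A d x))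
      \<le> sum p A * (d + M)"
    unfolding sum_distrib_right by (intro sum_mono) auto
  also have "\<dots> \<le> w * (d + M)"
    by (intro mult_right_mono) (use assms in auto)
  finally show ?thesis .
qed

text \<open>Along a line both block numbers are monotone in \<open>x\<close>. With the sign of the
  second one adapted to the slope, their sum \<open>K\<close> is increasing, and equality of two
  sums forces equality of both summands. So \<open>K\<close> labels the cells on the line, and it
  takes at most \<open>2 * \<lfloor>r\<rfloor> + 1 \<le> 3 * r\<close> values.\<close>

lemma card_line_cells:
  fixes r :: real
  assumes "finite A" "finite B" "\<And>x. x \<in> A \<Longrightarrow> 0 \<le> p x" "\<And>y. y \<in> B \<Longrightarrow> 0 \<le> q y"
    and "sum p A \<le> w1" "sum q B \<le> w2" "0 < w1" "0 < w2" "1 \<le> r" "l \<noteq> 0" "S \<subseteq> A"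
  obtains K :: "real \<Rightarrow> int" where "card (K ` S) \<le> 3 * r"
    "\<And>x x'. K x = K x' \<Longrightarrow> cell p A (w1 / r) x = cell p A (w1 / r) x'
        \<and> cell q B (w2 / r) (l * x + t) = cell q B (w2 / r) (l * x' + t)"
proof
  define i where "i = cell p A (w1 / r)"
  define j where "j = cell q B (w2 / r)"
  have mono: "i x \<le> i x'" "j x \<le> j x'" if "x \<le> x'" for x x'
    unfolding i_def j_def using assms that by (auto intro!: cell_mono)
  have bd: "0 \<le> i x" "i x \<le> \<lfloor>r\<rfloor>" "0 \<le> j x" "j x \<le> \<lfloor>r\<rfloor>" for x
    using cell_nonneg[of A p "w1 / r" x] cell_nonneg[of B q "w2 / r" x]
      cell_le[of A p "w1 / r" w1 x] cell_le[of B q "w2 / r" w2 x] assms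
    by (auto simp: i_def j_def)
  define K where "K x = i x + (if l > 0 then j (l * x + t) else - j (l * x + t))" for x
  have key: "i x = i x' \<and> j (l * x + t) = j (l * x' + t)" if "K x = K x'" "x \<le> x'" for x x'
  proof (cases "l > 0")
    case True
    then have "l * x + t \<le> l * x' + t" using that by simp
    from mono(2)[OF this] mono(1)[OF that(2)] that(1) True show ?thesis
      unfolding K_def by auto
  next
    case False
    then have "l * x' + t \<le> l * x + t" using that by (auto intro!: mult_left_mono_neg)
    from mono(2)[OF this] mono(1)[OF that(2)] that(1) False show ?thesis
      unfolding K_def by auto
  qed
  show "cell p A (w1 / r) x = cell p A (w1 / r) x'
        \<and> cell q B (w2 / r) (l * x + t) = cell q B (w2 / r) (l * x' + t)" if "K x = K x'" for x x'
    using key[of x x'] key[of x' x] that linear[of x x'] unfolding i_def j_def by metis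
  define n where "n = (if l > 0 then 0 else - \<lfloor>r\<rfloor>)"
  have "K ` S \<subseteq> {n..n + 2 * \<lfloor>r\<rfloor>}"
  proof
    fix k assume "k \<in> K ` S"
    then obtain x where "k = K x" by auto
    then show "k \<in> {n..n + 2 * \<lfloor>r\<rfloor>}"
      using bd[of x] bd[of "l * x + t"] by (auto simp: K_def n_def)
  qed
  then have "card (K ` S) \<le> card {n..n + 2 * \<lfloor>r\<rfloor>}"
    by (intro card_mono) auto
  also have "\<dots> = nat (2 * \<lfloor>r\<rfloor> + 1)" by simp
  finally have "real (card (K ` S)) \<le> 2 * of_int \<lfloor>r\<rfloor> + 1"
    using assms(9) by linarith
  then show "card (K ` S) \<le> 3 * r"
    using assms(9) of_int_floor_le[of r] by linarith
qed

text \<open>Cauchy-Schwarz over the at most \<open>3 * r\<close> cells on the line bounds its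
  squared mass by pairs of points in a common cell. The diagonal pairs contribute at most
  \<open>M1 * M2\<close> times the mass, and the 6 in \<open>r\<close> makes this at most half of
  the left-hand side, so it is absorbed. A pair with \<open>x \<noteq> x'\<close> determines its
  line, hence the remaining pairs form one fibre of the map to slope and intercept.\<close>

lemma rich_line_pairs:
  assumes "finite A" "finite B" "\<And>x. x \<in> A \<Longrightarrow> 0 \<le> p x" "\<And>y. y \<in> B \<Longrightarrow> 0 \<le> q y"
    and "\<And>x. x \<in> A \<Longrightarrow> p x \<le> M1" "\<And>y. y \<in> B \<Longrightarrow> q y \<le> M2"
    and "sum p A \<le> w1" "sum q B \<le> w2" "0 < w1" "0 < w2" "0 < M1" "0 < M2" "l \<noteq> 0"
    and r: "r = \<mu> / (6 * M1 * M2)" "1 \<le> r"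
    and rich: "\<mu> \<le> line_mass p A q B l t"
  defines "i \<equiv> cell p A (w1 / r)" and "j \<equiv> cell q B (w2 / r)"
  shows "(line_mass p A q B l t)\<^sup>2 \<le> 6 * r *
      push {((x, x'), (y, y')) \<in> (A \<times> A) \<times> (B \<times> B). x \<noteq> x' \<and> i x' = i x \<and> j y' = j y}
        (\<lambda>((x, x'), (y, y')). (p x * p x') * (q y * q y'))
        (\<lambda>((x, x'), (y, y')). ((y' - y) / (x' - x), y - (y' - y) / (x' - x) * x)) (l, t)"
    (is "_ \<le> 6 * r * ?D")
proof -
  define S where "S = {x\<in>A. l * x + t \<in> B}"
  define v where "v x = p x * q (l * x + t)" for x
  define m where "m = line_mass p A q B l t"
  have fS: "finite S" and SA: "S \<subseteq> A" using assms(1) by (auto simp: S_def)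
  have m: "m = (\<Sum>x\<in>S. v x)"
    unfolding m_def S_def v_def by (rule line_mass_alt) fact+
  have vn: "0 \<le> v x" and vM: "v x \<le> M1 * M2" if "x \<in> S" for x
    using that assms unfolding S_def v_def by (auto intro!: mult_mono)
  have "\<mu> = 6 * r * M1 * M2" using r(1) assms(11,12) by simp
  then have m0: "6 * r * M1 * M2 \<le> m" using rich by (simp add: m_def)
  have mpos: "0 < m" by (rule less_le_trans[OF _ m0]) (use r(2) assms(11,12) in simp)
  obtain K :: "real \<Rightarrow> int" where K: "card (K ` S) \<le> 3 * r"
    "\<And>x x'. K x = K x' \<Longrightarrow> i x = i x' \<and> j (l * x + t) = j (l * x' + t)"
    using card_line_cells[OF assms(1,2,3,4,7,8,9,10) r(2) \<open>l \<noteq> 0\<close> SA, where t = t]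
    unfolding i_def j_def by auto
  define D where "D = (\<Sum>x\<in>S. \<Sum>x'\<in>S. v x * v x' *
      of_bool (x \<noteq> x' \<and> i x' = i x \<and> j (l * x' + t) = j (l * x + t)))"
  have "m\<^sup>2 \<le> card (K ` S) * (\<Sum>x\<in>S. \<Sum>x'\<in>S. v x * v x' * of_bool (K x' = K x))"
    unfolding m by (rule square_sum_le_card_image) fact
  also have "\<dots> \<le> (3 * r) * ((\<Sum>x\<in>S. v x * v x) + D)"
  proof (rule mult_mono)
    show "(\<Sum>x\<in>S. \<Sum>x'\<in>S. v x * v x' * of_bool (K x' = K x)) \<le> (\<Sum>x\<in>S. v x * v x) + D"
    proof -
      have "(\<Sum>x'\<in>S. v x * v x' * of_bool (K x' = K x))
          \<le> (\<Sum>x'\<in>S. v x * v x' * of_bool (x' = x) + v x * v x' *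
            of_bool (x \<noteq> x' \<and> i x' = i x \<and> j (l * x' + t) = j (l * x + t)))" if "x \<in> S" for x
      proof (rule sum_mono)
        fix x' assume "x' \<in> S"
        then have "0 \<le> v x * v x'" using vn that by simp
        then show "v x * v x' * of_bool (K x' = K x) \<le> v x * v x' * of_bool (x' = x) + v x * v x' *
            of_bool (x \<noteq> x' \<and> i x' = i x \<and> j (l * x' + t) = j (l * x + t))"
          using K(2)[of x' x] by (cases "K x' = K x"; cases "x' = x") auto
      qed
      moreover have "(\<Sum>x'\<in>S. v x * v x' * of_bool (x' = x)) = v x * v x" if "x \<in> S" for x
        using that fS by (simp add: of_bool_def if_distrib cong: if_cong)
      ultimately show ?thesis
        unfolding D_def sum.distrib[symmetric] by (intro sum_mono) (simp add: sum.distrib)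
    qed
  qed (use K(1) r(2) vn in \<open>auto intro!: sum_nonneg\<close>)
  finally have mD: "m\<^sup>2 \<le> (3 * r) * ((\<Sum>x\<in>S. v x * v x) + D)" .
  have "(\<Sum>x\<in>S. v x * v x) \<le> (\<Sum>x\<in>S. (M1 * M2) * v x)"
    by (intro sum_mono mult_right_mono) (use vn vM in auto)
  also have "\<dots> = M1 * M2 * m" by (simp add: m sum_distrib_left)
  finally have "(3 * r) * ((\<Sum>x\<in>S. v x * v x) + D) \<le> 3 * r * (M1 * M2 * m + D)"
    using r(2) by simp
  then have "m\<^sup>2 \<le> 3 * r * (M1 * M2 * m + D)" using mD by simp
  moreover have "6 * r * M1 * M2 * m \<le> m * m"
    using mult_right_mono[OF m0, of m] mpos by simp
  ultimately have *: "m\<^sup>2 \<le> 6 * r * D" by (simp add: power2_eq_square algebra_simps)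
  have "D = (\<Sum>(x, x')\<in>{(x, x') \<in> S \<times> S. x \<noteq> x' \<and> i x' = i x \<and> j (l * x' + t) = j (l * x + t)}. v x * v x')"
    unfolding D_def sum.cartesian_product
    by (rule sum.mono_neutral_cong_right) (use fS in auto)
  also have "\<dots> = ?D"
  proof -
    have line: "(y' - y) / (x' - x) = l \<and> y - (y' - y) / (x' - x) * x = t
        \<longleftrightarrow> y = l * x + t \<and> y' = l * x' + t" if "x \<noteq> x'" for x x' y y'
    proof -
      have "(y' - y) / (x' - x) = l \<longleftrightarrow> y' - y = l * (x' - x)"
        using that by (simp add: divide_eq_eq)
      then show ?thesis by (auto simp: algebra_simps)
    qed
    have set: "{e \<in> {((x, x'), (y, y')) \<in> (A \<times> A) \<times> (B \<times> B). x \<noteq> x' \<and> i x' = i x \<and> j y' = j y}.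
        (\<lambda>((x, x'), (y, y')). ((y' - y) / (x' - x), y - (y' - y) / (x' - x) * x)) e = (l, t)}
      = {((x, x'), (y, y')) \<in> (A \<times> A) \<times> (B \<times> B).
          x \<noteq> x' \<and> i x' = i x \<and> j y' = j y \<and> y = l * x + t \<and> y' = l * x' + t}"
    proof (rule set_eqI)
      fix e :: "(real \<times> real) \<times> real \<times> real"
      obtain x x' y y' where e: "e = ((x, x'), (y, y'))" by (metis prod.exhaust)
      show "e \<in> {e \<in> {((x, x'), (y, y')) \<in> (A \<times> A) \<times> (B \<times> B). x \<noteq> x' \<and> i x' = i x \<and> j y' = j y}.
        (\<lambda>((x, x'), (y, y')). ((y' - y) / (x' - x), y - (y' - y) / (x' - x) * x)) e = (l, t)}
        \<longleftrightarrow> e \<in> {((x, x'), (y, y')) \<in> (A \<times> A) \<times> (B \<times> B).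
          x \<noteq> x' \<and> i x' = i x \<and> j y' = j y \<and> y = l * x + t \<and> y' = l * x' + t}"
        unfolding e mem_Collect_eq prod.case prod.inject using line[of x x' y' y] by blast
    qed
    have "?D = (\<Sum>((x, x'), (y, y'))\<in>{((x, x'), (y, y')) \<in> (A \<times> A) \<times> (B \<times> B).
          x \<noteq> x' \<and> i x' = i x \<and> j y' = j y \<and> y = l * x + t \<and> y' = l * x' + t}.
          (p x * p x') * (q y * q y'))"
      unfolding push_def by (rule sum.cong[OF set refl])
    moreover have "(\<Sum>(x, x')\<in>{(x, x') \<in> S \<times> S. x \<noteq> x' \<and> i x' = i x \<and>
            j (l * x' + t) = j (l * x + t)}. v x * v x') = \<dots>"
      by (rule sum.reindex_bij_witness[where i = fst and
          j = "\<lambda>(x, x'). ((x, x'), (l * x + t, l * x' + t))"])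
        (auto simp: S_def v_def)
    ultimately show ?thesis by simp
  qed
  finally show ?thesis using * unfolding m_def by simp
qed

text \<open>A weighted Szemeredi-Trotter bound for a cartesian product: two points in a common cell
  lie on at most one line, and a line meets few cells.\<close>

theorem rich_lines:
  assumes fin: "finite A" "finite B" and nn: "\<And>x. x \<in> A \<Longrightarrow> 0 \<le> p x" "\<And>y. y \<in> B \<Longrightarrow> 0 \<le> q y"
    and sup: "\<And>x. x \<in> A \<Longrightarrow> p x \<le> M1" "\<And>y. y \<in> B \<Longrightarrow> q y \<le> M2"
    and w: "sum p A \<le> w1" "sum q B \<le> w2" and M: "0 < M1" "0 < M2"
    and \<mu>: "6 * M1 * M2 \<le> \<mu>"
    and L: "finite L" "\<And>l t. (l, t) \<in> L \<Longrightarrow> l \<noteq> 0 \<and> \<mu> \<le> line_mass p A q B l t"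
  shows "(\<Sum>(l, t)\<in>L. (line_mass p A q B l t)\<^sup>2) \<le> 54 * M1 * M2 * w1\<^sup>2 * w2\<^sup>2 / \<mu>"
proof (cases "L = {}")
  case True
  have "0 < \<mu>" using \<mu> M by (smt (verit) mult_pos_pos)
  with True M show ?thesis by simp
next
  case False
  then obtain l0 t0 where lt0: "(l0, t0) \<in> L" by auto
  define r where "r = \<mu> / (6 * M1 * M2)"
  have r1: "1 \<le> r" using \<mu> M by (simp add: r_def field_simps)
  have \<mu>0: "0 < \<mu>" using \<mu> M by (smt (verit) mult_pos_pos)
  define S where "S = {x\<in>A. l0 * x + t0 \<in> B}"
  have fS: "finite S" using fin by (simp add: S_def)
  have m0: "\<mu> \<le> (\<Sum>x\<in>S. p x * q (l0 * x + t0))" and l0: "l0 \<noteq> 0"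
    using L(2)[OF lt0] line_mass_alt[OF fin] by (auto simp: S_def)
  have "(\<Sum>x\<in>S. p x * q (l0 * x + t0)) \<le> (\<Sum>x\<in>S. p x * M2)"
    by (intro sum_mono mult_left_mono) (use sup nn in \<open>auto simp: S_def\<close>)
  also have "\<dots> \<le> sum p A * M2"
    unfolding sum_distrib_right by (rule sum_mono2) (use nn M fin in \<open>auto simp: S_def\<close>)
  also have "\<dots> \<le> w1 * M2" using w M by simp
  finally have 1: "\<mu> \<le> w1 * M2" using m0 by simp
  have "(\<Sum>x\<in>S. p x * q (l0 * x + t0)) \<le> (\<Sum>x\<in>S. M1 * q (l0 * x + t0))"
    by (intro sum_mono mult_right_mono) (use sup nn in \<open>auto simp: S_def\<close>)
  also have "\<dots> = (\<Sum>y\<in>(\<lambda>x. l0 * x + t0) ` S. M1 * q y)"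
    by (subst sum.reindex) (use l0 in \<open>auto simp: inj_on_def\<close>)
  also have "\<dots> \<le> M1 * sum q B"
    unfolding sum_distrib_left by (rule sum_mono2) (use nn M fin in \<open>auto simp: S_def\<close>)
  also have "\<dots> \<le> M1 * w2" using w M by simp
  finally have 2: "\<mu> \<le> M1 * w2" using m0 by simp
  have w0: "0 < w1" "0 < w2"
    using less_le_trans[OF \<mu>0 1] less_le_trans[OF \<mu>0 2] M by (simp_all add: zero_less_mult_iff)
  \<comment> \<open>Since \<open>\<mu> = 6 * r * M1 * M2\<close>, a single rich line already forces
    every atom to be at most a sixth of a block. A block then weighs at most \<open>7/6\<close> of
    its nominal mass, which produces the \<open>49/6\<close> below; it is rounded up to 9, and
    \<open>54 = 9 * 6\<close>.\<close>
  have M1: "M1 \<le> w1 / (6 * r)" and M2: "M2 \<le> w2 / (6 * r)"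
    using 1 2 M \<mu>0 by (auto simp: r_def field_simps)
  define i where "i = cell p A (w1 / r)"
  define j where "j = cell q B (w2 / r)"
  define E where "E = {((x, x'), (y, y')) \<in> (A \<times> A) \<times> (B \<times> B). x \<noteq> x' \<and> i x' = i x \<and> j y' = j y}"
  define W where "W = (\<lambda>((x, x'), (y, y')). (p x * p x') * (q y * q y'))"
  define \<kappa> :: "(real \<times> real) \<times> (real \<times> real) \<Rightarrow> real \<times> real"
    where "\<kappa> = (\<lambda>((x, x'), (y, y')). ((y' - y) / (x' - x), y - (y' - y) / (x' - x) * x))"
  have fE: "finite E" unfolding E_def
    by (rule finite_subset[of _ "(A \<times> A) \<times> (B \<times> B)"]) (use fin in auto)
  have Wn: "0 \<le> W e" if "e \<in> E" for e using that nn by (auto simp: E_def W_def)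
  have "sum W E = (\<Sum>((x, x'), (y, y'))\<in>E.
      (p x * p x' * of_bool (i x' = i x)) * (q y * q y' * of_bool (j y' = j y)))"
    by (intro sum.cong) (auto simp: E_def W_def)
  also have "\<dots> \<le> (\<Sum>((x, x'), (y, y'))\<in>(A \<times> A) \<times> (B \<times> B).
      (p x * p x' * of_bool (i x' = i x)) * (q y * q y' * of_bool (j y' = j y)))"
    by (rule sum_mono2) (use fin nn in \<open>auto simp: E_def\<close>)
  also have "\<dots> = (\<Sum>x\<in>A. \<Sum>x'\<in>A. p x * p x' * of_bool (i x' = i x)) *
      (\<Sum>y\<in>B. \<Sum>y'\<in>B. q y * q y' * of_bool (j y' = j y))"
    by (simp add: sum.cartesian_product sum_product split_def)
  also have "\<dots> \<le> (w1 * (w1 / r + M1)) * (w2 * (w2 / r + M2))"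
    unfolding i_def j_def
    by (intro mult_mono cell_pair_mass_le sum_nonneg) (use fin nn sup w w0 M r1 in auto)
  also have "\<dots> \<le> (w1 * (7 / 6 * (w1 / r))) * (w2 * (7 / 6 * (w2 / r)))"
    using M1 M2 w0 M r1 by (intro mult_mono mult_left_mono) (auto simp: field_simps)
  finally have WE: "sum W E \<le> (w1 * (7 / 6 * (w1 / r))) * (w2 * (7 / 6 * (w2 / r)))" .
  have line: "(line_mass p A q B l t)\<^sup>2 \<le> 6 * r * push E W \<kappa> (l, t)" if "(l, t) \<in> L" for l t
    unfolding E_def W_def \<kappa>_def i_def j_def
    by (rule rich_line_pairs[OF fin nn sup w w0 M _ r_def r1]) (use L(2)[OF that] in auto)
  have "(\<Sum>(l, t)\<in>L. (line_mass p A q B l t)\<^sup>2) \<le> (\<Sum>e\<in>L. 6 * r * push E W \<kappa> e)"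
    by (intro sum_mono) (auto intro: line)
  also have "\<dots> = 6 * r * (\<Sum>e\<in>L. push E W \<kappa> e)" by (simp add: sum_distrib_left)
  also have "\<dots> \<le> 6 * r * sum W E"
    by (intro mult_left_mono sum_push_le) (use fE L Wn r1 in auto)
  also have "\<dots> \<le> 6 * r * ((w1 * (7 / 6 * (w1 / r))) * (w2 * (7 / 6 * (w2 / r))))"
    using r1 by (intro mult_left_mono WE) auto
  also have "\<dots> = (49 / 6) * (w1\<^sup>2 * w2\<^sup>2) / r"
    using r1 by (simp add: field_simps power2_eq_square)
  also have "\<dots> \<le> 9 * (w1\<^sup>2 * w2\<^sup>2) / r"
    using r1 w0 by (intro divide_right_mono mult_right_mono) auto
  also have "\<dots> = 54 * M1 * M2 * w1\<^sup>2 * w2\<^sup>2 / \<mu>"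
    by (simp add: r_def)
  finally show ?thesis .
qed

section \<open>Second moments of line masses over weighted slopes\<close>

lemma line_mass_nonneg:
  assumes "\<And>x. x \<in> A \<Longrightarrow> 0 \<le> p x" "\<And>y. y \<in> B \<Longrightarrow> 0 \<le> q y"
  shows "0 \<le> line_mass p A q B l t"
  unfolding line_mass_def by (rule push_nonneg) (use assms in auto)

lemma sum_line_mass_le:
  assumes "finite A" "finite B" "\<And>x. x \<in> A \<Longrightarrow> 0 \<le> p x" "\<And>y. y \<in> B \<Longrightarrow> 0 \<le> q y" "finite T"
    and "sum p A \<le> w1" "sum q B \<le> w2"
  shows "(\<Sum>t\<in>T. line_mass p A q B l t) \<le> w1 * w2"
proof -
  have "(\<Sum>t\<in>T. line_mass p A q B l t) \<le> (\<Sum>(x, y)\<in>A \<times> B. p x * q y)"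
    unfolding line_mass_def by (rule sum_push_le) (use assms in auto)
  also have "\<dots> = sum p A * sum q B"
    by (simp add: sum_product sum.cartesian_product)
  also have "\<dots> \<le> w1 * w2"
    by (rule mult_mono) (use assms in \<open>auto intro!: sum_nonneg order.trans[OF sum_nonneg assms(6)]\<close>)
  finally show ?thesis .
qed

text \<open>Lines of mass below \<open>\<mu> + 6 * M1 * M2\<close> are handled by taking out one
  factor and summing the other over all intercepts; the richer ones by \<open>\<rho> \<le> R\<close>
  and the bound for rich lines. The summand \<open>6 * M1 * M2\<close> makes the threshold
  admissible for every positive \<open>\<mu>\<close>, so that \<open>\<mu>\<close> can be chosen to
  balance the two terms.\<close>

lemma weighted_line_energy:
  fixes \<rho> :: "real \<Rightarrow> real"
  assumes fin: "finite A" "finite B" and nn: "\<And>x. x \<in> A \<Longrightarrow> 0 \<le> p x" "\<And>y. y \<in> B \<Longrightarrow> 0 \<le> q y"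
    and sup: "\<And>x. x \<in> A \<Longrightarrow> p x \<le> M1" "\<And>y. y \<in> B \<Longrightarrow> q y \<le> M2"
    and w: "sum p A \<le> w1" "sum q B \<le> w2" and M: "0 < M1" "0 < M2"
    and \<mu>: "0 < \<mu>"
    and \<Lambda>: "finite \<Lambda>" "0 \<notin> \<Lambda>" "\<And>l. l \<in> \<Lambda> \<Longrightarrow> finite (T l)"
    and \<rho>: "\<And>l. l \<in> \<Lambda> \<Longrightarrow> 0 \<le> \<rho> l" "\<And>l. l \<in> \<Lambda> \<Longrightarrow> \<rho> l \<le> R" "sum \<rho> \<Lambda> \<le> P" "0 \<le> R"
  shows "(\<Sum>l\<in>\<Lambda>. \<rho> l * (\<Sum>t\<in>T l. (line_mass p A q B l t)\<^sup>2))
    \<le> (\<mu> + 6 * M1 * M2) * (w1 * w2) * P + R * (54 * M1 * M2 * w1\<^sup>2 * w2\<^sup>2 / \<mu>)"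
proof -
  define m where "m l t = line_mass p A q B l t" for l t
  define \<mu>' where "\<mu>' = \<mu> + 6 * M1 * M2"
  have MM: "0 < M1 * M2" using M by simp
  then have \<mu>': "0 < \<mu>'" "\<mu> \<le> \<mu>'" "6 * M1 * M2 \<le> \<mu>'" using \<mu> by (auto simp: \<mu>'_def)
  have m0: "0 \<le> m l t" for l t unfolding m_def by (rule line_mass_nonneg) (use nn in auto)
  have ww: "0 \<le> w1 * w2"
    using order.trans[OF sum_nonneg w(1)] order.trans[OF sum_nonneg w(2)] nn by simp
  define L where "L = {(l, t) \<in> Sigma \<Lambda> T. \<mu>' \<le> m l t}"
  have fL: "finite L" unfolding L_def using \<Lambda> by (auto intro: finite_subset[of _ "Sigma \<Lambda> T"])
  have "(\<Sum>l\<in>\<Lambda>. \<rho> l * (\<Sum>t\<in>T l. (m l t)\<^sup>2))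
      \<le> (\<Sum>l\<in>\<Lambda>. \<Sum>t\<in>T l. \<mu>' * \<rho> l * m l t + R * (if \<mu>' \<le> m l t then (m l t)\<^sup>2 else 0))"
    unfolding sum_distrib_left
  proof (intro sum_mono)
    fix l t assume "l \<in> \<Lambda>" "t \<in> T l"
    show "\<rho> l * (m l t)\<^sup>2 \<le> \<mu>' * \<rho> l * m l t + R * (if \<mu>' \<le> m l t then (m l t)\<^sup>2 else 0)"
    proof (cases "\<mu>' \<le> m l t")
      case True
      have "\<rho> l * (m l t)\<^sup>2 \<le> R * (m l t)\<^sup>2"
        using \<rho> \<open>l \<in> \<Lambda>\<close> by (intro mult_right_mono) auto
      moreover have "0 \<le> \<mu>' * \<rho> l * m l t" using \<rho> \<open>l \<in> \<Lambda>\<close> m0 \<mu>' by simp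
      ultimately show ?thesis using True by simp
    next
      case False
      have "\<rho> l * (m l t * m l t) \<le> \<rho> l * (\<mu>' * m l t)"
        using \<rho> \<open>l \<in> \<Lambda>\<close> m0[of l t] False by (intro mult_left_mono mult_right_mono) auto
      with False show ?thesis by (simp add: power2_eq_square algebra_simps)
    qed
  qed
  also have "\<dots> = \<mu>' * (\<Sum>l\<in>\<Lambda>. \<rho> l * (\<Sum>t\<in>T l. m l t))
      + R * (\<Sum>l\<in>\<Lambda>. \<Sum>t\<in>T l. if \<mu>' \<le> m l t then (m l t)\<^sup>2 else 0)"
    by (simp add: sum.distrib sum_distrib_left mult.assoc)
  also have "\<dots> \<le> \<mu>' * ((w1 * w2) * P) + R * (54 * M1 * M2 * w1\<^sup>2 * w2\<^sup>2 / \<mu>)"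
  proof (intro add_mono mult_left_mono)
    have "(\<Sum>l\<in>\<Lambda>. \<rho> l * (\<Sum>t\<in>T l. m l t)) \<le> (\<Sum>l\<in>\<Lambda>. \<rho> l * (w1 * w2))"
      unfolding m_def
      by (intro sum_mono mult_left_mono sum_line_mass_le) (use fin nn w \<Lambda> \<rho> in auto)
    also have "\<dots> = (w1 * w2) * sum \<rho> \<Lambda>" by (simp add: sum_distrib_left mult.commute)
    also have "\<dots> \<le> (w1 * w2) * P" using ww \<rho> by (intro mult_left_mono)
    finally show "(\<Sum>l\<in>\<Lambda>. \<rho> l * (\<Sum>t\<in>T l. m l t)) \<le> (w1 * w2) * P" .
    have "(\<Sum>l\<in>\<Lambda>. \<Sum>t\<in>T l. if \<mu>' \<le> m l t then (m l t)\<^sup>2 else 0) = (\<Sum>(l, t)\<in>L. (m l t)\<^sup>2)"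
      using \<Lambda> by (subst sum.Sigma) (auto simp: L_def intro!: sum.mono_neutral_cong_right split: if_splits)
    also have "\<dots> \<le> 54 * M1 * M2 * w1\<^sup>2 * w2\<^sup>2 / \<mu>'"
      unfolding m_def
    proof (rule rich_lines[OF fin nn sup w M \<mu>'(3) fL])
      show "l \<noteq> 0 \<and> \<mu>' \<le> line_mass p A q B l t" if "(l, t) \<in> L" for l t
        using that \<Lambda>(2) by (auto simp: L_def m_def)
    qed
    also have "\<dots> \<le> 54 * M1 * M2 * w1\<^sup>2 * w2\<^sup>2 / \<mu>"
      using \<mu> \<mu>' M by (intro divide_left_mono) auto
    finally show "(\<Sum>l\<in>\<Lambda>. \<Sum>t\<in>T l. if \<mu>' \<le> m l t then (m l t)\<^sup>2 else 0)
        \<le> 54 * M1 * M2 * w1\<^sup>2 * w2\<^sup>2 / \<mu>" .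
  qed (use \<mu>' \<rho> in auto)
  finally show ?thesis by (simp add: m_def \<mu>'_def mult.assoc)
qed

section \<open>The ratio distribution of a bounded weight\<close>

lemma line_mass_le:
  assumes "finite A" "finite B" "\<And>x. x \<in> A \<Longrightarrow> 0 \<le> p x" "\<And>y. y \<in> B \<Longrightarrow> q y \<le> M" "0 \<le> M"
    and "sum p A \<le> w"
  shows "line_mass p A q B l t \<le> w * M"
proof -
  have "line_mass p A q B l t \<le> (\<Sum>x\<in>{x\<in>A. l * x + t \<in> B}. p x * M)"
    unfolding line_mass_alt[OF assms(1,2)]
    by (intro sum_mono mult_left_mono) (use assms in auto)
  also have "\<dots> \<le> (\<Sum>x\<in>A. p x * M)"
    by (rule sum_mono2) (use assms in auto)
  also have "\<dots> \<le> w * M"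
    unfolding sum_distrib_right[symmetric] by (intro mult_right_mono) (use assms in auto)
  finally show ?thesis .
qed

text \<open>From a weak-type bound to a third moment; \<open>\<delta>\<close> is the ratio of consecutive levels.\<close>

lemma cube_sum_levels:
  fixes f w :: "'i \<Rightarrow> real"
  assumes fin: "finite S" and f: "\<And>x. x \<in> S \<Longrightarrow> 0 \<le> f x" "\<And>x. x \<in> S \<Longrightarrow> f x \<le> 1"
    and w: "\<And>x. x \<in> S \<Longrightarrow> 0 \<le> w x"
    and D: "\<And>K. 0 < K \<Longrightarrow> (\<Sum>x\<in>{x\<in>S. K \<le> f x}. w x * (f x)\<^sup>2) \<le> D / K"
    and \<delta>: "0 < \<delta>" "\<delta> \<le> 1"
  shows "(\<Sum>x\<in>{x\<in>S. \<delta> ^ n \<le> f x}. w x * f x ^ 3) \<le> (n + 1) * (D / \<delta>)"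
proof (induction n)
  case 0
  have "0 \<le> (\<Sum>x\<in>{x\<in>S. 1 \<le> f x}. w x * (f x)\<^sup>2)" by (rule sum_nonneg) (use w in auto)
  then have "0 \<le> D" using D[of 1] by simp
  have "(\<Sum>x\<in>{x\<in>S. 1 \<le> f x}. w x * f x ^ 3) \<le> (\<Sum>x\<in>{x\<in>S. 1 \<le> f x}. w x * (f x)\<^sup>2)"
    by (intro sum_mono mult_left_mono power_decreasing) (use f w in auto)
  also have "\<dots> \<le> D" using D[of 1] by simp
  also have "\<dots> \<le> D / \<delta>" using \<open>0 \<le> D\<close> \<delta> by (simp add: le_divide_eq mult_left_le)
  finally show ?case by simp
next
  case (Suc n)
  have eq: "{x\<in>S. \<delta> ^ Suc n \<le> f x} = {x\<in>S. \<delta> ^ n \<le> f x} \<union> {x\<in>S. \<delta> ^ Suc n \<le> f x \<and> f x < \<delta> ^ n}"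
    using power_decreasing[of n "Suc n" \<delta>] \<delta> by (auto simp del: power_Suc)
  have "(\<Sum>x\<in>{x\<in>S. \<delta> ^ Suc n \<le> f x \<and> f x < \<delta> ^ n}. w x * f x ^ 3)
      \<le> (\<Sum>x\<in>{x\<in>S. \<delta> ^ Suc n \<le> f x \<and> f x < \<delta> ^ n}. \<delta> ^ n * (w x * (f x)\<^sup>2))"
  proof (rule sum_mono)
    fix x assume "x \<in> {x\<in>S. \<delta> ^ Suc n \<le> f x \<and> f x < \<delta> ^ n}"
    then have "f x * (w x * (f x)\<^sup>2) \<le> \<delta> ^ n * (w x * (f x)\<^sup>2)"
      using w by (intro mult_right_mono) auto
    then show "w x * f x ^ 3 \<le> \<delta> ^ n * (w x * (f x)\<^sup>2)"
      by (simp add: power2_eq_square power3_eq_cube algebra_simps)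
  qed
  also have "\<dots> \<le> (\<Sum>x\<in>{x\<in>S. \<delta> ^ Suc n \<le> f x}. \<delta> ^ n * (w x * (f x)\<^sup>2))"
    by (rule sum_mono2) (use fin w \<delta> in auto)
  also have "\<dots> \<le> \<delta> ^ n * (D / \<delta> ^ Suc n)"
    unfolding sum_distrib_left[symmetric] using \<delta> by (intro mult_left_mono D) auto
  also have "\<dots> = D / \<delta>" using \<delta> by simp
  finally have "(\<Sum>x\<in>{x\<in>S. \<delta> ^ Suc n \<le> f x \<and> f x < \<delta> ^ n}. w x * f x ^ 3) \<le> D / \<delta>" .
  moreover have "(\<Sum>x\<in>{x\<in>S. \<delta> ^ Suc n \<le> f x}. w x * f x ^ 3) =
      (\<Sum>x\<in>{x\<in>S. \<delta> ^ n \<le> f x}. w x * f x ^ 3) +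
      (\<Sum>x\<in>{x\<in>S. \<delta> ^ Suc n \<le> f x \<and> f x < \<delta> ^ n}. w x * f x ^ 3)"
    unfolding eq by (rule sum.union_disjoint) (use fin in auto)
  moreover have "(real (Suc n) + 1) * (D / \<delta>) = (real n + 1) * (D / \<delta>) + D / \<delta>"
    by (simp only: of_nat_Suc distrib_right)
  ultimately show ?case using Suc by linarith
qed

text \<open>With ratio \<open>M powr (1/200)\<close>, 400 levels reach from 1 down to
  \<open>M\<^sup>2\<close>, and below that two of the three factors already give \<open>M^4\<close>.
  The number of levels is absolute, so the only loss is one ratio: the exponent
  \<open>3 - 1/200\<close>. The constant covers \<open>401 * 433 + 1\<close>.\<close>

lemma cube_sum_le:
  fixes f w :: "'i \<Rightarrow> real"
  assumes fin: "finite S" and f: "\<And>x. x \<in> S \<Longrightarrow> 0 \<le> f x" "\<And>x. x \<in> S \<Longrightarrow> f x \<le> 1"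
    and w: "\<And>x. x \<in> S \<Longrightarrow> 0 \<le> w x" and mass: "(\<Sum>x\<in>S. w x * f x) \<le> 1"
    and D: "\<And>K. 0 < K \<Longrightarrow> (\<Sum>x\<in>{x\<in>S. K \<le> f x}. w x * (f x)\<^sup>2) \<le> 433 * M ^ 3 / K"
    and M: "0 < M" "M \<le> 1"
  shows "(\<Sum>x\<in>S. w x * f x ^ 3) \<le> 200000 * M powr (599 / 200)"
proof -
  define \<delta> where "\<delta> = M powr (1 / 200)"
  have \<delta>: "0 < \<delta>" "\<delta> \<le> 1" using M by (auto simp: \<delta>_def intro: powr_le1)
  have \<delta>400: "\<delta> ^ 400 = M\<^sup>2"
    using M by (simp add: \<delta>_def powr_power)
  have split: "(\<Sum>x\<in>S. w x * f x ^ 3) = (\<Sum>x\<in>{x\<in>S. \<delta> ^ 400 \<le> f x}. w x * f x ^ 3)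
      + (\<Sum>x\<in>{x\<in>S. f x < M\<^sup>2}. w x * f x ^ 3)"
    by (subst sum.union_disjoint[symmetric]) (use fin in \<open>auto simp: \<delta>400 intro: sum.cong\<close>)
  have "(\<Sum>x\<in>{x\<in>S. f x < M\<^sup>2}. w x * f x ^ 3) \<le> (\<Sum>x\<in>{x\<in>S. f x < M\<^sup>2}. M ^ 4 * (w x * f x))"
  proof (rule sum_mono)
    fix x assume x: "x \<in> {x\<in>S. f x < M\<^sup>2}"
    then have "(f x)\<^sup>2 * (w x * f x) \<le> (M\<^sup>2)\<^sup>2 * (w x * f x)"
      using f w by (intro mult_right_mono power_mono) auto
    then show "w x * f x ^ 3 \<le> M ^ 4 * (w x * f x)"
      by (simp add: power2_eq_square power3_eq_cube power4_eq_xxxx algebra_simps)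
  qed
  also have "\<dots> \<le> (\<Sum>x\<in>S. M ^ 4 * (w x * f x))"
    by (rule sum_mono2) (use fin w f M in auto)
  also have "\<dots> \<le> M ^ 4 * 1"
    unfolding sum_distrib_left[symmetric] using M mass by (intro mult_left_mono) auto
  finally have low: "(\<Sum>x\<in>{x\<in>S. f x < M\<^sup>2}. w x * f x ^ 3) \<le> M ^ 4" by simp
  have "(\<Sum>x\<in>{x\<in>S. \<delta> ^ 400 \<le> f x}. w x * f x ^ 3) \<le> (real 400 + 1) * (433 * M ^ 3 / \<delta>)"
    by (rule cube_sum_levels) (use fin f w D \<delta> in auto)
  also have "\<dots> = 401 * 433 * M powr (599 / 200)"
    using M powr_diff[of M 3 "1 / 200"] by (simp add: \<delta>_def)
  finally have "(\<Sum>x\<in>S. w x * f x ^ 3) \<le> 401 * 433 * M powr (599 / 200) + M ^ 4"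
    using split low by simp
  moreover have "M ^ 4 \<le> M powr (599 / 200)"
    using M powr_mono'[of "599/200" 4 M] by simp
  ultimately show ?thesis using powr_ge_zero[of M "599 / 200"] by linarith
qed

section \<open>Quotients of differences for a weight without large atoms\<close>

locale bounded_weight =
  fixes A :: "real set" and \<alpha> :: "real \<Rightarrow> real" and M :: real
  assumes fin: "finite A"
    and nonneg: "\<And>a. a \<in> A \<Longrightarrow> 0 \<le> \<alpha> a"
    and le_M: "\<And>a. a \<in> A \<Longrightarrow> \<alpha> a \<le> M"
    and mass: "sum \<alpha> A \<le> 1"
    and M: "0 < M" "M \<le> 1"
begin

definition "A0 = A - {0}"

definition \<phi> :: "real \<Rightarrow> real" where
  "\<phi> = push (A0 \<times> A \<times> A) (\<lambda>(b, a, a'). \<alpha> b * \<alpha> a * \<alpha> a') (\<lambda>(b, a, a'). (a - a') / b)"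

definition "Z = (\<lambda>(b, a, a'). (a - a') / b) ` (A0 \<times> A \<times> A)"

definition "J = (\<Sum>z\<in>Z. (\<phi> z)\<^sup>2)"

lemma fin_A0: "finite A0" and A0_sub: "A0 \<subseteq> A"
  using fin by (auto simp: A0_def)

lemma A0_D: "b \<in> A0 \<Longrightarrow> b \<in> A" "b \<in> A0 \<Longrightarrow> b \<noteq> 0"
  by (auto simp: A0_def)

lemma fin_Z: "finite Z"
  using fin fin_A0 by (simp add: Z_def)

lemma mass_A0: "sum \<alpha> A0 \<le> 1"
  using sum_mono2[OF fin A0_sub, of \<alpha>] nonneg mass by fastforce

lemma phi_nonneg: "0 \<le> \<phi> z"
  unfolding \<phi>_def by (rule push_nonneg) (use nonneg in \<open>auto dest: A0_D\<close>)

lemma sum_phi_mult: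
  "(\<Sum>z\<in>Z. \<phi> z * F z) = (\<Sum>b\<in>A0. \<Sum>a\<in>A. \<Sum>a'\<in>A. \<alpha> b * \<alpha> a * \<alpha> a' * F ((a - a') / b))"
  unfolding \<phi>_def using fin fin_A0
  by (subst sum_push_mult) (auto simp: Z_def sum.cartesian_product split_def)

lemma sum_phi_le: "sum \<phi> Z \<le> 1"
proof -
  have "sum \<phi> Z = sum \<alpha> A0 * (sum \<alpha> A * sum \<alpha> A)"
    using sum_phi_mult[of "\<lambda>_. 1"]
    by (simp flip: sum_distrib_left sum_distrib_right)
  also have "\<dots> \<le> 1 * (1 * 1)"
    by (intro mult_mono mass mass_A0) (auto intro!: sum_nonneg mult_nonneg_nonneg nonneg dest: A0_D)
  finally show ?thesis by simp
qed

lemma phi_uminus: "\<phi> (- z) = \<phi> z"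
  unfolding \<phi>_def push_def
  by (rule sum.reindex_bij_witness[where i = "\<lambda>(b, a, a'). (b, a', a)" and j = "\<lambda>(b, a, a'). (b, a', a)"])
    (auto dest: A0_D simp: field_simps)

text \<open>The equation \<open>(a - a') / b = z\<close> puts the point \<open>(b, a)\<close> on the
  line of slope \<open>z\<close> with intercept \<open>a'\<close>.\<close>

lemma phi_lines: "\<phi> z = (\<Sum>a'\<in>A. \<alpha> a' * line_mass \<alpha> A0 \<alpha> A z a')"
proof -
  have "\<phi> z = (\<Sum>(a', b)\<in>{(a', b). a' \<in> A \<and> b \<in> A0 \<and> z * b + a' \<in> A}. \<alpha> a' * (\<alpha> b * \<alpha> (z * b + a')))"
    unfolding \<phi>_def push_def
    by (rule sum.reindex_bij_witness[where j = "\<lambda>(b, a, a'). (a', b)" and i = "\<lambda>(a', b). (b, z * b + a', a')"])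
      (auto dest: A0_D simp: field_simps)
  also have "\<dots> = (\<Sum>(a', b)\<in>Sigma A (\<lambda>a'. {b\<in>A0. z * b + a' \<in> A}). \<alpha> a' * (\<alpha> b * \<alpha> (z * b + a')))"
    by (rule sum.cong) auto
  also have "\<dots> = (\<Sum>a'\<in>A. \<alpha> a' * line_mass \<alpha> A0 \<alpha> A z a')"
    using fin fin_A0 by (subst sum.Sigma[symmetric]) (auto simp: line_mass_alt sum_distrib_left)
  finally show ?thesis .
qed

lemma phi_le: "\<phi> z \<le> M"
proof -
  have "\<phi> z \<le> (\<Sum>a'\<in>A. \<alpha> a' * (1 * M))"
    unfolding phi_lines
    by (intro sum_mono mult_left_mono line_mass_le) (use fin fin_A0 nonneg le_M M mass_A0 in \<open>auto dest: A0_D\<close>)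
  also have "\<dots> = sum \<alpha> A * M" by (simp add: sum_distrib_right)
  also have "\<dots> \<le> 1 * M" using mass M by (intro mult_right_mono) auto
  finally show ?thesis by simp
qed

lemma sum_sq_le: "(\<Sum>a\<in>A. (\<alpha> a)\<^sup>2) \<le> M"
proof -
  have "(\<Sum>a\<in>A. (\<alpha> a)\<^sup>2) \<le> (\<Sum>a\<in>A. M * \<alpha> a)"
    unfolding power2_eq_square by (intro sum_mono mult_right_mono) (use nonneg le_M in auto)
  also have "\<dots> = M * sum \<alpha> A" by (simp add: sum_distrib_left)
  also have "\<dots> \<le> M * 1" using mass M by (intro mult_left_mono) auto
  finally show ?thesis by simp
qed

text \<open>At least half of \<open>\<phi> z\<close> comes from intercepts whose line has mass at
  least \<open>K / 2\<close>. Cauchy-Schwarz against the second moment of \<open>\<alpha>\<close>,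
  which is at most \<open>M\<close>, passes to the squared masses of these rich lines, with constant
  \<open>432 = 4 * 54 * 2\<close>. For \<open>K < 12 * M\<^sup>2\<close> the trivial bound
  \<open>M\<close> is good enough. The point \<open>z = 0\<close> corresponds to horizontal lines,
  which the bound for rich lines excludes; it is the last unit of 433.\<close>

lemma phi_tail:
  assumes "0 < K"
  shows "(\<Sum>z\<in>{z\<in>Z. K \<le> \<phi> z}. (\<phi> z)\<^sup>2) \<le> 433 * M ^ 3 / K"
proof (cases "K < 12 * M\<^sup>2")
  case True
  have "(\<Sum>z\<in>{z\<in>Z. K \<le> \<phi> z}. (\<phi> z)\<^sup>2) \<le> (\<Sum>z\<in>Z. M * \<phi> z)"
    unfolding power2_eq_square
    by (rule order.trans[OF sum_mono sum_mono2])
      (use fin_Z phi_nonneg phi_le M in \<open>auto intro!: mult_right_mono\<close>)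
  also have "\<dots> = M * sum \<phi> Z" by (simp add: sum_distrib_left)
  also have "\<dots> \<le> M * 1" using M sum_phi_le by (intro mult_left_mono) auto
  also have "\<dots> \<le> 433 * M ^ 3 / K"
    using True assms M by (simp add: field_simps power2_eq_square power3_eq_cube)
  finally show ?thesis .
next
  case False
  define \<mu> where "\<mu> = K / 2"
  have \<mu>: "6 * M * M \<le> \<mu>" using False by (simp add: \<mu>_def power2_eq_square)
  define m where "m z t = line_mass \<alpha> A0 \<alpha> A z t" for z t
  have m0: "0 \<le> m z t" for z t
    unfolding m_def by (rule line_mass_nonneg) (use nonneg in \<open>auto dest: A0_D\<close>)
  define Z' where "Z' = {z\<in>Z. K \<le> \<phi> z} - {0}"
  define L where "L = (SIGMA z:Z'. {t\<in>A. \<mu> \<le> m z t})"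
  have fZ': "finite Z'" using fin_Z by (simp add: Z'_def)
  have fL: "finite L" using fZ' fin by (auto simp: L_def)
  have sq: "(\<phi> z)\<^sup>2 \<le> 4 * M * (\<Sum>t\<in>{t\<in>A. \<mu> \<le> m z t}. (m z t)\<^sup>2)" if "z \<in> Z'" for z
  proof -
    define s where "s = (\<Sum>t\<in>{t\<in>A. \<mu> \<le> m z t}. \<alpha> t * m z t)"
    have "\<phi> z = s + (\<Sum>t\<in>{t\<in>A. m z t < \<mu>}. \<alpha> t * m z t)"
      unfolding s_def phi_lines m_def[symmetric]
      by (subst sum.union_disjoint[symmetric]) (use fin in \<open>auto intro: sum.cong\<close>)
    also have "(\<Sum>t\<in>{t\<in>A. m z t < \<mu>}. \<alpha> t * m z t) \<le> (\<Sum>t\<in>{t\<in>A. m z t < \<mu>}. \<alpha> t * \<mu>)"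
      by (intro sum_mono mult_left_mono) (use nonneg in auto)
    also have "\<dots> \<le> (\<Sum>t\<in>A. \<alpha> t * \<mu>)"
      by (rule sum_mono2) (use fin nonneg assms in \<open>auto simp: \<mu>_def\<close>)
    also have "\<dots> = sum \<alpha> A * \<mu>" by (simp add: sum_distrib_right)
    also have "\<dots> \<le> 1 * \<mu>" using mass assms by (intro mult_right_mono) (auto simp: \<mu>_def)
    finally have "\<phi> z \<le> s + \<mu>" by simp
    moreover have "2 * \<mu> \<le> \<phi> z" using that by (simp add: \<mu>_def Z'_def)
    ultimately have "\<phi> z \<le> 2 * s" by simp
    then have "(\<phi> z)\<^sup>2 \<le> (2 * s)\<^sup>2" using phi_nonneg by (intro power_mono)
    also have "\<dots> = 4 * s\<^sup>2" by (simp add: power_mult_distrib)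
    also have "s\<^sup>2 \<le> (\<Sum>t\<in>{t\<in>A. \<mu> \<le> m z t}. (\<alpha> t)\<^sup>2) * (\<Sum>t\<in>{t\<in>A. \<mu> \<le> m z t}. (m z t)\<^sup>2)"
      unfolding s_def by (rule Cauchy_Schwarz_ineq_sum)
    also have "\<dots> \<le> M * (\<Sum>t\<in>{t\<in>A. \<mu> \<le> m z t}. (m z t)\<^sup>2)"
      by (intro mult_right_mono order.trans[OF sum_mono2 sum_sq_le]) (use fin in \<open>auto intro: sum_nonneg\<close>)
    finally show ?thesis by simp
  qed
  have "(\<Sum>z\<in>Z'. (\<phi> z)\<^sup>2) \<le> (\<Sum>z\<in>Z'. 4 * M * (\<Sum>t\<in>{t\<in>A. \<mu> \<le> m z t}. (m z t)\<^sup>2))"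
    by (intro sum_mono sq)
  also have "\<dots> = 4 * M * (\<Sum>(z, t)\<in>L. (m z t)\<^sup>2)"
    unfolding L_def using fZ' fin by (subst sum.Sigma[symmetric]) (auto simp: sum_distrib_left)
  also have "(\<Sum>(z, t)\<in>L. (m z t)\<^sup>2) \<le> 54 * M * M * 1\<^sup>2 * 1\<^sup>2 / \<mu>"
    unfolding m_def
    by (rule rich_lines[OF fin_A0 fin _ _ _ _ mass_A0 mass M(1) M(1) \<mu> fL])
      (use nonneg le_M in \<open>auto simp: L_def m_def Z'_def dest: A0_D\<close>)
  also have "4 * M * (54 * M * M * 1\<^sup>2 * 1\<^sup>2 / \<mu>) = 432 * M ^ 3 / K"
    by (simp add: \<mu>_def power3_eq_cube)
  finally have 1: "(\<Sum>z\<in>Z'. (\<phi> z)\<^sup>2) \<le> 432 * M ^ 3 / K" using M by simp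
  have 2: "(\<phi> 0)\<^sup>2 \<le> M ^ 3 / K" if "K \<le> \<phi> 0"
  proof -
    have "K * (\<phi> 0)\<^sup>2 \<le> M * M\<^sup>2"
      using that phi_le[of 0] phi_nonneg[of 0] assms M
      by (intro mult_mono power_mono) auto
    then show ?thesis using assms by (simp add: field_simps power2_eq_square power3_eq_cube)
  qed
  have "(\<Sum>z\<in>{z\<in>Z. K \<le> \<phi> z}. (\<phi> z)\<^sup>2) \<le> (\<Sum>z\<in>Z'. (\<phi> z)\<^sup>2) + M ^ 3 / K"
  proof (cases "0 \<in> {z\<in>Z. K \<le> \<phi> z}")
    case True
    then show ?thesis using 2 fin_Z unfolding Z'_def by (subst sum.remove[of _ 0]) auto
  next
    case False
    then show ?thesis using assms M by (simp add: Z'_def)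
  qed
  also have "\<dots> \<le> 433 * M ^ 3 / K" using 1 by (simp add: add_divide_distrib[symmetric])
  finally show ?thesis .
qed

section \<open>Collisions of quotients as points on a common line\<close>

definition "m = line_mass \<alpha> A \<alpha> A"

definition "T l = (\<lambda>(x, y). y - l * x) ` (A \<times> A)" for l :: real

definition r :: "real \<Rightarrow> real" where
  "r = push (A0 \<times> A0) (\<lambda>(b, d). \<alpha> b * \<alpha> d) (\<lambda>(b, d). d / b)"

definition "\<Lambda> = (\<lambda>(b, d). d / b) ` (A0 \<times> A0)"

lemma fin_T: "finite (T l)" using fin by (simp add: T_def)

lemma fin_\<Lambda>: "finite \<Lambda>" using fin_A0 by (simp add: \<Lambda>_def)

lemma \<Lambda>_nonzero: "0 \<notin> \<Lambda>" by (auto simp: \<Lambda>_def dest: A0_D)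

lemma m_nonneg: "0 \<le> m l t"
  unfolding m_def by (rule line_mass_nonneg) (use nonneg in auto)

lemma m_le: "m l t \<le> M"
  unfolding m_def using line_mass_le[OF fin fin nonneg le_M _ mass] M by simp

lemma r_nonneg: "0 \<le> r l"
  unfolding r_def by (rule push_nonneg) (auto intro!: mult_nonneg_nonneg nonneg dest: A0_D)

lemma r_le: "r l \<le> M"
proof -
  have "r l = line_mass \<alpha> A0 \<alpha> A0 l 0"
    unfolding r_def line_mass_def push_def by (rule sum.cong) (auto dest: A0_D simp: field_simps)
  also have "\<dots> \<le> 1 * M"
    by (rule line_mass_le) (use fin_A0 nonneg le_M M mass_A0 in \<open>auto dest: A0_D\<close>)
  finally show ?thesis by simp
qed

lemma sum_r_mult:
  "(\<Sum>l\<in>\<Lambda>. r l * F l) = (\<Sum>(b, d)\<in>A0 \<times> A0. \<alpha> b * \<alpha> d * F (d / b))"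
  unfolding r_def using fin_A0
  by (subst sum_push_mult) (auto simp: \<Lambda>_def split_def)

lemma sum_r_le: "sum r \<Lambda> \<le> 1"
proof -
  have "sum r \<Lambda> = sum \<alpha> A0 * sum \<alpha> A0"
    using sum_r_mult[of "\<lambda>_. 1"] by (simp add: sum_product sum.cartesian_product)
  also have "\<dots> \<le> 1 * 1"
    by (intro mult_mono mass_A0) (auto intro!: sum_nonneg nonneg dest: A0_D)
  finally show ?thesis by simp
qed

lemma sum_m_le: "(\<Sum>t\<in>T l. m l t) \<le> 1"
  unfolding m_def using sum_line_mass_le[OF fin fin nonneg nonneg fin_T mass mass] by simp

lemma sum_m_sq:
  "(\<Sum>t\<in>T l. (m l t)\<^sup>2) = (\<Sum>i\<in>A \<times> A. \<Sum>j\<in>A \<times> A. (\<alpha> (fst i) * \<alpha> (snd i)) * (\<alpha> (fst j) * \<alpha> (snd j)) *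
      of_bool (snd j - l * fst j = snd i - l * fst i))"
  unfolding m_def line_mass_def using fin
  by (subst sum_push_sq) (auto simp: T_def split_def)

lemma sum_m_cube:
  "(\<Sum>t\<in>T l. m l t ^ 3) = (\<Sum>i\<in>A \<times> A. \<Sum>j\<in>A \<times> A. \<Sum>k\<in>A \<times> A.
      (\<alpha> (fst i) * \<alpha> (snd i)) * (\<alpha> (fst j) * \<alpha> (snd j)) * (\<alpha> (fst k) * \<alpha> (snd k)) *
      of_bool (snd j - l * fst j = snd i - l * fst i \<and> snd k - l * fst k = snd i - l * fst i))"
proof -
  have sq: "(m l t)\<^sup>2 = (\<Sum>j\<in>A \<times> A. \<Sum>k\<in>A \<times> A. (\<alpha> (fst j) * \<alpha> (snd j)) * (\<alpha> (fst k) * \<alpha> (snd k)) *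
      of_bool (snd j - l * fst j = t \<and> snd k - l * fst k = t))" for t
    unfolding m_def line_mass_def power2_eq_square using fin
    by (simp add: push_alt sum_product split_def of_bool_conj mult_ac)
  have "(\<Sum>t\<in>T l. m l t ^ 3) = (\<Sum>t\<in>T l. m l t * (m l t)\<^sup>2)"
    by (simp add: power2_eq_square power3_eq_cube mult.assoc)
  also have "\<dots> = (\<Sum>i\<in>A \<times> A. (\<alpha> (fst i) * \<alpha> (snd i)) * (m l (snd i - l * fst i))\<^sup>2)"
    unfolding m_def line_mass_def using fin
    by (subst sum_push_mult) (auto simp: T_def split_def)
  finally show ?thesis
    unfolding sq by (simp add: sum_distrib_left mult.assoc)
qed

lemma ratio_eq_iff:
  assumes "b \<in> A0" "d \<in> A0"
  shows "(c - c') / d = (a - a') / b \<longleftrightarrow> c - d / b * a = c' - d / b * a'"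
  using assms by (auto simp: A0_def field_simps)

lemma Z_I: "b \<in> A0 \<Longrightarrow> a \<in> A \<Longrightarrow> a' \<in> A \<Longrightarrow> (a - a') / b \<in> Z"
  by (force simp: Z_def)

text \<open>A collision \<open>(a - a') / b = (c - c') / d\<close> says that \<open>(a, c)\<close>
  and \<open>(a', c')\<close> lie on a common line of slope \<open>d / b\<close>. The result is the
  second moment wanted for commuting pairs, with one factor \<open>r l\<close> instead of two; the
  other factor costs only \<open>r_le\<close>.\<close>

lemma J_eq: "J = (\<Sum>l\<in>\<Lambda>. r l * (\<Sum>t\<in>T l. (m l t)\<^sup>2))"
proof -
  define I where "I = A0 \<times> A \<times> A"
  have fI: "finite I" using fin fin_A0 by (simp add: I_def)
  have "J = (\<Sum>i\<in>I. \<Sum>j\<in>I. (case i of (b, a, a') \<Rightarrow> \<alpha> b * \<alpha> a * \<alpha> a') * (case j of (b, a, a') \<Rightarrow> \<alpha> b * \<alpha> a * \<alpha> a')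
      * of_bool ((case j of (b, a, a') \<Rightarrow> (a - a') / b) = (case i of (b, a, a') \<Rightarrow> (a - a') / b)))"
    unfolding J_def \<phi>_def using fI by (subst sum_push_sq) (auto simp: Z_def I_def)
  also have "\<dots> = (\<Sum>(i, j)\<in>I \<times> I. (case i of (b, a, a') \<Rightarrow> \<alpha> b * \<alpha> a * \<alpha> a') * (case j of (b, a, a') \<Rightarrow> \<alpha> b * \<alpha> a * \<alpha> a')
      * of_bool ((case j of (b, a, a') \<Rightarrow> (a - a') / b) = (case i of (b, a, a') \<Rightarrow> (a - a') / b)))"
    by (simp add: sum.cartesian_product)
  also have "\<dots> = (\<Sum>(p, i, j)\<in>(A0 \<times> A0) \<times> (A \<times> A) \<times> (A \<times> A). \<alpha> (fst p) * \<alpha> (snd p) *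
      ((\<alpha> (fst i) * \<alpha> (snd i)) * (\<alpha> (fst j) * \<alpha> (snd j)) *
      of_bool (snd j - snd p / fst p * fst j = snd i - snd p / fst p * fst i)))"
    by (rule sum.reindex_bij_witness[where j = "\<lambda>((b, a, a'), (d, c, c')). ((b, d), (a', c'), (a, c))"
          and i = "\<lambda>((b, d), (a', c'), (a, c)). ((b, a, a'), (d, c, c'))"])
      (auto simp: I_def ratio_eq_iff)
  also have "\<dots> = (\<Sum>l\<in>\<Lambda>. r l * (\<Sum>t\<in>T l. (m l t)\<^sup>2))"
    unfolding sum_r_mult sum_m_sq by (simp add: sum.cartesian_product sum_distrib_left split_def)
  finally show ?thesis .
qed

text \<open>The threshold \<open>M powr (3/2)\<close> balances \<open>\<mu>\<close> against
  \<open>M^3 / \<mu>\<close>, and \<open>61 = 1 + 6 + 54\<close>. This is the bound to be improved,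
  and it also enters the improvement as a bound on the total mass of
  \<open>\<phi>\<^sup>2\<close>.\<close>

lemma J_le: "J \<le> 61 * M powr (3 / 2)"
proof -
  have "J \<le> (M powr (3/2) + 6 * M * M) * (1 * 1) * 1 + M * (54 * M * M * 1\<^sup>2 * 1\<^sup>2 / M powr (3/2))"
    unfolding J_eq m_def
    by (rule weighted_line_energy[OF fin fin nonneg nonneg le_M le_M mass mass])
      (use M fin_\<Lambda> \<Lambda>_nonzero fin_T r_nonneg r_le sum_r_le in auto)
  also have "\<dots> = M powr (3/2) + 6 * M powr 2 + 54 * (M powr 3 / M powr (3/2))"
    using M by (simp add: power2_eq_square power3_eq_cube)
  also have "M powr 3 / M powr (3/2) = M powr (3/2)"
    by (simp add: powr_diff[symmetric])
  finally have "J \<le> M powr (3/2) + 6 * M powr 2 + 54 * M powr (3/2)" .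
  moreover have "M powr 2 \<le> M powr (3/2)" using M by (intro powr_mono') auto
  ultimately show ?thesis by linarith
qed

lemma sum_phi_cube_le: "(\<Sum>z\<in>Z. \<phi> z ^ 3) \<le> 200000 * M powr (599 / 200)"
  using cube_sum_le[of Z \<phi> "\<lambda>_. 1" M] fin_Z phi_nonneg order.trans[OF phi_le M(2)] sum_phi_le phi_tail M
  by simp

text \<open>The weak-type hypothesis of \<open>cube_sum_le\<close> comes from
  \<open>r \<le> M\<close> and the bound for rich lines when \<open>K \<ge> 6 * M * M\<close>, and
  from the trivial bound \<open>M\<close> for smaller \<open>K\<close>.\<close>

lemma sum_m_cube_le: "(\<Sum>l\<in>\<Lambda>. r l * (\<Sum>t\<in>T l. m l t ^ 3)) \<le> 200000 * M powr (599 / 200)"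
proof -
  define S where "S = Sigma \<Lambda> T"
  have fS: "finite S" using fin_\<Lambda> fin_T by (auto simp: S_def)
  have rm: "(\<Sum>x\<in>S. r (fst x) * m (fst x) (snd x)) \<le> 1"
  proof -
    have "(\<Sum>x\<in>S. r (fst x) * m (fst x) (snd x)) = (\<Sum>l\<in>\<Lambda>. r l * (\<Sum>t\<in>T l. m l t))"
      unfolding S_def using fin_\<Lambda> fin_T by (simp add: sum.Sigma sum_distrib_left split_def)
    also have "\<dots> \<le> (\<Sum>l\<in>\<Lambda>. r l * 1)"
      by (intro sum_mono mult_left_mono sum_m_le r_nonneg)
    finally show ?thesis using sum_r_le by simp
  qed
  have "(\<Sum>x\<in>S. r (fst x) * m (fst x) (snd x) ^ 3) \<le> 200000 * M powr (599 / 200)"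
  proof (rule cube_sum_le[OF fS _ _ _ rm _ M])
    fix K :: real assume K: "0 < K"
    show "(\<Sum>x\<in>{x\<in>S. K \<le> m (fst x) (snd x)}. r (fst x) * (m (fst x) (snd x))\<^sup>2) \<le> 433 * M ^ 3 / K"
    proof (cases "K < 6 * M * M")
      case True
      have "(\<Sum>x\<in>{x\<in>S. K \<le> m (fst x) (snd x)}. r (fst x) * (m (fst x) (snd x))\<^sup>2)
          \<le> (\<Sum>x\<in>S. r (fst x) * (m (fst x) (snd x))\<^sup>2)"
        by (rule sum_mono2) (use fS r_nonneg in auto)
      also have "\<dots> \<le> (\<Sum>x\<in>S. M * (r (fst x) * m (fst x) (snd x)))"
      proof (rule sum_mono)
        fix x
        have "m (fst x) (snd x) * (r (fst x) * m (fst x) (snd x)) \<le> M * (r (fst x) * m (fst x) (snd x))"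
          by (intro mult_right_mono m_le mult_nonneg_nonneg r_nonneg m_nonneg)
        then show "r (fst x) * (m (fst x) (snd x))\<^sup>2 \<le> M * (r (fst x) * m (fst x) (snd x))"
          by (simp add: power2_eq_square algebra_simps)
      qed
      also have "\<dots> \<le> M * 1"
        unfolding sum_distrib_left[symmetric] using M rm by (intro mult_left_mono) auto
      also have "\<dots> \<le> 433 * M ^ 3 / K"
        using True K M by (simp add: field_simps power2_eq_square power3_eq_cube)
      finally show ?thesis .
    next
      case False
      have "(\<Sum>x\<in>{x\<in>S. K \<le> m (fst x) (snd x)}. r (fst x) * (m (fst x) (snd x))\<^sup>2)
        \<le> (\<Sum>x\<in>{x\<in>S. K \<le> m (fst x) (snd x)}. M * (m (fst x) (snd x))\<^sup>2)"
        by (intro sum_mono mult_right_mono r_le) auto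
      also have "\<dots> = M * (\<Sum>(l, t)\<in>{x\<in>S. K \<le> m (fst x) (snd x)}. (m l t)\<^sup>2)"
        by (simp add: sum_distrib_left split_def)
      also have "\<dots> \<le> M * (54 * M * M * 1\<^sup>2 * 1\<^sup>2 / K)"
        unfolding m_def
      proof (intro mult_left_mono rich_lines[OF fin fin nonneg nonneg le_M le_M mass mass M(1) M(1)])
        show "l \<noteq> 0 \<and> K \<le> line_mass \<alpha> A \<alpha> A l t"
          if "(l, t) \<in> {x\<in>S. K \<le> line_mass \<alpha> A \<alpha> A (fst x) (snd x)}" for l t
          using that \<Lambda>_nonzero by (auto simp: S_def)
      qed (use False M fS in auto)
      also have "\<dots> \<le> 433 * M ^ 3 / K"
        using K M by (simp add: field_simps power3_eq_cube)
      finally show ?thesis .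
    qed
  qed (use r_nonneg m_nonneg order.trans[OF m_le M(2)] in auto)
  then show ?thesis
    unfolding S_def using fin_\<Lambda> fin_T by (simp add: sum.Sigma sum_distrib_left split_def)
qed

definition \<psi> :: "real \<times> real \<Rightarrow> real" where
  "\<psi> = push (A0 \<times> A \<times> A \<times> A) (\<lambda>(b, a, a', a''). \<alpha> b * \<alpha> a * \<alpha> a' * \<alpha> a'')
    (\<lambda>(b, a, a', a''). ((a - a'') / b, (a' - a'') / b))"

text \<open>Two similar triples \<open>(b, a, a', a'')\<close>, \<open>(d, c, c', c'')\<close> span three points
  \<open>(a, c)\<close>, \<open>(a', c')\<close>, \<open>(a'', c'')\<close> on a line of slope \<open>d / b\<close>.\<close>

lemma sum_psi_sq: "(\<Sum>p\<in>Z \<times> Z. (\<psi> p)\<^sup>2) \<le> 200000 * M powr (599 / 200)"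
proof -
  define I where "I = A0 \<times> A \<times> A \<times> A"
  have fI: "finite I" using fin fin_A0 by (simp add: I_def)
  define w where "w = (\<lambda>(b, a, a', a''). \<alpha> b * \<alpha> a * \<alpha> a' * \<alpha> a'')"
  define k where "k = (\<lambda>(b, a, a', a''). ((a - a'') / b :: real, (a' - a'') / b :: real))"
  have "(\<Sum>p\<in>Z \<times> Z. (\<psi> p)\<^sup>2) = (\<Sum>i\<in>I. \<Sum>j\<in>I. w i * w j * of_bool (k j = k i))"
    unfolding \<psi>_def w_def[symmetric] k_def[symmetric] I_def[symmetric] using fI fin_Z
    by (subst sum_push_sq) (auto simp: I_def k_def intro: Z_I)
  also have "\<dots> = (\<Sum>(i, j)\<in>I \<times> I. w i * w j * of_bool (k j = k i))"
    by (simp add: sum.cartesian_product)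
  also have "\<dots> = (\<Sum>(p, i, j, h)\<in>(A0 \<times> A0) \<times> (A \<times> A) \<times> (A \<times> A) \<times> (A \<times> A). \<alpha> (fst p) * \<alpha> (snd p) *
      ((\<alpha> (fst i) * \<alpha> (snd i)) * (\<alpha> (fst j) * \<alpha> (snd j)) * (\<alpha> (fst h) * \<alpha> (snd h)) *
      of_bool (snd j - snd p / fst p * fst j = snd i - snd p / fst p * fst i
        \<and> snd h - snd p / fst p * fst h = snd i - snd p / fst p * fst i)))"
    by (rule sum.reindex_bij_witness[where
          j = "\<lambda>((b, a, a', a''), (d, c, c', c'')). ((b, d), (a'', c''), (a, c), (a', c'))" and
          i = "\<lambda>((b, d), (a'', c''), (a, c), (a', c')). ((b, a, a', a''), (d, c, c', c''))"])
      (auto simp: I_def w_def k_def ratio_eq_iff)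
  also have "\<dots> = (\<Sum>l\<in>\<Lambda>. r l * (\<Sum>t\<in>T l. m l t ^ 3))"
    unfolding sum_r_mult sum_m_cube by (simp add: sum.cartesian_product sum_distrib_left split_def)
  finally show ?thesis using sum_m_cube_le by simp
qed

end

section \<open>Triangles and positive definiteness\<close>

lemma Cauchy_Schwarz_mass:
  fixes w a :: "'i \<Rightarrow> real"
  assumes "\<And>i. i \<in> I \<Longrightarrow> 0 \<le> w i" "sum w I \<le> 1"
  shows "(\<Sum>i\<in>I. w i * a i)\<^sup>2 \<le> (\<Sum>i\<in>I. w i * (a i)\<^sup>2)"
proof -
  have "(\<Sum>i\<in>I. w i * a i)\<^sup>2 \<le> (\<Sum>i\<in>I. w i * (a i)\<^sup>2) * sum w I"
    using Cauchy_Schwarz_weighted[of I w a "\<lambda>_. 1"] assms by simp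
  also have "\<dots> \<le> (\<Sum>i\<in>I. w i * (a i)\<^sup>2) * 1"
    by (intro mult_left_mono assms sum_nonneg) (use assms in auto)
  finally show ?thesis by simp
qed

text \<open>Jensen for the cube by its tangent at the mean \<open>s\<close>: the difference is
  \<open>(t - s)\<^sup>2 * (t + 2 * s)\<close>. A total weight below 1 works in favour of the
  inequality, since the constant term of the tangent is negative.\<close>

lemma cube_sum_le_sum_cube:
  fixes w x :: "'i \<Rightarrow> real"
  assumes "\<And>i. i \<in> I \<Longrightarrow> 0 \<le> w i" "sum w I \<le> 1" "\<And>i. i \<in> I \<Longrightarrow> 0 \<le> x i"
  shows "(\<Sum>i\<in>I. w i * x i) ^ 3 \<le> (\<Sum>i\<in>I. w i * x i ^ 3)"
proof -
  define s where "s = (\<Sum>i\<in>I. w i * x i)"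
  have s: "0 \<le> s" unfolding s_def by (intro sum_nonneg mult_nonneg_nonneg assms)
  have "3 * s\<^sup>2 * t - 2 * s ^ 3 \<le> t ^ 3" if "0 \<le> t" for t
  proof -
    have "0 \<le> (t - s)\<^sup>2 * (t + 2 * s)" using that s by simp
    also have "\<dots> = t ^ 3 - (3 * s\<^sup>2 * t - 2 * s ^ 3)" by algebra
    finally show ?thesis by simp
  qed
  then have "(\<Sum>i\<in>I. w i * (3 * s\<^sup>2 * x i - 2 * s ^ 3)) \<le> (\<Sum>i\<in>I. w i * x i ^ 3)"
    by (intro sum_mono mult_left_mono) (use assms in auto)
  moreover have "(\<Sum>i\<in>I. w i * (3 * s\<^sup>2 * x i - 2 * s ^ 3)) = 3 * s\<^sup>2 * s - 2 * s ^ 3 * sum w I"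
    by (simp add: s_def right_diff_distrib sum_subtractf sum_distrib_left sum_distrib_right mult_ac)
  moreover have "s ^ 3 * sum w I \<le> s ^ 3 * 1" by (intro mult_left_mono assms) (use s in simp)
  ultimately show ?thesis unfolding s_def[symmetric] by (simp add: power2_eq_square power3_eq_cube)
qed

text \<open>For a positive semidefinite kernel \<open>k\<close>, with \<open>T\<close> the matrix
  \<open>sqrt (\<alpha> x * \<alpha> y) * k x y\<close> and \<open>v = sqrt \<alpha>\<close>, this is \<open>(v \<bullet> T v)^3 \<le> v \<bullet> T^3 v \<le> tr T^3\<close>.\<close>

lemma psd_triangles:
  fixes g :: "'i \<Rightarrow> 'x \<Rightarrow> real"
  assumes c: "\<And>i. i \<in> I \<Longrightarrow> 0 \<le> c i" and \<alpha>: "\<And>x. x \<in> X \<Longrightarrow> 0 \<le> \<alpha> x" "sum \<alpha> X \<le> 1"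
    and k: "\<And>x y. x \<in> X \<Longrightarrow> y \<in> X \<Longrightarrow> k x y = (\<Sum>i\<in>I. c i * g i x * g i y)"
  shows "(\<Sum>x\<in>X. \<Sum>y\<in>X. \<alpha> x * \<alpha> y * k x y) ^ 3 \<le>
    (\<Sum>x\<in>X. \<Sum>y\<in>X. \<Sum>z\<in>X. \<alpha> x * \<alpha> y * \<alpha> z * (k x y * k y z * k x z))"
proof -
  define h where "h x = (\<Sum>y\<in>X. \<alpha> y * k x y)" for x
  define u where "u i = (\<Sum>x\<in>X. \<alpha> x * g i x)" for i
  define y where "y i = (\<Sum>x\<in>X. \<alpha> x * h x * g i x)" for i
  \<comment> \<open>In the notation above, \<open>q\<close>, \<open>q2\<close> and \<open>q3\<close>
    are the pairings of \<open>v\<close> with \<open>T v\<close>, \<open>T^2 v\<close> and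
    \<open>T^3 v\<close>. The families \<open>u\<close> and \<open>y\<close> are the images of
    \<open>v\<close> and \<open>T v\<close> under the Gram factor of \<open>T\<close>, so
    Cauchy-Schwarz with weights \<open>c\<close> compares all three.\<close>
  define q where "q = (\<Sum>x\<in>X. \<alpha> x * h x)"
  define q2 where "q2 = (\<Sum>x\<in>X. \<alpha> x * (h x)\<^sup>2)"
  define q3 where "q3 = (\<Sum>i\<in>I. c i * (y i)\<^sup>2)"
  have sym: "k x x' = k x' x" if "x \<in> X" "x' \<in> X" for x x'
    using that by (simp add: k mult_ac)
  have h: "h x = (\<Sum>i\<in>I. c i * g i x * u i)" if "x \<in> X" for x
  proof -
    have "h x = (\<Sum>y\<in>X. \<Sum>i\<in>I. \<alpha> y * (c i * g i x * g i y))"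
      unfolding h_def using that by (simp add: k sum_distrib_left)
    also have "\<dots> = (\<Sum>i\<in>I. \<Sum>y\<in>X. \<alpha> y * (c i * g i x * g i y))" by (rule sum.swap)
    finally show ?thesis by (simp add: u_def sum_distrib_left mult_ac)
  qed
  have q: "q = (\<Sum>i\<in>I. c i * (u i)\<^sup>2)"
  proof -
    have "q = (\<Sum>x\<in>X. \<Sum>i\<in>I. \<alpha> x * (c i * g i x * u i))"
      unfolding q_def by (simp add: h sum_distrib_left)
    also have "\<dots> = (\<Sum>i\<in>I. \<Sum>x\<in>X. \<alpha> x * (c i * g i x * u i))" by (rule sum.swap)
    finally show ?thesis by (simp add: u_def power2_eq_square sum_distrib_left sum_distrib_right mult_ac)
  qed
  have q2: "q2 = (\<Sum>i\<in>I. c i * u i * y i)"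
  proof -
    have "q2 = (\<Sum>x\<in>X. \<alpha> x * h x * h x)" by (simp add: q2_def power2_eq_square mult.assoc)
    also have "\<dots> = (\<Sum>x\<in>X. \<Sum>i\<in>I. \<alpha> x * h x * (c i * g i x * u i))"
      by (intro sum.cong refl) (simp add: h sum_distrib_left)
    also have "\<dots> = (\<Sum>i\<in>I. \<Sum>x\<in>X. \<alpha> x * h x * (c i * g i x * u i))" by (rule sum.swap)
    finally show ?thesis by (simp add: y_def sum_distrib_left mult_ac)
  qed
  have q0: "0 \<le> q" unfolding q by (intro sum_nonneg mult_nonneg_nonneg c) auto
  have q20: "0 \<le> q2" unfolding q2_def by (intro sum_nonneg mult_nonneg_nonneg \<alpha>) auto
  have 1: "q\<^sup>2 \<le> q2" unfolding q_def q2_def by (rule Cauchy_Schwarz_mass) (use \<alpha> in auto)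
  have 2: "q2\<^sup>2 \<le> q * q3"
    unfolding q2 q q3_def by (rule Cauchy_Schwarz_weighted) (use c in auto)
  have 3: "q ^ 3 \<le> q3"
  proof (cases "q = 0")
    case True
    then show ?thesis unfolding q3_def by (auto intro!: sum_nonneg mult_nonneg_nonneg c)
  next
    case False
    have "q * q ^ 3 = (q\<^sup>2)\<^sup>2" by (simp add: power2_eq_square power3_eq_cube)
    also have "\<dots> \<le> q2\<^sup>2" by (rule power_mono[OF 1]) simp
    also note 2
    finally show ?thesis using False q0 by simp
  qed
  \<comment> \<open>Exchanging sums makes \<open>y i\<close> an \<open>\<alpha>\<close>-average of
    \<open>W i\<close>, so its square is at most the average of the squares. After expansion, the
    sum over \<open>i\<close> reassembles the third edge \<open>k x z\<close>, which gives the
    trace.\<close>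
  define W where "W i x' = (\<Sum>x\<in>X. \<alpha> x * k x x' * g i x)" for i x'
  have yW: "y i = (\<Sum>x'\<in>X. \<alpha> x' * W i x')" for i
  proof -
    have "y i = (\<Sum>x\<in>X. \<Sum>x'\<in>X. \<alpha> x * (\<alpha> x' * k x x') * g i x)"
      by (simp add: y_def h_def sum_distrib_left sum_distrib_right)
    also have "\<dots> = (\<Sum>x'\<in>X. \<Sum>x\<in>X. \<alpha> x * (\<alpha> x' * k x x') * g i x)" by (rule sum.swap)
    finally show ?thesis by (simp add: W_def sum_distrib_left mult_ac)
  qed
  have "q3 \<le> (\<Sum>i\<in>I. c i * (\<Sum>x'\<in>X. \<alpha> x' * (W i x')\<^sup>2))"
    unfolding q3_def yW by (intro sum_mono mult_left_mono Cauchy_Schwarz_mass) (use \<alpha> c in auto)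
  also have "\<dots> = (\<Sum>i\<in>I. \<Sum>x'\<in>X. \<Sum>x\<in>X. \<Sum>z\<in>X. c i * \<alpha> x' * (\<alpha> x * k x x' * g i x) * (\<alpha> z * k z x' * g i z))"
    by (simp add: W_def power2_eq_square sum_product sum_distrib_left mult_ac)
  also have "\<dots> = (\<Sum>x'\<in>X. \<Sum>i\<in>I. \<Sum>x\<in>X. \<Sum>z\<in>X. c i * \<alpha> x' * (\<alpha> x * k x x' * g i x) * (\<alpha> z * k z x' * g i z))"
    by (rule sum.swap)
  also have "\<dots> = (\<Sum>x'\<in>X. \<Sum>x\<in>X. \<Sum>i\<in>I. \<Sum>z\<in>X. c i * \<alpha> x' * (\<alpha> x * k x x' * g i x) * (\<alpha> z * k z x' * g i z))"
    by (intro sum.cong refl) (rule sum.swap)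
  also have "\<dots> = (\<Sum>x'\<in>X. \<Sum>x\<in>X. \<Sum>z\<in>X. \<Sum>i\<in>I. c i * \<alpha> x' * (\<alpha> x * k x x' * g i x) * (\<alpha> z * k z x' * g i z))"
    by (intro sum.cong refl) (rule sum.swap)
  also have "\<dots> = (\<Sum>x'\<in>X. \<Sum>x\<in>X. \<Sum>z\<in>X. \<alpha> x * \<alpha> x' * \<alpha> z * (k x x' * k x' z * k x z))"
  proof (intro sum.cong refl)
    fix x' x z assume X: "x' \<in> X" "x \<in> X" "z \<in> X"
    have "(\<Sum>i\<in>I. c i * \<alpha> x' * (\<alpha> x * k x x' * g i x) * (\<alpha> z * k z x' * g i z))
        = \<alpha> x * \<alpha> x' * \<alpha> z * k x x' * k z x' * k x z"
      unfolding k[OF X(2,3)] sum_distrib_left by (intro sum.cong refl) (simp add: mult_ac)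
    then show "(\<Sum>i\<in>I. c i * \<alpha> x' * (\<alpha> x * k x x' * g i x) * (\<alpha> z * k z x' * g i z))
        = \<alpha> x * \<alpha> x' * \<alpha> z * (k x x' * k x' z * k x z)"
      using sym[OF X(1,3)] by (simp add: mult_ac)
  qed
  also have "\<dots> = (\<Sum>x\<in>X. \<Sum>x'\<in>X. \<Sum>z\<in>X. \<alpha> x * \<alpha> x' * \<alpha> z * (k x x' * k x' z * k x z))"
    by (rule sum.swap)
  finally have "q3 \<le> (\<Sum>x\<in>X. \<Sum>x'\<in>X. \<Sum>z\<in>X. \<alpha> x * \<alpha> x' * \<alpha> z * (k x x' * k x' z * k x z))" .
  moreover have "q = (\<Sum>x\<in>X. \<Sum>y\<in>X. \<alpha> x * \<alpha> y * k x y)"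
    by (simp add: q_def h_def sum_distrib_left mult.assoc)
  ultimately show ?thesis using 3 by simp
qed

section \<open>Gram structure of \<open>\<phi>\<close>, and vertices of small degree\<close>

context bounded_weight
begin

lemma phi_alt: "\<phi> z = (\<Sum>d\<in>A0. \<Sum>s\<in>A. \<Sum>s'\<in>A. \<alpha> d * \<alpha> s * \<alpha> s' * of_bool ((s - s') / d = z))"
  unfolding \<phi>_def using fin fin_A0
  by (simp add: push_alt sum.cartesian_product split_def del: sum_mult_of_bool_eq)

text \<open>For a fixed denominator \<open>d\<close> the equation
  \<open>(s - s') / d = (a - a') / b\<close> separates into
  \<open>s - d * a / b = s' - d * a' / b\<close>. Calling the common value \<open>y\<close> splits
  \<open>\<phi>\<close> into products of one and the same function at \<open>a\<close> and at
  \<open>a'\<close>.\<close>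

lemma phi_gram:
  assumes b: "b \<in> A0" and a: "a \<in> A" "a' \<in> A"
  defines "Y \<equiv> (\<lambda>(d, s, a). s - d * a / b) ` (A0 \<times> A \<times> A)"
    and "g \<equiv> \<lambda>(d, y) a. push A \<alpha> (\<lambda>s. s - d * a / b) y"
  shows "\<phi> ((a - a') / b) = (\<Sum>i\<in>A0 \<times> Y. \<alpha> (fst i) * g i a * g i a')"
proof -
  have fY: "finite Y" using fin fin_A0 by (simp add: Y_def)
  have "(\<Sum>i\<in>A0 \<times> Y. \<alpha> (fst i) * g i a * g i a') = (\<Sum>d\<in>A0. \<alpha> d * (\<Sum>y\<in>Y. g (d, y) a * g (d, y) a'))"
    by (simp add: sum.cartesian_product sum_distrib_left mult.assoc split_def)
  also have "\<dots> = (\<Sum>d\<in>A0. \<Sum>s\<in>A. \<Sum>s'\<in>A. \<alpha> d * \<alpha> s * \<alpha> s' * of_bool ((s - s') / d = (a - a') / b))"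
  proof (rule sum.cong[OF refl])
    fix d assume d: "d \<in> A0"
    have "(\<Sum>y\<in>Y. g (d, y) a * g (d, y) a') = (\<Sum>s\<in>A. \<alpha> s * g (d, s - d * a / b) a')"
      unfolding g_def prod.case
      by (rule sum_push_mult[OF fin fY]) (use d a in \<open>force simp: Y_def\<close>)
    also have "\<dots> = (\<Sum>s\<in>A. \<Sum>s'\<in>A. \<alpha> s * \<alpha> s' * of_bool (s' - d * a' / b = s - d * a / b))"
      by (simp add: g_def push_alt[OF fin] sum_distrib_left mult.assoc)
    also have "\<dots> = (\<Sum>s\<in>A. \<Sum>s'\<in>A. \<alpha> s * \<alpha> s' * of_bool ((s - s') / d = (a - a') / b))"
      using b d by (intro sum.cong refl arg_cong2[of _ _ _ _ "(*)"] arg_cong[of _ _ of_bool])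
        (auto simp: A0_def field_simps)
    finally show "\<alpha> d * (\<Sum>y\<in>Y. g (d, y) a * g (d, y) a')
        = (\<Sum>s\<in>A. \<Sum>s'\<in>A. \<alpha> d * \<alpha> s * \<alpha> s' * of_bool ((s - s') / d = (a - a') / b))"
      by (simp add: sum_distrib_left mult.assoc)
  qed
  finally show ?thesis by (simp add: phi_alt)
qed

text \<open>The kernel stays positive semidefinite on any vertex set \<open>R b\<close>, which may
  depend on \<open>b\<close>; this freedom is used to delete vertices. The different
  \<open>b\<close> are combined by convexity of the cube.\<close>

lemma triangles_ge:
  assumes R: "\<And>b. b \<in> A0 \<Longrightarrow> R b \<subseteq> A"
  shows "(\<Sum>b\<in>A0. \<alpha> b * (\<Sum>a\<in>R b. \<Sum>a'\<in>R b. \<alpha> a * \<alpha> a' * \<phi> ((a - a') / b))) ^ 3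
    \<le> (\<Sum>b\<in>A0. \<alpha> b * (\<Sum>a\<in>R b. \<Sum>a'\<in>R b. \<Sum>a''\<in>R b. \<alpha> a * \<alpha> a' * \<alpha> a'' *
          (\<phi> ((a - a') / b) * \<phi> ((a' - a'') / b) * \<phi> ((a - a'') / b))))"
proof -
  have \<alpha>: "0 \<le> \<alpha> a" if "a \<in> R b" "b \<in> A0" for a b using that R nonneg by auto
  have R1: "sum \<alpha> (R b) \<le> 1" if "b \<in> A0" for b
    using sum_mono2[OF fin R[OF that], of \<alpha>] nonneg mass by fastforce
  have "(\<Sum>b\<in>A0. \<alpha> b * (\<Sum>a\<in>R b. \<Sum>a'\<in>R b. \<alpha> a * \<alpha> a' * \<phi> ((a - a') / b))) ^ 3
    \<le> (\<Sum>b\<in>A0. \<alpha> b * (\<Sum>a\<in>R b. \<Sum>a'\<in>R b. \<alpha> a * \<alpha> a' * \<phi> ((a - a') / b)) ^ 3)"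
    by (intro cube_sum_le_sum_cube mass_A0)
      (auto intro!: sum_nonneg mult_nonneg_nonneg phi_nonneg intro: nonneg \<alpha> dest: A0_D)
  also have "\<dots> \<le> (\<Sum>b\<in>A0. \<alpha> b * (\<Sum>a\<in>R b. \<Sum>a'\<in>R b. \<Sum>a''\<in>R b. \<alpha> a * \<alpha> a' * \<alpha> a'' *
          (\<phi> ((a - a') / b) * \<phi> ((a' - a'') / b) * \<phi> ((a - a'') / b))))"
  proof (intro sum_mono mult_left_mono)
    fix b assume b: "b \<in> A0"
    show "(\<Sum>a\<in>R b. \<Sum>a'\<in>R b. \<alpha> a * \<alpha> a' * \<phi> ((a - a') / b)) ^ 3
      \<le> (\<Sum>a\<in>R b. \<Sum>a'\<in>R b. \<Sum>a''\<in>R b. \<alpha> a * \<alpha> a' * \<alpha> a'' *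
          (\<phi> ((a - a') / b) * \<phi> ((a' - a'') / b) * \<phi> ((a - a'') / b)))"
    proof (rule psd_triangles[where c = "\<lambda>i. \<alpha> (fst i)"])
      show "\<phi> ((a - a') / b) = (\<Sum>i\<in>A0 \<times> (\<lambda>(d, s, a). s - d * a / b) ` (A0 \<times> A \<times> A). \<alpha> (fst i) *
          (\<lambda>(d, y) a. push A \<alpha> (\<lambda>s. s - d * a / b) y) i a *
          (\<lambda>(d, y) a. push A \<alpha> (\<lambda>s. s - d * a / b) y) i a')" if "a \<in> R b" "a' \<in> R b" for a a'
        by (rule phi_gram[OF b]) (use that R[OF b] in auto)
    qed (use \<alpha>[OF _ b] R1[OF b] nonneg in \<open>auto dest: A0_D\<close>)
  qed (auto intro: nonneg dest: A0_D)
  finally show ?thesis .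
qed

text \<open>For each \<open>b\<close>, the values \<open>\<phi> ((x - z) / b)\<close> are edge
  weights of a graph on \<open>A\<close>; this is the squared degree of \<open>x\<close>. Its mean
  over \<open>b\<close> and \<open>x\<close> is the third moment of \<open>\<phi>\<close>, so few
  vertices exceed a bound \<open>G\<close>.\<close>

definition deg2 :: "real \<Rightarrow> real \<Rightarrow> real" where
  "deg2 b x = (\<Sum>z\<in>A. \<alpha> z * (\<phi> ((x - z) / b))\<^sup>2)"

lemma deg2_nonneg: "0 \<le> deg2 b x"
  unfolding deg2_def by (intro sum_nonneg mult_nonneg_nonneg nonneg) auto

lemma sum_deg2_le: "(\<Sum>b\<in>A0. \<Sum>a\<in>A. \<alpha> b * \<alpha> a * deg2 b a) \<le> 200000 * M powr (599 / 200)"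
proof -
  have "(\<Sum>b\<in>A0. \<Sum>a\<in>A. \<alpha> b * \<alpha> a * deg2 b a) = (\<Sum>z\<in>Z. \<phi> z * (\<phi> z)\<^sup>2)"
    unfolding sum_phi_mult by (simp add: deg2_def sum_distrib_left mult.assoc)
  then show ?thesis using sum_phi_cube_le by (simp add: power2_eq_square power3_eq_cube mult.assoc)
qed

lemma bad_mass_le:
  assumes "0 < G"
  shows "(\<Sum>b\<in>A0. \<Sum>a\<in>A. \<alpha> b * \<alpha> a * of_bool (G < deg2 b a)) \<le> 200000 * M powr (599 / 200) / G"
proof -
  have "G * (\<Sum>b\<in>A0. \<Sum>a\<in>A. \<alpha> b * \<alpha> a * of_bool (G < deg2 b a))
      = (\<Sum>b\<in>A0. \<Sum>a\<in>A. \<alpha> b * \<alpha> a * (G * of_bool (G < deg2 b a)))"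
    unfolding sum_distrib_left by (intro sum.cong refl) (simp only: mult_ac)
  also have "\<dots> \<le> (\<Sum>b\<in>A0. \<Sum>a\<in>A. \<alpha> b * \<alpha> a * deg2 b a)"
    by (intro sum_mono mult_left_mono) (use nonneg deg2_nonneg in \<open>auto dest: A0_D\<close>)
  also note sum_deg2_le
  finally show ?thesis using assms by (simp only: pos_le_divide_eq mult.commute)
qed

text \<open>An edge below \<open>K\<close> with a bad endpoint costs at most \<open>K\<close>, hence
  \<open>K\<close> times the bad mass, once for each endpoint. Edges of weight at least
  \<open>K\<close> are charged to the tail of \<open>\<phi>\<close>, whatever their endpoints
  are.\<close>

lemma edges_ge:
  assumes "0 < G" "0 < K"
  shows "J - 2 * K * (200000 * M powr (599 / 200) / G) - 433 * M ^ 3 / K \<le>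
    (\<Sum>b\<in>A0. \<alpha> b * (\<Sum>a\<in>{a\<in>A. deg2 b a \<le> G}. \<Sum>a'\<in>{a\<in>A. deg2 b a \<le> G}.
      \<alpha> a * \<alpha> a' * \<phi> ((a - a') / b)))"
    (is "_ \<le> ?Q")
proof -
  define bad where "bad b a = (of_bool (G < deg2 b a) :: real)" for b a
  define h where "h z = (if K \<le> \<phi> z then \<phi> z else 0)" for z
  have ptw: "\<phi> ((a - a') / b) \<le> \<phi> ((a - a') / b) * ((1 - bad b a) * (1 - bad b a')) + K * bad b a + K * bad b a'
      + h ((a - a') / b)" for a a' b
    using phi_nonneg[of "(a - a') / b"] assms unfolding bad_def h_def by auto
  have "J = (\<Sum>b\<in>A0. \<Sum>a\<in>A. \<Sum>a'\<in>A. \<alpha> b * \<alpha> a * \<alpha> a' * \<phi> ((a - a') / b))"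
    unfolding J_def power2_eq_square by (rule sum_phi_mult)
  also have "\<dots> \<le> (\<Sum>b\<in>A0. \<Sum>a\<in>A. \<Sum>a'\<in>A. \<alpha> b * \<alpha> a * \<alpha> a' *
      (\<phi> ((a - a') / b) * ((1 - bad b a) * (1 - bad b a')) + K * bad b a + K * bad b a' + h ((a - a') / b)))"
    by (intro sum_mono mult_left_mono ptw mult_nonneg_nonneg nonneg) (auto dest: A0_D)
  also have "\<dots> = (\<Sum>b\<in>A0. \<Sum>a\<in>A. \<Sum>a'\<in>A. \<alpha> b * \<alpha> a * \<alpha> a' * (\<phi> ((a - a') / b) * ((1 - bad b a) * (1 - bad b a'))))
      + (\<Sum>b\<in>A0. \<Sum>a\<in>A. \<Sum>a'\<in>A. \<alpha> b * \<alpha> a * \<alpha> a' * (K * bad b a))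
      + (\<Sum>b\<in>A0. \<Sum>a\<in>A. \<Sum>a'\<in>A. \<alpha> b * \<alpha> a * \<alpha> a' * (K * bad b a'))
      + (\<Sum>b\<in>A0. \<Sum>a\<in>A. \<Sum>a'\<in>A. \<alpha> b * \<alpha> a * \<alpha> a' * h ((a - a') / b))"
    by (simp only: distrib_left sum.distrib)
  also have "(\<Sum>b\<in>A0. \<Sum>a\<in>A. \<Sum>a'\<in>A. \<alpha> b * \<alpha> a * \<alpha> a' * (\<phi> ((a - a') / b) * ((1 - bad b a) * (1 - bad b a')))) = ?Q"
  proof (rule sum.cong[OF refl])
    fix b
    have "(\<Sum>a\<in>A. \<Sum>a'\<in>A. \<alpha> b * \<alpha> a * \<alpha> a' * (\<phi> ((a - a') / b) * ((1 - bad b a) * (1 - bad b a'))))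
      = (\<Sum>a\<in>{a\<in>A. deg2 b a \<le> G}. \<Sum>a'\<in>{a\<in>A. deg2 b a \<le> G}. \<alpha> b * \<alpha> a * \<alpha> a' * \<phi> ((a - a') / b))"
      unfolding sum.inter_filter[OF fin] by (intro sum.cong refl) (auto simp: bad_def intro!: sum.cong)
    then show "(\<Sum>a\<in>A. \<Sum>a'\<in>A. \<alpha> b * \<alpha> a * \<alpha> a' * (\<phi> ((a - a') / b) * ((1 - bad b a) * (1 - bad b a'))))
      = \<alpha> b * (\<Sum>a\<in>{a\<in>A. deg2 b a \<le> G}. \<Sum>a'\<in>{a\<in>A. deg2 b a \<le> G}. \<alpha> a * \<alpha> a' * \<phi> ((a - a') / b))"
      by (simp add: sum_distrib_left mult.assoc)
  qed
  finally have split: "J \<le> ?Q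
      + (\<Sum>b\<in>A0. \<Sum>a\<in>A. \<Sum>a'\<in>A. \<alpha> b * \<alpha> a * \<alpha> a' * (K * bad b a))
      + (\<Sum>b\<in>A0. \<Sum>a\<in>A. \<Sum>a'\<in>A. \<alpha> b * \<alpha> a * \<alpha> a' * (K * bad b a'))
      + (\<Sum>b\<in>A0. \<Sum>a\<in>A. \<Sum>a'\<in>A. \<alpha> b * \<alpha> a * \<alpha> a' * h ((a - a') / b))" .
  define B where "B = (\<Sum>b\<in>A0. \<Sum>a\<in>A. \<alpha> b * \<alpha> a * bad b a)"
  have B0: "0 \<le> B" unfolding B_def bad_def by (intro sum_nonneg mult_nonneg_nonneg nonneg) (auto dest: A0_D)
  have B: "B \<le> 200000 * M powr (599 / 200) / G"
    unfolding B_def bad_def by (rule bad_mass_le) fact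
  have 1: "(\<Sum>b\<in>A0. \<Sum>a\<in>A. \<Sum>a'\<in>A. \<alpha> b * \<alpha> a * \<alpha> a' * (K * bad b a)) = K * (B * sum \<alpha> A)"
  proof -
    define s where "s = sum \<alpha> A"
    have "\<alpha> b * \<alpha> a * bad b a * s = (\<Sum>a'\<in>A. \<alpha> b * \<alpha> a * bad b a * \<alpha> a')" for b a
      by (simp add: s_def sum_distrib_left)
    then show ?thesis
      unfolding B_def s_def[symmetric] by (simp add: sum_distrib_left sum_distrib_right mult_ac)
  qed
  have "(\<Sum>b\<in>A0. \<Sum>a\<in>A. \<Sum>a'\<in>A. \<alpha> b * \<alpha> a * \<alpha> a' * (K * bad b a'))
      = (\<Sum>b\<in>A0. \<Sum>a'\<in>A. \<Sum>a\<in>A. \<alpha> b * \<alpha> a * \<alpha> a' * (K * bad b a'))"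
    by (rule sum.cong[OF refl], rule sum.swap)
  also have "\<dots> = K * (B * sum \<alpha> A)"
  proof -
    define s where "s = sum \<alpha> A"
    have "\<alpha> b * \<alpha> a * bad b a * s = (\<Sum>a'\<in>A. \<alpha> b * \<alpha> a * bad b a * \<alpha> a')" for b a
      by (simp add: s_def sum_distrib_left)
    then show ?thesis
      unfolding B_def s_def[symmetric] by (simp add: sum_distrib_left sum_distrib_right mult_ac)
  qed
  finally have 2: "(\<Sum>b\<in>A0. \<Sum>a\<in>A. \<Sum>a'\<in>A. \<alpha> b * \<alpha> a * \<alpha> a' * (K * bad b a')) = K * (B * sum \<alpha> A)" .
  have "K * (B * sum \<alpha> A) \<le> K * (B * 1)" using B0 mass assms by (intro mult_left_mono) auto
  then have 3: "K * (B * sum \<alpha> A) \<le> K * (200000 * M powr (599 / 200) / G)"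
    using mult_left_mono[OF B, of K] assms by linarith
  have "(\<Sum>b\<in>A0. \<Sum>a\<in>A. \<Sum>a'\<in>A. \<alpha> b * \<alpha> a * \<alpha> a' * h ((a - a') / b)) = (\<Sum>z\<in>Z. \<phi> z * h z)"
    by (simp add: sum_phi_mult)
  also have "\<dots> = (\<Sum>z\<in>{z\<in>Z. K \<le> \<phi> z}. (\<phi> z)\<^sup>2)"
    by (rule sum.mono_neutral_cong_right) (use fin_Z in \<open>auto simp: h_def power2_eq_square\<close>)
  also have "\<dots> \<le> 433 * M ^ 3 / K" by (rule phi_tail) fact
  finally have 4: "(\<Sum>b\<in>A0. \<Sum>a\<in>A. \<Sum>a'\<in>A. \<alpha> b * \<alpha> a * \<alpha> a' * h ((a - a') / b)) \<le> 433 * M ^ 3 / K" .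
  define X where "X = 200000 * M powr (599 / 200) / G"
  have "2 * K * X = K * X + K * X" by simp
  then show ?thesis using split 4 3 unfolding 1 2 X_def[symmetric] by linarith
qed

lemma ratio_eq_diff_iff: "b \<in> A0 \<Longrightarrow> (a - a') / b = y - z \<longleftrightarrow> a - b * y = a' - b * z"
proof -
  assume "b \<in> A0"
  then have "(a - a') / b = y - z \<longleftrightarrow> a - a' = (y - z) * b"
    by (intro nonzero_divide_eq_eq) (auto simp: A0_def)
  then show ?thesis by (simp only:) (auto simp: algebra_simps)
qed

text \<open>Expanding \<open>\<phi> (y - z)\<close> over \<open>(b, a, a')\<close> puts
  \<open>(y, a)\<close> and \<open>(z, a')\<close> on a common line of slope \<open>b\<close>. The
  entries \<open>b\<close> are now slopes with weight at most \<open>M\<close>, and the points live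
  in \<open>Z \<times> A\<close>, where the atoms of the first factor are at most
  \<open>K\<^sup>2\<close>.\<close>

lemma kappa_energy:
  assumes f: "\<And>z. z \<in> Z \<Longrightarrow> 0 \<le> f z" "\<And>z. z \<in> Z \<Longrightarrow> f z \<le> K\<^sup>2" "sum f Z \<le> w" and "0 < K" "0 < \<mu>"
  shows "(\<Sum>(y, z)\<in>Z \<times> Z. f y * f z * \<phi> (y - z))
    \<le> (\<mu> + 6 * K\<^sup>2 * M) * w + M * (54 * K\<^sup>2 * M * w\<^sup>2 / \<mu>)"
proof -
  define S where "S b = (\<lambda>(x, y). y - b * x) ` (Z \<times> A)" for b :: real
  have sq: "(\<Sum>t\<in>S b. (line_mass f Z \<alpha> A b t)\<^sup>2) = (\<Sum>i\<in>Z \<times> A. \<Sum>j\<in>Z \<times> A.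
      (f (fst i) * \<alpha> (snd i)) * (f (fst j) * \<alpha> (snd j)) * of_bool (snd j - b * fst j = snd i - b * fst i))" for b
    unfolding line_mass_def using fin fin_Z
    by (subst sum_push_sq) (auto simp: S_def split_def)
  have "(\<Sum>(y, z)\<in>Z \<times> Z. f y * f z * \<phi> (y - z)) = (\<Sum>(p, b, a, a')\<in>(Z \<times> Z) \<times> A0 \<times> A \<times> A.
      f (fst p) * f (snd p) * (\<alpha> b * \<alpha> a * \<alpha> a' * of_bool ((a - a') / b = fst p - snd p)))"
    by (simp add: phi_alt sum.cartesian_product sum_distrib_left split_def del: sum_mult_of_bool_eq)
  also have "\<dots> = (\<Sum>(b, i, j)\<in>A0 \<times> (Z \<times> A) \<times> (Z \<times> A). \<alpha> b *
      ((f (fst i) * \<alpha> (snd i)) * (f (fst j) * \<alpha> (snd j)) * of_bool (snd j - b * fst j = snd i - b * fst i)))"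
    by (rule sum.reindex_bij_witness[where j = "\<lambda>((y, z), b, a, a'). (b, (z, a'), (y, a))"
          and i = "\<lambda>(b, (z, a'), (y, a)). ((y, z), b, a, a')"])
      (auto simp: ratio_eq_diff_iff)
  also have "\<dots> = (\<Sum>b\<in>A0. \<alpha> b * (\<Sum>t\<in>S b. (line_mass f Z \<alpha> A b t)\<^sup>2))"
    unfolding sq by (simp add: sum.cartesian_product sum_distrib_left split_def del: sum_mult_of_bool_eq)
  also have "\<dots> \<le> (\<mu> + 6 * K\<^sup>2 * M) * (w * 1) * 1 + M * (54 * K\<^sup>2 * M * w\<^sup>2 * 1\<^sup>2 / \<mu>)"
    by (rule weighted_line_energy[OF fin_Z fin f(1) nonneg f(2) le_M f(3) mass])
      (use assms M fin fin_A0 fin_Z nonneg le_M mass_A0 in \<open>auto simp: S_def dest: A0_D\<close>)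
  finally show ?thesis by simp
qed

text \<open>Cauchy-Schwarz separates the similar triples from the second moment of \<open>F\<close>.
  In the latter, one of the two factors \<open>f (y - z)\<close> is estimated by \<open>K\<close>
  and the other by the full \<open>\<phi> (y - z)\<close>, which can be expanded.\<close>

lemma small_triangles_le:
  assumes "0 < K" "0 < \<mu>" and w: "J \<le> w"
  defines "f \<equiv> \<lambda>z. if \<phi> z < K then \<phi> z else 0"
  shows "(\<Sum>b\<in>A0. \<Sum>a\<in>A. \<Sum>a'\<in>A. \<Sum>a''\<in>A. \<alpha> b * \<alpha> a * \<alpha> a' * \<alpha> a'' *
        (f ((a - a') / b) * f ((a' - a'') / b) * f ((a - a'') / b)))\<^sup>2
    \<le> (200000 * M powr (599 / 200)) *
      (K * ((\<mu> + 6 * K\<^sup>2 * M) * w + M * (54 * K\<^sup>2 * M * w\<^sup>2 / \<mu>)))"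
proof -
  have f0: "0 \<le> f z" and fK: "f z \<le> K" and f\<phi>: "f z \<le> \<phi> z" for z
    using phi_nonneg[of z] assms(1) by (auto simp: f_def)
  define F where "F p = f (fst p - snd p) * f (snd p) * f (fst p)" for p :: "real \<times> real"
  have "(\<Sum>b\<in>A0. \<Sum>a\<in>A. \<Sum>a'\<in>A. \<Sum>a''\<in>A. \<alpha> b * \<alpha> a * \<alpha> a' * \<alpha> a'' *
        (f ((a - a') / b) * f ((a' - a'') / b) * f ((a - a'') / b)))
      = (\<Sum>i\<in>A0 \<times> A \<times> A \<times> A. (case i of (b, a, a', a'') \<Rightarrow> \<alpha> b * \<alpha> a * \<alpha> a' * \<alpha> a'') *
        F (case i of (b, a, a', a'') \<Rightarrow> ((a - a'') / b, (a' - a'') / b)))"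
    by (simp add: sum.cartesian_product F_def split_def diff_divide_distrib)
  also have "\<dots> = (\<Sum>p\<in>Z \<times> Z. \<psi> p * F p)"
    unfolding \<psi>_def using fin fin_A0 fin_Z
    by (subst sum_push_mult) (auto intro: Z_I)
  finally have "(\<Sum>b\<in>A0. \<Sum>a\<in>A. \<Sum>a'\<in>A. \<Sum>a''\<in>A. \<alpha> b * \<alpha> a * \<alpha> a' * \<alpha> a'' *
        (f ((a - a') / b) * f ((a' - a'') / b) * f ((a - a'') / b)))\<^sup>2
      \<le> (\<Sum>p\<in>Z \<times> Z. (\<psi> p)\<^sup>2) * (\<Sum>p\<in>Z \<times> Z. (F p)\<^sup>2)"
    by (simp only: Cauchy_Schwarz_ineq_sum)
  also have "\<dots> \<le> (200000 * M powr (599 / 200)) *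
      (K * ((\<mu> + 6 * K\<^sup>2 * M) * w + M * (54 * K\<^sup>2 * M * w\<^sup>2 / \<mu>)))"
  proof (rule mult_mono[OF sum_psi_sq])
    have "(\<Sum>p\<in>Z \<times> Z. (F p)\<^sup>2) \<le> (\<Sum>(y, z)\<in>Z \<times> Z. K * ((f y)\<^sup>2 * (f z)\<^sup>2 * \<phi> (y - z)))"
    proof (rule sum_mono, clarify)
      fix y z
      have "f (y - z) * f (y - z) \<le> K * \<phi> (y - z)" by (intro mult_mono fK f\<phi> f0) (use assms in auto)
      then have "(f (y - z) * f (y - z)) * ((f y)\<^sup>2 * (f z)\<^sup>2) \<le> (K * \<phi> (y - z)) * ((f y)\<^sup>2 * (f z)\<^sup>2)"
        by (intro mult_right_mono) auto
      then show "(F (y, z))\<^sup>2 \<le> K * ((f y)\<^sup>2 * (f z)\<^sup>2 * \<phi> (y - z))"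
        by (simp add: F_def power2_eq_square mult_ac)
    qed
    also have "\<dots> = K * (\<Sum>(y, z)\<in>Z \<times> Z. (f y)\<^sup>2 * (f z)\<^sup>2 * \<phi> (y - z))"
      by (simp add: sum_distrib_left split_def)
    also have "\<dots> \<le> K * ((\<mu> + 6 * K\<^sup>2 * M) * w + M * (54 * K\<^sup>2 * M * w\<^sup>2 / \<mu>))"
    proof (intro mult_left_mono kappa_energy)
      have "(\<Sum>z\<in>Z. (f z)\<^sup>2) \<le> J" unfolding J_def by (intro sum_mono power_mono f\<phi> f0)
      then show "(\<Sum>z\<in>Z. (f z)\<^sup>2) \<le> w" using w by simp
      show "(f z)\<^sup>2 \<le> K\<^sup>2" for z by (intro power_mono fK f0)
    qed (use assms in auto)
    finally show "(\<Sum>p\<in>Z \<times> Z. (F p)\<^sup>2) \<le> K * ((\<mu> + 6 * K\<^sup>2 * M) * w + M * (54 * K\<^sup>2 * M * w\<^sup>2 / \<mu>))" .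
  qed (auto intro: sum_nonneg)
  finally show ?thesis .
qed

end

lemma sum_triple_permute:
  fixes w :: "'x \<Rightarrow> real" and R :: "'x set"
  defines "W \<equiv> \<lambda>F. \<Sum>x\<in>R. \<Sum>y\<in>R. \<Sum>z\<in>R. w x * w y * w z * F x y z"
  shows "W (\<lambda>x y z. F y x z) = W F" "W (\<lambda>x y z. F x z y) = W F" "W (\<lambda>x y z. F z y x) = W F"
    "W (\<lambda>x y z. F y z x) = W F" "W (\<lambda>x y z. F z x y) = W F"
proof -
  have 1: "W (\<lambda>x y z. F y x z) = W F" for F
    unfolding W_def by (subst sum.swap) (simp add: mult_ac)
  have 2: "W (\<lambda>x y z. F x z y) = W F" for F
    unfolding W_def by (rule sum.cong[OF refl], subst sum.swap) (simp add: mult_ac)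
  show "W (\<lambda>x y z. F y x z) = W F" "W (\<lambda>x y z. F x z y) = W F" by (fact 1, fact 2)
  show "W (\<lambda>x y z. F z y x) = W F"
    using 1[of "\<lambda>x y z. F z x y"] 2[of "\<lambda>x y z. F y x z"] 1[of F] by simp
  show "W (\<lambda>x y z. F y z x) = W F" using 1[of "\<lambda>x y z. F x z y"] 2[of F] by simp
  show "W (\<lambda>x y z. F z x y) = W F" using 2[of "\<lambda>x y z. F y x z"] 1[of F] by simp
qed

section \<open>Triangles with a large edge, and the choice of exponents\<close>

context bounded_weight
begin

text \<open>Summing over \<open>z\<close> first produces the squared degree of \<open>x\<close>,
  which is at most \<open>G\<close> on the retained vertices. What remains is the total of the heavy
  edges, bounded by the tail of \<open>\<phi>\<close>.\<close>

lemma heavy_edge_triangles_le: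
  assumes "0 < K" "0 < G"
  defines "h \<equiv> \<lambda>z. if K \<le> \<phi> z then \<phi> z else 0"
  shows "(\<Sum>b\<in>A0. \<alpha> b * (\<Sum>x\<in>{a\<in>A. deg2 b a \<le> G}. \<Sum>y\<in>{a\<in>A. deg2 b a \<le> G}. \<Sum>z\<in>{a\<in>A. deg2 b a \<le> G}.
    \<alpha> x * \<alpha> y * \<alpha> z * (h ((x - y) / b) * (\<phi> ((x - z) / b))\<^sup>2))) \<le> G * (433 * M ^ 3 / K)"
proof -
  have h0: "0 \<le> h z" for z using phi_nonneg by (simp add: h_def)
  have "(\<Sum>x\<in>{a\<in>A. deg2 b a \<le> G}. \<Sum>y\<in>{a\<in>A. deg2 b a \<le> G}. \<Sum>z\<in>{a\<in>A. deg2 b a \<le> G}.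
    \<alpha> x * \<alpha> y * \<alpha> z * (h ((x - y) / b) * (\<phi> ((x - z) / b))\<^sup>2))
    \<le> (\<Sum>x\<in>A. \<Sum>y\<in>A. G * (\<alpha> x * \<alpha> y * h ((x - y) / b)))" for b
  proof -
    have "(\<Sum>x\<in>{a\<in>A. deg2 b a \<le> G}. \<Sum>y\<in>{a\<in>A. deg2 b a \<le> G}. \<Sum>z\<in>{a\<in>A. deg2 b a \<le> G}.
        \<alpha> x * \<alpha> y * \<alpha> z * (h ((x - y) / b) * (\<phi> ((x - z) / b))\<^sup>2))
      \<le> (\<Sum>x\<in>{a\<in>A. deg2 b a \<le> G}. \<Sum>y\<in>{a\<in>A. deg2 b a \<le> G}. G * (\<alpha> x * \<alpha> y * h ((x - y) / b)))"
    proof (intro sum_mono)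
      fix x y assume xy: "x \<in> {a\<in>A. deg2 b a \<le> G}" "y \<in> {a\<in>A. deg2 b a \<le> G}"
      have "(\<Sum>z\<in>{a\<in>A. deg2 b a \<le> G}. \<alpha> x * \<alpha> y * \<alpha> z * (h ((x - y) / b) * (\<phi> ((x - z) / b))\<^sup>2))
          \<le> (\<Sum>z\<in>A. \<alpha> x * \<alpha> y * \<alpha> z * (h ((x - y) / b) * (\<phi> ((x - z) / b))\<^sup>2))"
        by (rule sum_mono2) (use fin nonneg h0 xy in auto)
      also have "\<dots> = (\<alpha> x * \<alpha> y * h ((x - y) / b)) * deg2 b x"
        by (simp add: deg2_def sum_distrib_left mult_ac)
      also have "\<dots> \<le> (\<alpha> x * \<alpha> y * h ((x - y) / b)) * G"
        using xy nonneg h0 by (intro mult_left_mono) auto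
      finally show "(\<Sum>z\<in>{a\<in>A. deg2 b a \<le> G}. \<alpha> x * \<alpha> y * \<alpha> z * (h ((x - y) / b) * (\<phi> ((x - z) / b))\<^sup>2))
          \<le> G * (\<alpha> x * \<alpha> y * h ((x - y) / b))" by (simp add: mult.commute)
    qed
    also have "\<dots> \<le> (\<Sum>x\<in>{a\<in>A. deg2 b a \<le> G}. \<Sum>y\<in>A. G * (\<alpha> x * \<alpha> y * h ((x - y) / b)))"
      by (intro sum_mono sum_mono2) (use fin nonneg h0 assms in auto)
    also have "\<dots> \<le> (\<Sum>x\<in>A. \<Sum>y\<in>A. G * (\<alpha> x * \<alpha> y * h ((x - y) / b)))"
      by (intro sum_mono2) (use fin nonneg h0 assms in \<open>auto intro!: sum_nonneg\<close>)
    finally show ?thesis .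
  qed
  then have "(\<Sum>b\<in>A0. \<alpha> b * (\<Sum>x\<in>{a\<in>A. deg2 b a \<le> G}. \<Sum>y\<in>{a\<in>A. deg2 b a \<le> G}. \<Sum>z\<in>{a\<in>A. deg2 b a \<le> G}.
    \<alpha> x * \<alpha> y * \<alpha> z * (h ((x - y) / b) * (\<phi> ((x - z) / b))\<^sup>2)))
    \<le> (\<Sum>b\<in>A0. \<alpha> b * (\<Sum>x\<in>A. \<Sum>y\<in>A. G * (\<alpha> x * \<alpha> y * h ((x - y) / b))))"
    by (intro sum_mono mult_left_mono) (auto intro: nonneg dest: A0_D)
  also have "\<dots> = G * (\<Sum>z\<in>Z. \<phi> z * h z)"
    unfolding sum_phi_mult sum_distrib_left by (intro sum.cong refl) (simp add: mult_ac)
  also have "(\<Sum>z\<in>Z. \<phi> z * h z) = (\<Sum>z\<in>{z\<in>Z. K \<le> \<phi> z}. (\<phi> z)\<^sup>2)"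
    by (rule sum.mono_neutral_cong_right) (use fin_Z in \<open>auto simp: h_def power2_eq_square\<close>)
  also have "G * \<dots> \<le> G * (433 * M ^ 3 / K)"
    using assms by (intro mult_left_mono phi_tail) auto
  finally show ?thesis .
qed

text \<open>If an edge \<open>p\<close> is at least \<open>K\<close>, then
  \<open>p * q * s \<le> (p * q\<^sup>2 + p * s\<^sup>2) / 2\<close>. Two edges of a triangle always
  share a vertex, so each of the six possible terms is a relabelling of the sum in
  \<open>heavy_edge_triangles_le\<close>; six halves give the factor 3.\<close>

lemma triangles_le:
  assumes "0 < K" "0 < G"
  defines "f \<equiv> \<lambda>z. if \<phi> z < K then \<phi> z else 0"
  shows "(\<Sum>b\<in>A0. \<alpha> b * (\<Sum>a\<in>{a\<in>A. deg2 b a \<le> G}. \<Sum>a'\<in>{a\<in>A. deg2 b a \<le> G}. \<Sum>a''\<in>{a\<in>A. deg2 b a \<le> G}.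
      \<alpha> a * \<alpha> a' * \<alpha> a'' * (\<phi> ((a - a') / b) * \<phi> ((a' - a'') / b) * \<phi> ((a - a'') / b))))
    \<le> (\<Sum>b\<in>A0. \<Sum>a\<in>A. \<Sum>a'\<in>A. \<Sum>a''\<in>A. \<alpha> b * \<alpha> a * \<alpha> a' * \<alpha> a'' *
        (f ((a - a') / b) * f ((a' - a'') / b) * f ((a - a'') / b))) + 3 * (G * (433 * M ^ 3 / K))"
proof -
  define h where "h z = (if K \<le> \<phi> z then \<phi> z else 0)" for z
  define R where "R b = {a\<in>A. deg2 b a \<le> G}" for b
  have h0: "0 \<le> h z" and f0: "0 \<le> f z" for z using phi_nonneg by (auto simp: h_def f_def)
  have heven: "h ((x - y) / b) = h ((y - x) / b)" and \<phi>even: "\<phi> ((x - y) / b) = \<phi> ((y - x) / b)" for x y b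
    using phi_uminus[of "(y - x) / b"] by (auto simp: h_def minus_divide_left)
  define S where "S b = (\<Sum>a\<in>A. \<Sum>a'\<in>A. \<Sum>a''\<in>A. \<alpha> a * \<alpha> a' * \<alpha> a'' *
        (f ((a - a') / b) * f ((a' - a'') / b) * f ((a - a'') / b)))" for b
  define F where "F b x y z = h ((x - y) / b) * (\<phi> ((x - z) / b))\<^sup>2" for b x y z
  define W where "W b F = (\<Sum>x\<in>R b. \<Sum>y\<in>R b. \<Sum>z\<in>R b. \<alpha> x * \<alpha> y * \<alpha> z * F x y z)" for b F
  have R\<alpha>: "0 \<le> \<alpha> a" if "a \<in> R b" for a b using that nonneg by (auto simp: R_def)
  have ptw: "p * q * s \<le> (if p < K then p else 0) * (if q < K then q else 0) * (if s < K then s else 0)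
      + ((if K \<le> p then p else 0) * s\<^sup>2 + (if K \<le> p then p else 0) * q\<^sup>2
      + (if K \<le> q then q else 0) * p\<^sup>2 + (if K \<le> q then q else 0) * s\<^sup>2
      + (if K \<le> s then s else 0) * p\<^sup>2 + (if K \<le> s then s else 0) * q\<^sup>2) / 2"
    if pqs: "0 \<le> p" "0 \<le> q" "0 \<le> s" for p q s :: real
  proof -
    have amgm: "2 * (x * y * z) \<le> x * y\<^sup>2 + x * z\<^sup>2" if "0 \<le> x" for x y z :: real
      using mult_left_mono[OF sum_squares_bound[of y z] that] by (simp add: algebra_simps)
    have nn: "0 \<le> p * s\<^sup>2" "0 \<le> p * q\<^sup>2" "0 \<le> q * p\<^sup>2" "0 \<le> q * s\<^sup>2" "0 \<le> s * p\<^sup>2" "0 \<le> s * q\<^sup>2"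
      using pqs by auto
    show ?thesis
    proof (cases "p < K \<and> q < K \<and> s < K")
      case False
      have *: "2 * (p * q * s) \<le> (if K \<le> p then p else 0) * s\<^sup>2 + (if K \<le> p then p else 0) * q\<^sup>2
        + (if K \<le> q then q else 0) * p\<^sup>2 + (if K \<le> q then q else 0) * s\<^sup>2
        + (if K \<le> s then s else 0) * p\<^sup>2 + (if K \<le> s then s else 0) * q\<^sup>2"
        using False nn amgm[OF pqs(1), of q s] amgm[OF pqs(2), of p s] amgm[OF pqs(3), of p q]
        by (auto simp: mult_ac not_less)
      have "0 \<le> (if p < K then p else 0) * (if q < K then q else 0) * (if s < K then s else 0)"
        using pqs by simp
      moreover have "t \<le> Y + X / 2" if "0 \<le> Y" "2 * t \<le> X" for t X Y :: real using that by simp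
      ultimately show ?thesis using * by blast
    qed (use nn in auto)
  qed
  have "W b (\<lambda>a a' a''. \<phi> ((a - a') / b) * \<phi> ((a' - a'') / b) * \<phi> ((a - a'') / b)) \<le> S b + 3 * W b (F b)" for b
  proof -
    have "W b (\<lambda>a a' a''. \<phi> ((a - a') / b) * \<phi> ((a' - a'') / b) * \<phi> ((a - a'') / b))
      \<le> W b (\<lambda>x y z. f ((x - y) / b) * f ((y - z) / b) * f ((x - z) / b)
          + (F b x y z + F b y x z + F b y z x + F b z y x + F b x z y + F b z x y) / 2)"
      unfolding W_def
    proof (intro sum_mono mult_left_mono mult_nonneg_nonneg R\<alpha>)
      fix x y z
      show "\<phi> ((x - y) / b) * \<phi> ((y - z) / b) * \<phi> ((x - z) / b)
        \<le> f ((x - y) / b) * f ((y - z) / b) * f ((x - z) / b)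
          + (F b x y z + F b y x z + F b y z x + F b z y x + F b x z y + F b z x y) / 2"
        using ptw[OF phi_nonneg phi_nonneg phi_nonneg, of "(x - y) / b" "(y - z) / b" "(x - z) / b"]
        unfolding F_def heven[of y x] \<phi>even[of y x] heven[of z y] \<phi>even[of z x] heven[of z x] \<phi>even[of z y]
        by (simp only: f_def h_def)
    qed
    also have "\<dots> = W b (\<lambda>x y z. f ((x - y) / b) * f ((y - z) / b) * f ((x - z) / b))
        + (W b (\<lambda>x y z. F b x y z) + W b (\<lambda>x y z. F b y x z) + W b (\<lambda>x y z. F b y z x)
        + W b (\<lambda>x y z. F b z y x) + W b (\<lambda>x y z. F b x z y) + W b (\<lambda>x y z. F b z x y)) / 2"
      unfolding W_def by (simp add: distrib_left sum.distrib sum_divide_distrib add_divide_distrib)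
    also have "\<dots> = W b (\<lambda>x y z. f ((x - y) / b) * f ((y - z) / b) * f ((x - z) / b)) + 3 * W b (F b)"
      unfolding W_def using sum_triple_permute[where w = \<alpha> and R = "R b" and F = "F b"] by simp
    also have "W b (\<lambda>x y z. f ((x - y) / b) * f ((y - z) / b) * f ((x - z) / b)) \<le> S b"
    proof -
      have sub: "R b \<subseteq> A" by (auto simp: R_def)
      have t0: "0 \<le> \<alpha> x * \<alpha> y * \<alpha> z * (f ((x - y) / b) * f ((y - z) / b) * f ((x - z) / b))"
        if "x \<in> A" "y \<in> A" "z \<in> A" for x y z
        using that by (intro mult_nonneg_nonneg f0 nonneg)
      show ?thesis unfolding W_def S_def using sub
        by (intro order.trans[OF sum_mono2[OF fin sub] sum_mono] order.trans[OF sum_mono2[OF fin sub] sum_mono] sum_mono2 fin sum_nonneg t0)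
          auto
    qed
    finally show ?thesis by simp
  qed
  then have "(\<Sum>b\<in>A0. \<alpha> b * W b (\<lambda>a a' a''. \<phi> ((a - a') / b) * \<phi> ((a' - a'') / b) * \<phi> ((a - a'') / b)))
    \<le> (\<Sum>b\<in>A0. \<alpha> b * (S b + 3 * W b (F b)))"
    by (intro sum_mono mult_left_mono) (auto intro: nonneg dest: A0_D)
  also have "\<dots> = (\<Sum>b\<in>A0. \<alpha> b * S b) + 3 * (\<Sum>b\<in>A0. \<alpha> b * W b (F b))"
    by (simp add: distrib_left sum.distrib sum_distrib_left mult_ac)
  also have "\<dots> \<le> (\<Sum>b\<in>A0. \<alpha> b * S b) + 3 * (G * (433 * M ^ 3 / K))"
    using heavy_edge_triangles_le[OF assms(1,2)] unfolding W_def F_def R_def h_def by simp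
  also have "(\<Sum>b\<in>A0. \<alpha> b * S b) = (\<Sum>b\<in>A0. \<Sum>a\<in>A. \<Sum>a'\<in>A. \<Sum>a''\<in>A. \<alpha> b * \<alpha> a * \<alpha> a' * \<alpha> a'' *
        (f ((a - a') / b) * f ((a' - a'') / b) * f ((a - a'') / b)))"
    by (simp add: S_def sum_distrib_left mult.assoc)
  finally show ?thesis unfolding W_def R_def .
qed

theorem J_bound: "J \<le> 500000 * M powr (151 / 100)"
proof -
  \<comment> \<open>The bad vertices have mass about
    \<open>M powr (599/200) / G = M powr (1/40)\<close>, and \<open>K1\<close> makes their cost
    exactly \<open>M powr (151/100)\<close>; its tail \<open>M^3 / K1\<close> is smaller still.
    Triangles need the separate, larger threshold \<open>K\<close>: it puts
    \<open>G * M^3 / K\<close> at \<open>M powr (453/100)\<close>, the cube of the target. Finally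
    \<open>\<mu>\<close> balances the two terms of \<open>kappa_energy\<close> at
    \<open>M powr (469/100)\<close>. This leaves exponent \<open>365/40 = 9.125\<close> for
    \<open>S\<^sup>2\<close>, where \<open>9.06\<close> suffices.\<close>
  define K1 where "K1 = M powr (297 / 200)"
  define K where "K = M powr (36 / 25)"
  define G where "G = M powr (297 / 100)"
  define \<mu> where "\<mu> = M powr (319 / 100)"
  define w where "w = 61 * M powr (3 / 2)"
  define f where "f = (\<lambda>z. if \<phi> z < K then \<phi> z else 0)"
  have pos: "0 < K1" "0 < K" "0 < G" "0 < \<mu>" using M by (auto simp: K1_def K_def G_def \<mu>_def)
  have M3: "M ^ 3 = M powr 3" and M1: "M = M powr 1" using M by simp_all
  have mono: "M powr a \<le> M powr b" if "b \<le> a" for a b using M that by (intro powr_mono') auto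
  have padd: "M powr a * M powr b = M powr (a + b)" and pdiv: "M powr a / M powr b = M powr (a - b)" for a b
    by (simp_all add: powr_add powr_diff)
  define Q where "Q = (\<Sum>b\<in>A0. \<alpha> b * (\<Sum>a\<in>{a\<in>A. deg2 b a \<le> G}. \<Sum>a'\<in>{a\<in>A. deg2 b a \<le> G}.
      \<alpha> a * \<alpha> a' * \<phi> ((a - a') / b)))"
  define S where "S = (\<Sum>b\<in>A0. \<Sum>a\<in>A. \<Sum>a'\<in>A. \<Sum>a''\<in>A. \<alpha> b * \<alpha> a * \<alpha> a' * \<alpha> a'' *
        (f ((a - a') / b) * f ((a' - a'') / b) * f ((a - a'') / b)))"
  have JQ: "J - 2 * K1 * (200000 * M powr (599 / 200) / G) - 433 * M ^ 3 / K1 \<le> Q"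
    unfolding Q_def using edges_ge[OF pos(3,1)] .
  have e1: "K1 * (M powr (599 / 200) / G) = M powr (151 / 100)"
    by (simp add: K1_def G_def padd pdiv)
  have e2: "M ^ 3 / K1 \<le> M powr (151 / 100)"
    unfolding M3 K1_def pdiv by (rule mono) simp
  have J1: "J \<le> Q + 400433 * M powr (151 / 100)"
    using JQ e1 e2 by simp
  have "S\<^sup>2 \<le> (200000 * M powr (599 / 200)) * (K * ((\<mu> + 6 * K\<^sup>2 * M) * w + M * (54 * K\<^sup>2 * M * w\<^sup>2 / \<mu>)))"
    unfolding S_def f_def using small_triangles_le[OF pos(2,4), of w] J_le by (simp add: w_def)
  \<comment> \<open>The constant is \<open>201361 = 7 * 61 + 54 * 61^2\<close>, with 61 from
    \<open>J_le\<close>.\<close>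
  also have "\<dots> \<le> (200000 * M powr (599 / 200)) * (201361 * M powr (613 / 100))"
  proof (rule mult_left_mono)
    have K2: "K\<^sup>2 = M powr (72 / 25)" by (simp add: K_def power2_eq_square padd)
    have w2: "w\<^sup>2 = 3721 * M powr 3" by (simp add: w_def power2_eq_square padd)
    have "K\<^sup>2 * M = M powr (97 / 25)" unfolding K2 using padd[of "72 / 25" 1] M by simp
    also have "\<dots> \<le> \<mu>" unfolding \<mu>_def by (rule mono) simp
    finally have "(\<mu> + 6 * K\<^sup>2 * M) * w \<le> (7 * \<mu>) * w" by (intro mult_right_mono) (auto simp: w_def)
    also have "\<dots> = 427 * M powr (469 / 100)" by (simp add: \<mu>_def w_def padd)
    finally have a: "(\<mu> + 6 * K\<^sup>2 * M) * w \<le> 427 * M powr (469 / 100)" .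
    have "M * (54 * K\<^sup>2 * M * w\<^sup>2 / \<mu>) = 200934 * ((M powr 1 * (M powr (72 / 25) * (M powr 1 * M powr 3))) / \<mu>)"
      unfolding K2 w2 M1[symmetric] by simp
    also have "\<dots> = 200934 * M powr (469 / 100)" by (simp only: \<mu>_def padd pdiv) simp
    finally have "(\<mu> + 6 * K\<^sup>2 * M) * w + M * (54 * K\<^sup>2 * M * w\<^sup>2 / \<mu>) \<le> 201361 * M powr (469 / 100)"
      using a by simp
    then have "K * ((\<mu> + 6 * K\<^sup>2 * M) * w + M * (54 * K\<^sup>2 * M * w\<^sup>2 / \<mu>)) \<le> K * (201361 * M powr (469 / 100))"
      using pos by simp
    also have "\<dots> = 201361 * M powr (613 / 100)" by (simp add: K_def padd)
    finally show "K * ((\<mu> + 6 * K\<^sup>2 * M) * w + M * (54 * K\<^sup>2 * M * w\<^sup>2 / \<mu>)) \<le> 201361 * M powr (613 / 100)" .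
  qed simp
  also have "\<dots> = 40272200000 * M powr (365 / 40)" by (simp add: padd)
  also have "\<dots> \<le> 44100000000 * M powr (906 / 100)"
    by (intro mult_mono mono) auto
  also have "\<dots> = (210000 * M powr (453 / 100))\<^sup>2" by (simp add: power2_eq_square padd)
  finally have S: "S \<le> 210000 * M powr (453 / 100)" by (rule power2_le_imp_le) simp
  have "Q ^ 3 \<le> (\<Sum>b\<in>A0. \<alpha> b * (\<Sum>a\<in>{a\<in>A. deg2 b a \<le> G}. \<Sum>a'\<in>{a\<in>A. deg2 b a \<le> G}. \<Sum>a''\<in>{a\<in>A. deg2 b a \<le> G}.
      \<alpha> a * \<alpha> a' * \<alpha> a'' * (\<phi> ((a - a') / b) * \<phi> ((a' - a'') / b) * \<phi> ((a - a'') / b))))"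
    unfolding Q_def by (rule triangles_ge) auto
  also have "\<dots> \<le> S + 3 * (G * (433 * M ^ 3 / K))"
    unfolding S_def f_def by (rule triangles_le[OF pos(2,3)])
  also have "G * (433 * M ^ 3 / K) = 433 * (M powr (297 / 100) * M powr 3 / M powr (36 / 25))"
    by (simp add: M3 G_def K_def)
  also have "\<dots> = 433 * M powr (453 / 100)" by (simp only: padd pdiv) simp
  finally have "Q ^ 3 \<le> 1000000 * M powr (453 / 100)" using S powr_ge_zero[of M "453 / 100"] by linarith
  also have "\<dots> = (100 * M powr (151 / 100)) ^ 3" by (simp add: power3_eq_cube padd)
  finally have "Q ^ Suc 2 \<le> (100 * M powr (151 / 100)) ^ Suc 2" by (simp add: numeral_3_eq_3)
  then have "Q \<le> 100 * M powr (151 / 100)" by (rule power_le_imp_le_base) simp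
  then show ?thesis using J1 powr_ge_zero[of M "151 / 100"] by linarith
qed

end

section \<open>Removing heavy atoms\<close>

text \<open>By \<open>2 * x * y \<le> x\<^sup>2 + y\<^sup>2\<close> at each point of the line; a
  nonzero slope makes the second coordinates distinct. Unlike \<open>line_mass_le\<close>, this does
  not depend on the largest atom.\<close>

lemma line_mass_le_sq:
  assumes "finite A" "finite B" "A \<subseteq> C" "B \<subseteq> C" "finite C" "l \<noteq> 0"
  shows "line_mass p A p B l t \<le> (\<Sum>x\<in>C. (p x)\<^sup>2)"
proof -
  define S where "S = {x\<in>A. l * x + t \<in> B}"
  have fS: "finite S" using assms(1) by (simp add: S_def)
  have "2 * line_mass p A p B l t \<le> (\<Sum>x\<in>S. (p x)\<^sup>2) + (\<Sum>x\<in>S. (p (l * x + t))\<^sup>2)"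
    unfolding line_mass_alt[OF assms(1,2)] S_def[symmetric] sum_distrib_left sum.distrib[symmetric]
    by (intro sum_mono) (metis mult.assoc sum_squares_bound)
  also have "(\<Sum>x\<in>S. (p (l * x + t))\<^sup>2) = (\<Sum>y\<in>(\<lambda>x. l * x + t) ` S. (p y)\<^sup>2)"
    by (subst sum.reindex) (use assms(6) in \<open>auto simp: inj_on_def\<close>)
  also have "\<dots> \<le> (\<Sum>x\<in>C. (p x)\<^sup>2)"
    by (rule sum_mono2) (use assms in \<open>auto simp: S_def\<close>)
  also have "(\<Sum>x\<in>S. (p x)\<^sup>2) \<le> (\<Sum>x\<in>C. (p x)\<^sup>2)"
    by (rule sum_mono2) (use assms in \<open>auto simp: S_def\<close>)
  finally show ?thesis by simp
qed

lemma line_mass_ratio: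
  assumes "0 \<notin> A"
  shows "line_mass p A q B l 0 = push (A \<times> B) (\<lambda>(b, d). p b * q d) (\<lambda>(b, d). d / b) l"
  unfolding line_mass_def push_def by (rule sum.cong) (use assms in \<open>auto simp: field_simps\<close>)

lemma line_mass_mono:
  assumes "finite A" "finite B" "A' \<subseteq> A" "B' \<subseteq> B"
    and "\<And>x. x \<in> A \<Longrightarrow> 0 \<le> p x" "\<And>y. y \<in> B \<Longrightarrow> 0 \<le> q y"
  shows "line_mass p A' q B' l t \<le> line_mass p A q B l t"
  unfolding line_mass_def push_def by (rule sum_mono2) (use assms in auto)

lemma line_mass_partition:
  fixes v :: "real \<Rightarrow> nat"
  assumes "finite A" "finite B" "\<And>x. x \<in> A \<Longrightarrow> v x < n" "\<And>x. x \<in> B \<Longrightarrow> v x < n"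
  shows "line_mass p A q B l t =
    (\<Sum>(i, j)\<in>{..<n} \<times> {..<n}. line_mass p {x\<in>A. v x = i} q {x\<in>B. v x = j} l t)"
proof -
  define E where "E = {i \<in> A \<times> B. (case i of (x, y) \<Rightarrow> y - l * x) = t}"
  have fE: "finite E" using assms by (auto simp: E_def)
  have "(\<Sum>k\<in>{..<n} \<times> {..<n}. \<Sum>e\<in>{e\<in>E. (v (fst e), v (snd e)) = k}. case e of (x, y) \<Rightarrow> p x * q y)
      = (\<Sum>(x, y)\<in>E. p x * q y)"
    by (rule sum.group[OF fE]) (use assms in \<open>auto simp: E_def\<close>)
  also have "\<dots> = line_mass p A q B l t"
    unfolding line_mass_def push_def E_def ..
  finally have "line_mass p A q B l t = (\<Sum>k\<in>{..<n} \<times> {..<n}.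
      \<Sum>e\<in>{e\<in>E. (v (fst e), v (snd e)) = k}. case e of (x, y) \<Rightarrow> p x * q y)" ..
  also have "\<dots> = (\<Sum>(i, j)\<in>{..<n} \<times> {..<n}. line_mass p {x\<in>A. v x = i} q {x\<in>B. v x = j} l t)"
    unfolding line_mass_def push_def E_def
    by (intro sum.cong refl) (auto intro!: sum.cong)
  finally show ?thesis .
qed

lemma sum_sq_le_card:
  fixes f :: "'i \<Rightarrow> real"
  shows "(\<Sum>i\<in>I. f i)\<^sup>2 \<le> card I * (\<Sum>i\<in>I. (f i)\<^sup>2)"
  using Cauchy_Schwarz_ineq_sum[of "\<lambda>_. 1" f I] by simp

section \<open>The quantity \<open>N\<close> and the line energy of four sets of atoms\<close>

locale finite_weight =
  fixes A :: "real set" and \<nu> :: "real \<Rightarrow> real"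
  assumes fin: "finite A" and nonneg: "\<And>a. a \<in> A \<Longrightarrow> 0 \<le> \<nu> a" and mass: "sum \<nu> A = 1"
begin

definition "N = (\<Sum>a\<in>A. (\<nu> a)\<^sup>2)"

lemma mass_le: "B \<subseteq> A \<Longrightarrow> sum \<nu> B \<le> 1"
  using sum_mono2[OF fin, of B \<nu>] nonneg mass by fastforce

lemma le_1: "a \<in> A \<Longrightarrow> \<nu> a \<le> 1"
  using mass_le[of "{a}"] by simp

lemma N_le: "N \<le> 1"
proof -
  have "N \<le> (\<Sum>a\<in>A. 1 * \<nu> a)"
    unfolding N_def power2_eq_square by (intro sum_mono mult_right_mono le_1 nonneg)
  then show ?thesis using mass by simp
qed

lemma N_pos: "0 < N"
proof (rule ccontr)
  assume "\<not> 0 < N"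
  then have "N = 0" using sum_nonneg[of A "\<lambda>a. (\<nu> a)\<^sup>2"] by (simp add: N_def)
  then have "\<forall>a\<in>A. \<nu> a = 0" unfolding N_def using fin by (subst (asm) sum_nonneg_eq_0_iff) auto
  then show False using mass by simp
qed

lemma N_mono: "b \<le> a \<Longrightarrow> N powr a \<le> N powr b"
  using N_pos N_le by (intro powr_mono') auto

lemma le_sqrt_N:
  assumes "a \<in> A" shows "\<nu> a \<le> N powr (1 / 2)"
proof -
  have "(\<nu> a)\<^sup>2 \<le> N"
    unfolding N_def using fin assms by (intro member_le_sum) auto
  then have "\<nu> a \<le> sqrt N" by (rule real_le_rsqrt)
  then show ?thesis using N_pos by (simp add: powr_half_sqrt)
qed

text \<open>The part of the count with \<open>b, c\<close> in \<open>B1\<close>, \<open>f, g\<close>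
  in \<open>B2\<close>, \<open>a, d\<close> in \<open>A1\<close> and \<open>e, h\<close> in
  \<open>A2\<close>, in the notation of the overview.\<close>

definition quad :: "real set \<Rightarrow> (real \<Rightarrow> real set) \<Rightarrow> real set \<Rightarrow> real set \<Rightarrow> real set \<Rightarrow> real set \<Rightarrow> real" where
  "quad \<Lambda> T B1 B2 A1 A2 = (\<Sum>l\<in>\<Lambda>. (line_mass \<nu> B1 \<nu> B2 l 0)\<^sup>2 * (\<Sum>t\<in>T l. (line_mass \<nu> A1 \<nu> A2 l t)\<^sup>2))"

text \<open>The line energy with weights \<open>r\<^sup>2\<close>, which are at most
  \<open>N\<^sup>2\<close> and have sum at most \<open>N * v\<close>. With \<open>\<mu>\<close>
  slightly above \<open>N powr (3/2)\<close>, the last term improves on \<open>N powr (5/2)\<close>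
  in spite of the losses in \<open>Mw\<close>. The first term would be too large at
  \<open>4997/2000\<close>, but \<open>small\<close> lifts its exponent to
  \<open>5003/2000\<close>.\<close>

lemma quad_heavy_le:
  assumes sub: "B1 \<subseteq> A" "B2 \<subseteq> A" "A1 \<subseteq> A" "A2 \<subseteq> A" and nz: "0 \<notin> B1"
    and \<Lambda>: "finite \<Lambda>" "0 \<notin> \<Lambda>" "\<And>l. finite (T l)"
    and M: "0 < M1" "0 < M2" "\<And>x. x \<in> A1 \<Longrightarrow> \<nu> x \<le> M1" "\<And>x. x \<in> A2 \<Longrightarrow> \<nu> x \<le> M2"
    and Mw: "M1 * sum \<nu> A1 \<le> N powr (1999 / 2000)" "M2 * sum \<nu> A2 \<le> N powr (1999 / 2000)"
    and small: "(sum \<nu> A1 * sum \<nu> A2) * (sum \<nu> B1 * sum \<nu> B2) \<le> N powr (6 / 2000)"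
  shows "quad \<Lambda> T B1 B2 A1 A2 \<le> 61 * N powr (5001 / 2000)"
proof -
  define r where "r l = line_mass \<nu> B1 \<nu> B2 l 0" for l
  define w1 where "w1 = sum \<nu> A1"
  define w2 where "w2 = sum \<nu> A2"
  define v where "v = sum \<nu> B1 * sum \<nu> B2"
  define \<mu> where "\<mu> = N powr (2997 / 2000)"
  have padd: "N powr a * N powr b = N powr (a + b)" and pdiv: "N powr a / N powr b = N powr (a - b)" for a b
    by (simp_all add: powr_add powr_diff)
  have N1: "N = N powr 1" using N_pos by simp
  have \<mu>: "0 < \<mu>" using N_pos by (simp add: \<mu>_def)
  have finB: "finite B1" "finite B2" "finite A1" "finite A2" using sub by (auto intro: finite_subset[OF _ fin])
  have nn: "0 \<le> \<nu> x" if "x \<in> B1 \<or> x \<in> B2 \<or> x \<in> A1 \<or> x \<in> A2" for x using that sub nonneg by auto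
  have w01: "0 \<le> w1" "w1 \<le> 1" "0 \<le> w2" "w2 \<le> 1"
    unfolding w1_def w2_def using nn sub mass_le by (auto intro!: sum_nonneg)
  have s01: "0 \<le> sum \<nu> B1" "sum \<nu> B1 \<le> 1" "0 \<le> sum \<nu> B2" "sum \<nu> B2 \<le> 1"
    using nn sub mass_le by (auto intro!: sum_nonneg)
  have v01: "0 \<le> v" "v \<le> 1" unfolding v_def using s01 by (auto intro: mult_le_one)
  have r0: "0 \<le> r l" for l unfolding r_def by (rule line_mass_nonneg) (use nn in auto)
  have rN: "r l \<le> N" if "l \<in> \<Lambda>" for l
    unfolding r_def N_def by (rule line_mass_le_sq) (use finB sub fin that \<Lambda> in auto)
  have "(\<Sum>l\<in>\<Lambda>. r l) \<le> (\<Sum>(b, d)\<in>B1 \<times> B2. \<nu> b * \<nu> d)"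
    unfolding r_def line_mass_ratio[OF nz]
    by (rule sum_push_le) (use finB \<Lambda> nn in auto)
  also have "\<dots> = v" by (simp add: v_def sum_product sum.cartesian_product)
  finally have rv: "(\<Sum>l\<in>\<Lambda>. r l) \<le> v" .
  have "(\<Sum>l\<in>\<Lambda>. (r l)\<^sup>2) \<le> (\<Sum>l\<in>\<Lambda>. N * r l)"
    unfolding power2_eq_square by (intro sum_mono mult_right_mono rN r0)
  also have "\<dots> \<le> N * v" unfolding sum_distrib_left[symmetric] using rv N_pos by (intro mult_left_mono) auto
  finally have r2: "(\<Sum>l\<in>\<Lambda>. (r l)\<^sup>2) \<le> N * v" .
  have "quad \<Lambda> T B1 B2 A1 A2 \<le> (\<mu> + 6 * M1 * M2) * (w1 * w2) * (N * v)
      + N\<^sup>2 * (54 * M1 * M2 * w1\<^sup>2 * w2\<^sup>2 / \<mu>)"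
    unfolding quad_def r_def[symmetric]
    by (rule weighted_line_energy[OF finB(3,4)])
      (use nn M \<mu> \<Lambda> r2 rN r0 in \<open>auto simp: w1_def w2_def intro: power_mono\<close>)
  also have "\<dots> = \<mu> * N * ((w1 * w2) * v) + 6 * ((M1 * w1) * (M2 * w2) * (N * v))
      + 54 * (((M1 * w1) * (M2 * w2) * N\<^sup>2 * (w1 * w2)) / \<mu>)"
    by (simp add: algebra_simps power2_eq_square)
  also have "\<dots> \<le> N powr (5001 / 2000) + 6 * N powr (5001 / 2000) + 54 * N powr (5001 / 2000)"
  proof (intro add_mono mult_left_mono)
    have "\<mu> * N * ((w1 * w2) * v) \<le> \<mu> * N * N powr (6 / 2000)"
      using small N_pos \<mu> by (intro mult_left_mono) (auto simp: w1_def w2_def v_def)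
    also have "\<dots> = N powr (2997 / 2000) * N powr 1 * N powr (6 / 2000)"
      using N_pos by (simp add: \<mu>_def)
    also have "\<dots> = N powr (5003 / 2000)" by (simp only: padd) simp
    also have "\<dots> \<le> N powr (5001 / 2000)" by (rule N_mono) simp
    finally show "\<mu> * N * ((w1 * w2) * v) \<le> N powr (5001 / 2000)" .
    have MM: "(M1 * w1) * (M2 * w2) \<le> N powr (1999 / 2000) * N powr (1999 / 2000)"
      using Mw M w01 by (intro mult_mono) (auto simp: w1_def w2_def)
    have "(M1 * w1) * (M2 * w2) * (N * v) \<le> N powr (1999 / 2000) * N powr (1999 / 2000) * (N powr 1 * 1)"
      using v01 N_pos M w01 by (intro mult_mono[OF MM] mult_mono) auto
    also have "\<dots> = N powr (5998 / 2000)" by (simp only: padd mult_1_right) simp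
    also have "\<dots> \<le> N powr (5001 / 2000)" by (rule N_mono) simp
    finally show "(M1 * w1) * (M2 * w2) * (N * v) \<le> N powr (5001 / 2000)" .
    have "(M1 * w1) * (M2 * w2) * N\<^sup>2 * (w1 * w2) / \<mu>
        \<le> N powr (1999 / 2000) * N powr (1999 / 2000) * N powr 2 * 1 / \<mu>"
      using w01 N_pos M \<mu> by (intro divide_right_mono mult_mono[OF mult_mono[OF MM]]) (auto intro: mult_le_one)
    also have "\<dots> = N powr (5001 / 2000)" by (simp only: padd pdiv \<mu>_def mult_1_right) simp
    finally show "(M1 * w1) * (M2 * w2) * N\<^sup>2 * (w1 * w2) / \<mu> \<le> N powr (5001 / 2000)" .
  qed auto
  finally show ?thesis by simp
qed

text \<open>One factor \<open>r\<close> is bounded by \<open>M\<close>, which leaves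
  \<open>M * J\<close>. The saving \<open>1/100\<close> in \<open>J_bound\<close> outweighs that
  \<open>M\<close> is a little larger than \<open>N\<close>: \<open>1994/2000 * 251/100\<close>
  exceeds \<open>5001/2000\<close>.\<close>

lemma quad_light_le:
  assumes C: "C = {x\<in>A. \<nu> x \<le> N powr (1994 / 2000)}"
    and sub: "B1 \<subseteq> C - {0}" "B2 \<subseteq> C - {0}" "A1 \<subseteq> C" "A2 \<subseteq> C"
    and \<Lambda>: "finite \<Lambda>" "\<And>l. finite (T l)"
  shows "quad \<Lambda> T B1 B2 A1 A2 \<le> 500000 * N powr (5001 / 2000)"
proof -
  define M where "M = N powr (1994 / 2000)"
  have M: "0 < M" "M \<le> 1" using N_pos N_le by (auto simp: M_def intro: powr_le1)
  interpret bw: bounded_weight C \<nu> M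
    by unfold_locales (use C fin nonneg mass_le[of C] M in \<open>auto simp: M_def\<close>)
  have A0: "bw.A0 = C - {0}" by (rule bw.A0_def)
  have r: "line_mass \<nu> (C - {0}) \<nu> (C - {0}) l 0 = bw.r l" for l
    unfolding bw.r_def A0 by (rule line_mass_ratio) auto
  have 1: "(line_mass \<nu> B1 \<nu> B2 l 0)\<^sup>2 \<le> (bw.r l)\<^sup>2" for l
    unfolding r[symmetric]
    by (intro power_mono line_mass_mono line_mass_nonneg) (use sub bw.fin bw.nonneg in auto)
  have 2: "(line_mass \<nu> A1 \<nu> A2 l t)\<^sup>2 \<le> (bw.m l t)\<^sup>2" for l t
    unfolding bw.m_def
    by (intro power_mono line_mass_mono line_mass_nonneg) (use sub bw.fin bw.nonneg in auto)
  have T: "(\<Sum>t\<in>T l. (bw.m l t)\<^sup>2) \<le> (\<Sum>t\<in>bw.T l. (bw.m l t)\<^sup>2)" for l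
  proof -
    have "(\<Sum>t\<in>T l. (bw.m l t)\<^sup>2) \<le> (\<Sum>t\<in>T l \<union> bw.T l. (bw.m l t)\<^sup>2)"
      by (rule sum_mono2) (use \<Lambda> bw.fin_T in auto)
    also have "\<dots> = (\<Sum>t\<in>bw.T l. (bw.m l t)\<^sup>2)"
      by (rule sum.mono_neutral_right) (use \<Lambda> bw.fin_T in \<open>auto simp: bw.m_def line_mass_def bw.T_def push_eq_0\<close>)
    finally show ?thesis .
  qed
  have "quad \<Lambda> T B1 B2 A1 A2 \<le> (\<Sum>l\<in>\<Lambda>. (bw.r l)\<^sup>2 * (\<Sum>t\<in>bw.T l. (bw.m l t)\<^sup>2))"
    unfolding quad_def
    by (intro sum_mono mult_mono 1 order.trans[OF sum_mono[OF 2] T] sum_nonneg) auto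
  also have "\<dots> \<le> (\<Sum>l\<in>\<Lambda> \<union> bw.\<Lambda>. (bw.r l)\<^sup>2 * (\<Sum>t\<in>bw.T l. (bw.m l t)\<^sup>2))"
    by (rule sum_mono2) (use \<Lambda> bw.fin_\<Lambda> in \<open>auto intro!: mult_nonneg_nonneg sum_nonneg\<close>)
  also have "\<dots> = (\<Sum>l\<in>bw.\<Lambda>. (bw.r l)\<^sup>2 * (\<Sum>t\<in>bw.T l. (bw.m l t)\<^sup>2))"
    by (rule sum.mono_neutral_right) (use \<Lambda> bw.fin_\<Lambda> in \<open>auto simp: bw.r_def bw.\<Lambda>_def push_eq_0\<close>)
  also have "\<dots> \<le> (\<Sum>l\<in>bw.\<Lambda>. M * (bw.r l * (\<Sum>t\<in>bw.T l. (bw.m l t)\<^sup>2)))"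
    unfolding power2_eq_square[of "bw.r _"] mult.assoc
    by (intro sum_mono mult_right_mono bw.r_le mult_nonneg_nonneg bw.r_nonneg sum_nonneg) auto
  also have "\<dots> = M * bw.J" by (simp add: bw.J_eq sum_distrib_left)
  also have "\<dots> \<le> M * (500000 * M powr (151 / 100))"
    using M bw.J_bound by (intro mult_left_mono) auto
  also have "\<dots> = 500000 * (M powr 1 * M powr (151 / 100))" using M by simp
  also have "M powr 1 * M powr (151 / 100) = N powr (1994 / 2000 * (251 / 100))"
    unfolding powr_add[symmetric] by (simp add: M_def powr_powr)
  also have "\<dots> \<le> N powr (5001 / 2000)" by (rule N_mono) simp
  finally show ?thesis by simp
qed

section \<open>Levels of atoms by powers of \<open>N\<close>\<close>

definition level :: "real \<Rightarrow> nat" where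
  "level x = (LEAST k. \<nu> x \<le> N powr (1 - (real k + 1) / 2000))"

text \<open>There are 1000 levels because the condition for \<open>k = 999\<close> is the universal
  bound \<open>\<nu> x \<le> N powr (1/2)\<close>. Level 0 contains all atoms up to
  \<open>N powr (1999/2000)\<close>, however small.\<close>

lemma level_le:
  assumes "x \<in> A"
  shows "level x < 1000" "\<nu> x \<le> N powr (1 - (real (level x) + 1) / 2000)"
proof -
  define P where "P k \<longleftrightarrow> \<nu> x \<le> N powr (1 - (real k + 1) / 2000)" for k
  have *: "P 999" using le_sqrt_N[OF assms] by (simp add: P_def)
  have l: "level x = (LEAST k. P k)" by (simp add: level_def P_def)
  show "level x < 1000" using Least_le[of P, OF *] by (simp add: l)
  show "\<nu> x \<le> N powr (1 - (real (level x) + 1) / 2000)"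
    using LeastI[of P, OF *] unfolding l[symmetric] by (simp add: P_def)
qed

lemma level_gt:
  assumes "0 < level x"
  shows "N powr (1 - real (level x) / 2000) < \<nu> x"
proof -
  have "\<not> \<nu> x \<le> N powr (1 - (real (level x - 1) + 1) / 2000)"
    using not_less_Least[of "level x - 1" "\<lambda>k. \<nu> x \<le> N powr (1 - (real k + 1) / 2000)"] assms
    by (simp add: level_def)
  then show ?thesis using assms by (simp add: of_nat_diff)
qed

text \<open>Chebyshev: for \<open>k > 0\<close> the atoms of level \<open>k\<close> exceed
  \<open>N powr (1 - k/2000)\<close>, while their squares add up to at most \<open>N\<close>. So the
  mass of a level times its largest atom exceeds \<open>N\<close> by one step of the scale at
  most.\<close>

lemma level_mass_le:
  assumes "B \<subseteq> {x\<in>A. level x = k}"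
  shows "sum \<nu> B \<le> N powr (real k / 2000)"
proof (cases "k = 0")
  case True
  then show ?thesis using mass_le[of B] assms N_pos by auto
next
  case False
  have fB: "finite B" using assms by (auto intro: finite_subset[OF _ fin])
  have "N powr (1 - real k / 2000) * sum \<nu> B \<le> (\<Sum>x\<in>B. (\<nu> x)\<^sup>2)"
    unfolding sum_distrib_left power2_eq_square
  proof (intro sum_mono mult_right_mono)
    fix x assume "x \<in> B"
    then show "N powr (1 - real k / 2000) \<le> \<nu> x" "0 \<le> \<nu> x"
      using level_gt[of x] False assms nonneg by auto
  qed
  also have "\<dots> \<le> N" unfolding N_def by (rule sum_mono2) (use fin assms in auto)
  finally have "sum \<nu> B \<le> N / N powr (1 - real k / 2000)"
    using N_pos by (simp add: pos_le_divide_eq mult.commute)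
  also have "\<dots> = N powr 1 / N powr (1 - real k / 2000)" using N_pos by simp
  also have "\<dots> = N powr (real k / 2000)" by (simp only: powr_diff[symmetric]) simp
  finally show ?thesis .
qed

text \<open>If all four levels are below 6, every atom is at most \<open>N powr (1994/2000)\<close>
  and the light case applies. Otherwise one of the four sets has mass at most
  \<open>N powr (6/2000)\<close>, which is the gain that the heavy case asks for.\<close>

lemma quad_levels_le:
  assumes \<Lambda>: "finite \<Lambda>" "0 \<notin> \<Lambda>" "\<And>l. finite (T l)"
  defines "L \<equiv> \<lambda>k. {x\<in>A. level x = k}" and "L0 \<equiv> \<lambda>k. {x\<in>A - {0}. level x = k}"
  shows "quad \<Lambda> T (L0 k1) (L0 k2) (L k3) (L k4) \<le> 500000 * N powr (5001 / 2000)"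
proof (cases "k1 < 6 \<and> k2 < 6 \<and> k3 < 6 \<and> k4 < 6")
  case True
  define C where "C = {x\<in>A. \<nu> x \<le> N powr (1994 / 2000)}"
  have *: "L k \<subseteq> C" if "k < 6" for k
  proof
    fix x assume "x \<in> L k"
    then have x: "x \<in> A" "level x = k" by (auto simp: L_def)
    have "\<nu> x \<le> N powr (1 - (real k + 1) / 2000)" using level_le(2)[OF x(1)] x(2) by simp
    also have "\<dots> \<le> N powr (1994 / 2000)" by (rule N_mono) (use that in simp)
    finally show "x \<in> C" using x by (simp add: C_def)
  qed
  have "L0 k \<subseteq> C - {0}" if "k < 6" for k using *[OF that] by (auto simp: L_def L0_def)
  with True * show ?thesis by (intro quad_light_le[OF C_def]) (use \<Lambda> in auto)
next
  case False
  have w: "0 \<le> sum \<nu> (L k)" "sum \<nu> (L k) \<le> 1" "sum \<nu> (L k) \<le> N powr (real k / 2000)" for k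
    unfolding L_def using nonneg by (auto intro!: sum_nonneg mass_le level_mass_le)
  have w0: "0 \<le> sum \<nu> (L0 k)" "sum \<nu> (L0 k) \<le> 1" "sum \<nu> (L0 k) \<le> N powr (real k / 2000)" for k
    unfolding L0_def using nonneg by (auto intro!: sum_nonneg mass_le level_mass_le)
  have heavy: "N powr (real k / 2000) \<le> N powr (6 / 2000)" if "\<not> k < 6" for k
    by (rule N_mono) (use that in simp)
  have small: "(sum \<nu> (L k3) * sum \<nu> (L k4)) * (sum \<nu> (L0 k1) * sum \<nu> (L0 k2)) \<le> N powr (6 / 2000)"
  proof -
    define a b c d where "a = sum \<nu> (L k3)" and "b = sum \<nu> (L k4)" and "c = sum \<nu> (L0 k1)" and "d = sum \<nu> (L0 k2)"
    have abcd: "0 \<le> a" "a \<le> 1" "0 \<le> b" "b \<le> 1" "0 \<le> c" "c \<le> 1" "0 \<le> d" "d \<le> 1"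
      using w w0 by (auto simp: a_def b_def c_def d_def)
    have le: "(a * b) * (c * d) \<le> a" "(a * b) * (c * d) \<le> b" "(a * b) * (c * d) \<le> c" "(a * b) * (c * d) \<le> d"
    proof -
      have "a * b \<le> a" "a * b \<le> b" "c * d \<le> c" "c * d \<le> d" "0 \<le> a * b" "0 \<le> c * d" "a * b \<le> 1" "c * d \<le> 1"
        using abcd by (auto intro: mult_left_le mult_left_le_one_le mult_le_one)
      then have "(a * b) * (c * d) \<le> a * b" "(a * b) * (c * d) \<le> c * d"
        by (auto intro: mult_left_le mult_left_le_one_le)
      then show "(a * b) * (c * d) \<le> a" "(a * b) * (c * d) \<le> b" "(a * b) * (c * d) \<le> c" "(a * b) * (c * d) \<le> d"
        using \<open>a * b \<le> a\<close> \<open>a * b \<le> b\<close> \<open>c * d \<le> c\<close> \<open>c * d \<le> d\<close> by linarith+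
    qed
    have "a \<le> N powr (6 / 2000) \<or> b \<le> N powr (6 / 2000) \<or> c \<le> N powr (6 / 2000) \<or> d \<le> N powr (6 / 2000)"
      using False heavy w(3)[of k3] w(3)[of k4] w0(3)[of k1] w0(3)[of k2]
      unfolding a_def b_def c_def d_def by (meson order.trans)
    then show ?thesis using le unfolding a_def[symmetric] b_def[symmetric] c_def[symmetric] d_def[symmetric]
      by linarith
  qed
  have Mw: "N powr (1 - (real k + 1) / 2000) * sum \<nu> (L k) \<le> N powr (1999 / 2000)" for k
  proof -
    have "N powr (1 - (real k + 1) / 2000) * sum \<nu> (L k)
        \<le> N powr (1 - (real k + 1) / 2000) * N powr (real k / 2000)"
      using w by (intro mult_left_mono) auto
    also have "\<dots> = N powr (1999 / 2000)" by (simp only: powr_add[symmetric]) (simp add: field_simps)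
    finally show ?thesis .
  qed
  have "quad \<Lambda> T (L0 k1) (L0 k2) (L k3) (L k4) \<le> 61 * N powr (5001 / 2000)"
    by (rule quad_heavy_le[OF _ _ _ _ _ \<Lambda> _ _ _ _ Mw Mw small])
      (use N_pos level_le in \<open>auto simp: L_def L0_def\<close>)
  also have "\<dots> \<le> 500000 * N powr (5001 / 2000)" by (intro mult_right_mono) auto
  finally show ?thesis .
qed

text \<open>Each line mass splits over \<open>10^6\<close> pairs of levels. Squaring costs that
  factor twice, and \<open>10^12\<close> combinations are then summed.\<close>

theorem quad_le:
  assumes \<Lambda>: "finite \<Lambda>" "0 \<notin> \<Lambda>" "\<And>l. finite (T l)"
  shows "quad \<Lambda> T (A - {0}) (A - {0}) A A \<le> 10 ^ 30 * N powr (5001 / 2000)"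
proof -
  define L where "L k = {x\<in>A. level x = k}" for k
  define L0 where "L0 k = {x\<in>A - {0}. level x = k}" for k
  define P where "P = {..<1000::nat} \<times> {..<1000::nat}"
  have P: "finite P" "real (card P) = 10 ^ 6" by (simp_all add: P_def)
  have r: "(line_mass \<nu> (A - {0}) \<nu> (A - {0}) l 0)\<^sup>2 \<le> 10 ^ 6 * (\<Sum>(i, j)\<in>P. (line_mass \<nu> (L0 i) \<nu> (L0 j) l 0)\<^sup>2)" for l
  proof -
    have "line_mass \<nu> (A - {0}) \<nu> (A - {0}) l 0 = (\<Sum>(i, j)\<in>P. line_mass \<nu> (L0 i) \<nu> (L0 j) l 0)"
      unfolding L0_def P_def by (rule line_mass_partition) (use fin level_le in auto)
    then show ?thesis using sum_sq_le_card[of "\<lambda>(i, j). line_mass \<nu> (L0 i) \<nu> (L0 j) l 0" P] P(2)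
      by (simp add: split_def)
  qed
  have m: "(line_mass \<nu> A \<nu> A l t)\<^sup>2 \<le> 10 ^ 6 * (\<Sum>(i, j)\<in>P. (line_mass \<nu> (L i) \<nu> (L j) l t)\<^sup>2)" for l t
  proof -
    have "line_mass \<nu> A \<nu> A l t = (\<Sum>(i, j)\<in>P. line_mass \<nu> (L i) \<nu> (L j) l t)"
      unfolding L_def P_def by (rule line_mass_partition) (use fin level_le in auto)
    then show ?thesis using sum_sq_le_card[of "\<lambda>(i, j). line_mass \<nu> (L i) \<nu> (L j) l t" P] P(2)
      by (simp add: split_def)
  qed
  define R where "R p l = (line_mass \<nu> (L0 (fst p)) \<nu> (L0 (snd p)) l 0)\<^sup>2" for p l
  define S where "S p l = (\<Sum>t\<in>T l. (line_mass \<nu> (L (fst p)) \<nu> (L (snd p)) l t)\<^sup>2)" for p l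
  have "quad \<Lambda> T (A - {0}) (A - {0}) A A \<le> (\<Sum>l\<in>\<Lambda>. (10 ^ 6 * (\<Sum>p\<in>P. R p l)) * (10 ^ 6 * (\<Sum>p\<in>P. S p l)))"
    unfolding quad_def
  proof (intro sum_mono mult_mono)
    fix l
    show "(line_mass \<nu> (A - {0}) \<nu> (A - {0}) l 0)\<^sup>2 \<le> 10 ^ 6 * (\<Sum>p\<in>P. R p l)"
      using r[of l] by (simp add: R_def split_def)
    have "(\<Sum>t\<in>T l. (line_mass \<nu> A \<nu> A l t)\<^sup>2) \<le> (\<Sum>t\<in>T l. 10 ^ 6 * (\<Sum>(i, j)\<in>P. (line_mass \<nu> (L i) \<nu> (L j) l t)\<^sup>2))"
      by (intro sum_mono m)
    also have "\<dots> = 10 ^ 6 * (\<Sum>p\<in>P. S p l)"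
      unfolding S_def sum_distrib_left[symmetric] by (subst sum.swap) (simp add: split_def)
    finally show "(\<Sum>t\<in>T l. (line_mass \<nu> A \<nu> A l t)\<^sup>2) \<le> 10 ^ 6 * (\<Sum>p\<in>P. S p l)" .
  qed (auto intro!: sum_nonneg simp: R_def)
  also have "\<dots> = (\<Sum>l\<in>\<Lambda>. 10 ^ 12 * ((\<Sum>p\<in>P. R p l) * (\<Sum>p\<in>P. S p l)))"
    by simp
  also have "\<dots> = 10 ^ 12 * (\<Sum>l\<in>\<Lambda>. \<Sum>p\<in>P. \<Sum>q\<in>P. R p l * S q l)"
    by (simp only: sum_product sum_distrib_left[symmetric])
  also have "(\<Sum>l\<in>\<Lambda>. \<Sum>p\<in>P. \<Sum>q\<in>P. R p l * S q l) = (\<Sum>p\<in>P. \<Sum>l\<in>\<Lambda>. \<Sum>q\<in>P. R p l * S q l)"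
    by (rule sum.swap)
  also have "\<dots> = (\<Sum>p\<in>P. \<Sum>q\<in>P. \<Sum>l\<in>\<Lambda>. R p l * S q l)"
    by (rule sum.cong[OF refl], rule sum.swap)
  also have "\<dots> = (\<Sum>p\<in>P. \<Sum>q\<in>P. quad \<Lambda> T (L0 (fst p)) (L0 (snd p)) (L (fst q)) (L (snd q)))"
    by (simp add: quad_def R_def S_def)
  also have "\<dots> \<le> (\<Sum>p\<in>P. \<Sum>q\<in>P. 500000 * N powr (5001 / 2000))"
    unfolding L_def L0_def by (intro sum_mono quad_levels_le \<Lambda>)
  also have "\<dots> = 10 ^ 6 * (10 ^ 6 * (500000 * N powr (5001 / 2000)))"
    using P(2) by simp
  also have "10 ^ 12 * \<dots> \<le> 10 ^ 30 * N powr (5001 / 2000)" by simp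
  finally show ?thesis by simp
qed

end

section \<open>Commuting matrices\<close>

context finite_weight
begin

definition "Q = A \<times> A \<times> A \<times> A"

definition V :: "real \<times> real \<times> real \<times> real \<Rightarrow> real" where
  "V = (\<lambda>(a, b, c, d). \<nu> a * \<nu> b * \<nu> c * \<nu> d)"

lemma V_nonneg: "q \<in> Q \<Longrightarrow> 0 \<le> V q"
  by (auto simp: Q_def V_def intro!: mult_nonneg_nonneg nonneg)

lemma sum_Q_prod:
  "(\<Sum>(a, b, c, d)\<in>Q. p1 a * p2 b * p3 c * p4 d) = sum p1 A * sum p2 A * sum p3 A * (sum p4 A :: real)"
proof -
  have "(\<Sum>(a, b, c, d)\<in>Q. p1 a * p2 b * p3 c * p4 d) = (\<Sum>a\<in>A. \<Sum>b\<in>A. \<Sum>c\<in>A. \<Sum>d\<in>A. p1 a * p2 b * p3 c * p4 d)"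
    by (simp add: Q_def sum.cartesian_product)
  also have "\<dots> = sum p1 A * sum p2 A * sum p3 A * sum p4 A"
    by (simp flip: sum_distrib_left sum_distrib_right)
  finally show ?thesis .
qed

lemma sum_line_le: "(\<Sum>x\<in>A. \<Sum>y\<in>A. \<nu> x * \<nu> y * of_bool (y = x + s)) \<le> N"
proof -
  have "(\<Sum>x\<in>A. \<Sum>y\<in>A. \<nu> x * \<nu> y * of_bool (y = x + s)) = line_mass \<nu> A \<nu> A 1 s"
    unfolding line_mass_def using fin
    by (subst push_alt) (auto simp: sum.cartesian_product split_def algebra_simps simp del: sum_mult_of_bool_eq intro!: sum.cong)
  also have "\<dots> \<le> N"
    unfolding N_def by (rule line_mass_le_sq) (use fin in auto)
  finally show ?thesis .
qed

text \<open>For fixed \<open>a\<close> and \<open>d\<close>, the pair \<open>(e, h)\<close> lies on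
  a line of slope 1, whose mass is at most \<open>N\<close> for every intercept. An arbitrary shift
  \<open>s\<close> covers all linear equations that can be solved for \<open>h\<close>.\<close>

lemma sum_shift_le: "(\<Sum>(a, d, e, h)\<in>Q. V (a, d, e, h) * of_bool (h = e + s a d)) \<le> N"
proof -
  have "(\<Sum>(a, d, e, h)\<in>Q. V (a, d, e, h) * of_bool (h = e + s a d))
      = (\<Sum>a\<in>A. \<Sum>d\<in>A. (\<nu> a * \<nu> d) * (\<Sum>e\<in>A. \<Sum>h\<in>A. \<nu> e * \<nu> h * of_bool (h = e + s a d)))"
    by (simp add: Q_def V_def sum.cartesian_product sum_distrib_left split_def mult.assoc del: sum_mult_of_bool_eq)
  also have "\<dots> \<le> (\<Sum>a\<in>A. \<Sum>d\<in>A. (\<nu> a * \<nu> d) * N)"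
    by (intro sum_mono mult_left_mono sum_line_le mult_nonneg_nonneg nonneg)
  also have "\<dots> = sum \<nu> A * sum \<nu> A * N" by (simp flip: sum_distrib_left sum_distrib_right)
  finally show ?thesis using mass by simp
qed

lemma sum_diag_le: "(\<Sum>(a, d, e, h)\<in>Q. V (a, d, e, h) * of_bool (d = a)) \<le> N"
proof -
  have "(\<Sum>(a, d, e, h)\<in>Q. V (a, d, e, h) * of_bool (d = a)) = (\<Sum>(e, h, a, d)\<in>Q. V (e, h, a, d) * of_bool (d = a + 0))"
    by (rule sum.reindex_bij_witness[where i = "\<lambda>(e, h, a, d). (a, d, e, h)" and j = "\<lambda>(a, d, e, h). (e, h, a, d)"])
      (auto simp: Q_def V_def)
  then show ?thesis using sum_shift_le[of "\<lambda>_ _. 0"] by simp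
qed

lemma sum_commuting_nonzero_le:
  "(\<Sum>(b, c, f, g)\<in>Q. \<Sum>(a, d, e, h)\<in>Q. V (b, c, f, g) * V (a, d, e, h) *
      of_bool (b \<noteq> 0 \<and> c \<noteq> 0 \<and> f \<noteq> 0 \<and> g \<noteq> 0 \<and> g / c = f / b \<and> h - f / b * d = e - f / b * a))
    \<le> 10 ^ 30 * N powr (5001 / 2000)"
    (is "?S \<le> _")
proof -
  \<comment> \<open>The trivial bound 1 gives access to the exact formulas for \<open>r\<close> and
    the second moment of \<open>m\<close>. The variables are regrouped as \<open>(b, f)\<close>,
    \<open>(c, g)\<close>, \<open>(a, e)\<close>, \<open>(d, h)\<close>: the first two pairs have
    the same ratio \<open>l\<close>, and the last two lie on one line of slope
    \<open>l\<close>.\<close>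
  interpret bw: bounded_weight A \<nu> 1
    by unfold_locales (use fin nonneg le_1 mass in auto)
  have A0: "A - {0} = bw.A0" by (simp add: bw.A0_def)
  have "?S = (\<Sum>((b, c, f, g), (a, d, e, h))\<in>Q \<times> Q. V (b, c, f, g) * V (a, d, e, h) *
      of_bool (b \<noteq> 0 \<and> c \<noteq> 0 \<and> f \<noteq> 0 \<and> g \<noteq> 0 \<and> g / c = f / b \<and> h - f / b * d = e - f / b * a))"
    by (simp add: sum.cartesian_product split_def del: sum_mult_of_bool_eq)
  also have "\<dots> = (\<Sum>((b, c, f, g), (a, d, e, h))\<in>(bw.A0 \<times> bw.A0 \<times> bw.A0 \<times> bw.A0) \<times> Q.
      V (b, c, f, g) * V (a, d, e, h) *
      of_bool (b \<noteq> 0 \<and> c \<noteq> 0 \<and> f \<noteq> 0 \<and> g \<noteq> 0 \<and> g / c = f / b \<and> h - f / b * d = e - f / b * a))"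
    by (rule sum.mono_neutral_right) (use fin in \<open>auto simp: Q_def bw.A0_def\<close>)
  also have "\<dots> = (\<Sum>(p, u, i, j)\<in>(bw.A0 \<times> bw.A0) \<times> (bw.A0 \<times> bw.A0) \<times> (A \<times> A) \<times> (A \<times> A).
      \<nu> (fst p) * \<nu> (snd p) * ((\<nu> (fst u) * \<nu> (snd u) * of_bool (snd u / fst u = snd p / fst p)) *
      ((\<nu> (fst i) * \<nu> (snd i)) * (\<nu> (fst j) * \<nu> (snd j)) *
      of_bool (snd j - snd p / fst p * fst j = snd i - snd p / fst p * fst i))))"
    by (rule sum.reindex_bij_witness[where
          i = "\<lambda>((b, f), (c, g), (a, e), (d, h)). ((b, c, f, g), (a, d, e, h))" and
          j = "\<lambda>((b, c, f, g), (a, d, e, h)). ((b, f), (c, g), (a, e), (d, h))"])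
      (auto simp: Q_def V_def bw.A0_D(2))
  also have "\<dots> = (\<Sum>l\<in>bw.\<Lambda>. bw.r l * (bw.r l * (\<Sum>t\<in>bw.T l. (bw.m l t)\<^sup>2)))"
  proof -
    have r: "bw.r l = (\<Sum>u\<in>bw.A0 \<times> bw.A0. \<nu> (fst u) * \<nu> (snd u) * of_bool (snd u / fst u = l))" for l
      unfolding bw.r_def using bw.fin_A0 by (subst push_alt) (auto simp: split_def)
    have rG: "bw.r l * (\<Sum>i\<in>A \<times> A. \<Sum>j\<in>A \<times> A. G i j) = (\<Sum>u\<in>bw.A0 \<times> bw.A0. \<Sum>i\<in>A \<times> A. \<Sum>j\<in>A \<times> A.
        (\<nu> (fst u) * \<nu> (snd u) * of_bool (snd u / fst u = l)) * G i j)" for l and G :: "real \<times> real \<Rightarrow> real \<times> real \<Rightarrow> real"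
      unfolding r sum_distrib_right unfolding sum_distrib_left ..
    show ?thesis
      unfolding bw.sum_r_mult unfolding bw.sum_m_sq rG
      by (simp add: sum.cartesian_product sum_distrib_left split_def mult.assoc
          del: sum_mult_of_bool_eq)
  qed
  also have "\<dots> = quad bw.\<Lambda> bw.T (A - {0}) (A - {0}) A A"
  proof -
    have r: "bw.r l = line_mass \<nu> (A - {0}) \<nu> (A - {0}) l 0" for l
      unfolding bw.r_def A0 by (rule line_mass_ratio[symmetric]) (simp add: bw.A0_def)
    show ?thesis
      unfolding quad_def r[symmetric] bw.m_def[symmetric] by (simp add: power2_eq_square mult.assoc)
  qed
  also have "\<dots> \<le> 10 ^ 30 * N powr (5001 / 2000)"
    by (rule quad_le) (use bw.fin_\<Lambda> bw.\<Lambda>_nonzero bw.fin_T in auto)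
  finally show ?thesis .
qed

section \<open>Matrices with a vanishing off-diagonal entry\<close>

definition "z = (\<Sum>a\<in>A. \<nu> a * of_bool (a = 0))"

lemma z_bounds: "0 \<le> z" "z \<le> 1"
proof -
  show "0 \<le> z" unfolding z_def by (intro sum_nonneg mult_nonneg_nonneg nonneg) auto
  have "z \<le> (\<Sum>a\<in>A. \<nu> a * 1)"
    unfolding z_def by (intro sum_mono mult_left_mono nonneg) auto
  then show "z \<le> 1" using mass by simp
qed

lemma sum_V_zeros:
  "(\<Sum>(b, c, f, g)\<in>Q. V (b, c, f, g) * (of_bool (b = 0) * of_bool (f = 0))) = z\<^sup>2"
  "(\<Sum>(b, c, f, g)\<in>Q. V (b, c, f, g) * (of_bool (c = 0) * of_bool (g = 0))) = z\<^sup>2"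
  "(\<Sum>(b, c, f, g)\<in>Q. V (b, c, f, g) * (of_bool (b = 0) * of_bool (c = 0))) = z\<^sup>2"
  "(\<Sum>(b, c, f, g)\<in>Q. V (b, c, f, g) * (of_bool (f = 0) * of_bool (g = 0))) = z\<^sup>2"
  "(\<Sum>(b, c, f, g)\<in>Q. V (b, c, f, g) * (of_bool (b = 0) * of_bool (c = 0) * of_bool (f = 0) * of_bool (g = 0))) = z ^ 4"
proof -
  let ?z = "\<lambda>x. \<nu> x * of_bool (x = 0)"
  have *: "sum ?z A = z" by (simp only: z_def)
  show "(\<Sum>(b, c, f, g)\<in>Q. V (b, c, f, g) * (of_bool (b = 0) * of_bool (f = 0))) = z\<^sup>2"
    using sum_Q_prod[of ?z \<nu> ?z \<nu>] unfolding * mass by (simp add: V_def power2_eq_square mult_ac)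
  show "(\<Sum>(b, c, f, g)\<in>Q. V (b, c, f, g) * (of_bool (c = 0) * of_bool (g = 0))) = z\<^sup>2"
    using sum_Q_prod[of \<nu> ?z \<nu> ?z] unfolding * mass by (simp add: V_def power2_eq_square mult_ac)
  show "(\<Sum>(b, c, f, g)\<in>Q. V (b, c, f, g) * (of_bool (b = 0) * of_bool (c = 0))) = z\<^sup>2"
    using sum_Q_prod[of ?z ?z \<nu> \<nu>] unfolding * mass by (simp add: V_def power2_eq_square mult_ac)
  show "(\<Sum>(b, c, f, g)\<in>Q. V (b, c, f, g) * (of_bool (f = 0) * of_bool (g = 0))) = z\<^sup>2"
    using sum_Q_prod[of \<nu> \<nu> ?z ?z] unfolding * mass by (simp add: V_def power2_eq_square mult_ac)
  show "(\<Sum>(b, c, f, g)\<in>Q. V (b, c, f, g) * (of_bool (b = 0) * of_bool (c = 0) * of_bool (f = 0) * of_bool (g = 0))) = z ^ 4"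
    using sum_Q_prod[of ?z ?z ?z ?z] unfolding * mass by (simp add: V_def power4_eq_xxxx mult_ac)
qed

text \<open>The off-diagonal entries \<open>q\<close> and the diagonal entries \<open>p\<close> are
  independent: a condition on \<open>q\<close> alone has mass \<open>x\<close>, and given
  \<open>q\<close> the condition on \<open>p\<close> has mass at most \<open>B\<close>.\<close>

lemma sum_event_le:
  assumes "\<And>q. q \<in> Q \<Longrightarrow> 0 \<le> O' q" "(\<Sum>q\<in>Q. V q * O' q) = x"
    and "\<And>q. q \<in> Q \<Longrightarrow> (\<Sum>p\<in>Q. V p * I q p) \<le> B"
  shows "(\<Sum>q\<in>Q. \<Sum>p\<in>Q. V q * V p * (O' q * I q p)) \<le> x * B"
proof -
  have "(\<Sum>q\<in>Q. \<Sum>p\<in>Q. V q * V p * (O' q * I q p)) = (\<Sum>q\<in>Q. V q * O' q * (\<Sum>p\<in>Q. V p * I q p))"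
    unfolding sum_distrib_left by (intro sum.cong refl) (simp only: mult_ac)
  also have "\<dots> \<le> (\<Sum>q\<in>Q. V q * O' q * B)"
    by (intro sum_mono mult_left_mono assms mult_nonneg_nonneg V_nonneg)
  also have "\<dots> = x * B" by (simp add: sum_distrib_right assms(2)[symmetric])
  finally show ?thesis .
qed

text \<open>For the matrices \<open>(a b; c d)\<close> and \<open>(e f; g h)\<close>; the off-diagonal entries come first.\<close>

definition commutes :: "real \<times> real \<times> real \<times> real \<Rightarrow> real \<times> real \<times> real \<times> real \<Rightarrow> bool" where
  "commutes = (\<lambda>(b, c, f, g) (a, d, e, h). b * g = f * c \<and> b * (h - e) = f * (d - a) \<and> c * (h - e) = g * (d - a))"

text \<open>Once an off-diagonal entry vanishes, \<open>b * g = f * c\<close> forces a second zero,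
  in the same position of the other matrix or elsewhere in the same matrix. Unless all four vanish,
  a remaining equation determines \<open>h\<close> or gives \<open>d = a\<close>. So every
  degenerate case has two zeros and one linear relation, or four zeros.\<close>

lemma commutes_cases:
  assumes "commutes (b, c, f, g) (a, d, e, h)"
  shows "b \<noteq> 0 \<and> c \<noteq> 0 \<and> f \<noteq> 0 \<and> g \<noteq> 0 \<and> g / c = f / b \<and> h - f / b * d = e - f / b * a
    \<or> b = 0 \<and> c = 0 \<and> f = 0 \<and> g = 0
    \<or> (b = 0 \<and> f = 0) \<and> h = e + g * (d - a) / c \<or> (b = 0 \<and> f = 0) \<and> d = a
    \<or> (c = 0 \<and> g = 0) \<and> h = e + f * (d - a) / b \<or> (c = 0 \<and> g = 0) \<and> d = a
    \<or> (b = 0 \<and> c = 0) \<and> d = a \<or> (f = 0 \<and> g = 0) \<and> h = e + 0"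
proof -
  have c: "b * g = f * c" "b * (h - e) = f * (d - a)" "c * (h - e) = g * (d - a)"
    using assms by (auto simp: commutes_def)
  show ?thesis
  proof (cases "b = 0 \<or> c = 0 \<or> f = 0 \<or> g = 0")
    case True
    have h: "h = e + y * (d - a) / x" if "x \<noteq> 0" "x * (h - e) = y * (d - a)" for x y
    proof -
      have "h - e = y * (d - a) / x" using that by (simp add: nonzero_eq_divide_eq mult.commute)
      then show ?thesis by linarith
    qed
    consider "b = 0 \<and> f = 0" | "c = 0 \<and> g = 0" | "b = 0 \<and> c = 0" | "f = 0 \<and> g = 0"
      using True c(1) by auto
    then show ?thesis
    proof cases
      case 1 then show ?thesis using c h[of c g] by (cases "c = 0"; cases "g = 0") auto
    next
      case 2 then show ?thesis using c h[of b f] by (cases "b = 0"; cases "f = 0") auto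
    next
      case 3 then show ?thesis using c by auto
    next
      case 4 then show ?thesis using c by auto
    qed
  next
    case False
    have "h - e = f / b * (d - a)" using c False by (simp add: field_simps)
    then have "h - f / b * d = e - f / b * a" by (simp add: right_diff_distrib)
    moreover have "g / c = f / b" using c False by (simp add: field_simps)
    ultimately show ?thesis using False by blast
  qed
qed

theorem sum_commutes_le:
  "(\<Sum>q\<in>Q. \<Sum>p\<in>Q. V q * V p * of_bool (commutes q p))
    \<le> 10 ^ 30 * N powr (5001 / 2000) + z ^ 4 + 6 * (z\<^sup>2 * N)"
proof -
  define O1 :: "real \<times> real \<times> real \<times> real \<Rightarrow> real"
    where "O1 = (\<lambda>(b, c, f, g). of_bool (b = 0) * of_bool (f = 0))"
  \<comment> \<open>At \<open>c = 0\<close> the quotient is 0 by convention and the event reads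
    \<open>h = e\<close>. This is still a shift of \<open>e\<close>, so the bound \<open>N\<close>
    holds there too; the same applies to \<open>I3\<close> at \<open>b = 0\<close>.\<close>
  define I1 :: "real \<times> real \<times> real \<times> real \<Rightarrow> real \<times> real \<times> real \<times> real \<Rightarrow> real"
    where "I1 = (\<lambda>(b, c, f, g) (a, d, e, h). of_bool (h = e + g * (d - a) / c))"
  define O2 :: "real \<times> real \<times> real \<times> real \<Rightarrow> real"
    where "O2 = (\<lambda>(b, c, f, g). of_bool (b = 0) * of_bool (f = 0))"
  define I2 :: "real \<times> real \<times> real \<times> real \<Rightarrow> real \<times> real \<times> real \<times> real \<Rightarrow> real"
    where "I2 = (\<lambda>(b, c, f, g) (a, d, e, h). of_bool (d = a))"
  define O3 :: "real \<times> real \<times> real \<times> real \<Rightarrow> real"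
    where "O3 = (\<lambda>(b, c, f, g). of_bool (c = 0) * of_bool (g = 0))"
  define I3 :: "real \<times> real \<times> real \<times> real \<Rightarrow> real \<times> real \<times> real \<times> real \<Rightarrow> real"
    where "I3 = (\<lambda>(b, c, f, g) (a, d, e, h). of_bool (h = e + f * (d - a) / b))"
  define O4 :: "real \<times> real \<times> real \<times> real \<Rightarrow> real"
    where "O4 = (\<lambda>(b, c, f, g). of_bool (c = 0) * of_bool (g = 0))"
  define I4 :: "real \<times> real \<times> real \<times> real \<Rightarrow> real \<times> real \<times> real \<times> real \<Rightarrow> real"
    where "I4 = (\<lambda>(b, c, f, g) (a, d, e, h). of_bool (d = a))"
  define O5 :: "real \<times> real \<times> real \<times> real \<Rightarrow> real"
    where "O5 = (\<lambda>(b, c, f, g). of_bool (b = 0) * of_bool (c = 0))"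
  define I5 :: "real \<times> real \<times> real \<times> real \<Rightarrow> real \<times> real \<times> real \<times> real \<Rightarrow> real"
    where "I5 = (\<lambda>(b, c, f, g) (a, d, e, h). of_bool (d = a))"
  define O6 :: "real \<times> real \<times> real \<times> real \<Rightarrow> real"
    where "O6 = (\<lambda>(b, c, f, g). of_bool (f = 0) * of_bool (g = 0))"
  define I6 :: "real \<times> real \<times> real \<times> real \<Rightarrow> real \<times> real \<times> real \<times> real \<Rightarrow> real"
    where "I6 = (\<lambda>(b, c, f, g) (a, d, e, h). of_bool (h = e + 0))"
  define O0 :: "real \<times> real \<times> real \<times> real \<Rightarrow> real"
    where "O0 = (\<lambda>(b, c, f, g). of_bool (b = 0) * of_bool (c = 0) * of_bool (f = 0) * of_bool (g = 0))"
  define main :: "real \<times> real \<times> real \<times> real \<Rightarrow> real \<times> real \<times> real \<times> real \<Rightarrow> real"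
    where "main = (\<lambda>(b, c, f, g) (a, d, e, h). of_bool (b \<noteq> 0 \<and> c \<noteq> 0 \<and> f \<noteq> 0 \<and> g \<noteq> 0
      \<and> g / c = f / b \<and> h - f / b * d = e - f / b * a))"
  have V1: "sum V Q = 1"
    using sum_Q_prod[of \<nu> \<nu> \<nu> \<nu>] mass by (simp add: V_def split_def)
  have m: "(\<Sum>q\<in>Q. \<Sum>p\<in>Q. V q * V p * main q p) \<le> 10 ^ 30 * N powr (5001 / 2000)"
    using sum_commuting_nonzero_le by (simp add: main_def split_def)
  have 0: "(\<Sum>q\<in>Q. \<Sum>p\<in>Q. V q * V p * (O0 q * 1)) \<le> z ^ 4 * 1"
    by (rule sum_event_le) (use sum_V_zeros(5) V1 in \<open>auto simp: O0_def split_def\<close>)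
  have 1: "(\<Sum>q\<in>Q. \<Sum>p\<in>Q. V q * V p * (O1 q * I1 q p)) \<le> z\<^sup>2 * N"
  proof (rule sum_event_le)
    show "(\<Sum>q\<in>Q. V q * O1 q) = z\<^sup>2"
      using sum_V_zeros(1) by (simp add: O1_def split_def)
    show "(\<Sum>p\<in>Q. V p * I1 q p) \<le> N" for q
    proof -
      obtain b c f g where q: "q = (b, c, f, g)" by (rule prod_cases4)
      show ?thesis using sum_shift_le[of "\<lambda>a d. g * (d - a) / c"] by (simp add: I1_def q split_def)
    qed
  qed (auto simp: O1_def)
  have 2: "(\<Sum>q\<in>Q. \<Sum>p\<in>Q. V q * V p * (O2 q * I2 q p)) \<le> z\<^sup>2 * N"
  proof (rule sum_event_le)
    show "(\<Sum>q\<in>Q. V q * O2 q) = z\<^sup>2"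
      using sum_V_zeros(1) by (simp add: O2_def split_def)
    show "(\<Sum>p\<in>Q. V p * I2 q p) \<le> N" for q
    proof -
      obtain b c f g where q: "q = (b, c, f, g)" by (rule prod_cases4)
      show ?thesis using sum_diag_le by (simp add: I2_def q split_def)
    qed
  qed (auto simp: O2_def)
  have 3: "(\<Sum>q\<in>Q. \<Sum>p\<in>Q. V q * V p * (O3 q * I3 q p)) \<le> z\<^sup>2 * N"
  proof (rule sum_event_le)
    show "(\<Sum>q\<in>Q. V q * O3 q) = z\<^sup>2"
      using sum_V_zeros(2) by (simp add: O3_def split_def)
    show "(\<Sum>p\<in>Q. V p * I3 q p) \<le> N" for q
    proof -
      obtain b c f g where q: "q = (b, c, f, g)" by (rule prod_cases4)
      show ?thesis using sum_shift_le[of "\<lambda>a d. f * (d - a) / b"] by (simp add: I3_def q split_def)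
    qed
  qed (auto simp: O3_def)
  have 4: "(\<Sum>q\<in>Q. \<Sum>p\<in>Q. V q * V p * (O4 q * I4 q p)) \<le> z\<^sup>2 * N"
  proof (rule sum_event_le)
    show "(\<Sum>q\<in>Q. V q * O4 q) = z\<^sup>2"
      using sum_V_zeros(2) by (simp add: O4_def split_def)
    show "(\<Sum>p\<in>Q. V p * I4 q p) \<le> N" for q
    proof -
      obtain b c f g where q: "q = (b, c, f, g)" by (rule prod_cases4)
      show ?thesis using sum_diag_le by (simp add: I4_def q split_def)
    qed
  qed (auto simp: O4_def)
  have 5: "(\<Sum>q\<in>Q. \<Sum>p\<in>Q. V q * V p * (O5 q * I5 q p)) \<le> z\<^sup>2 * N"
  proof (rule sum_event_le)
    show "(\<Sum>q\<in>Q. V q * O5 q) = z\<^sup>2"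
      using sum_V_zeros(3) by (simp add: O5_def split_def)
    show "(\<Sum>p\<in>Q. V p * I5 q p) \<le> N" for q
    proof -
      obtain b c f g where q: "q = (b, c, f, g)" by (rule prod_cases4)
      show ?thesis using sum_diag_le by (simp add: I5_def q split_def)
    qed
  qed (auto simp: O5_def)
  have 6: "(\<Sum>q\<in>Q. \<Sum>p\<in>Q. V q * V p * (O6 q * I6 q p)) \<le> z\<^sup>2 * N"
  proof (rule sum_event_le)
    show "(\<Sum>q\<in>Q. V q * O6 q) = z\<^sup>2"
      using sum_V_zeros(4) by (simp add: O6_def split_def)
    show "(\<Sum>p\<in>Q. V p * I6 q p) \<le> N" for q
    proof -
      obtain b c f g where q: "q = (b, c, f, g)" by (rule prod_cases4)
      show ?thesis using sum_shift_le[of "\<lambda>a d. 0"] by (simp add: I6_def q split_def)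
    qed
  qed (auto simp: O6_def)
  have ptw: "of_bool (commutes q p) \<le> main q p + O0 q * 1 + O1 q * I1 q p + O2 q * I2 q p + O3 q * I3 q p + O4 q * I4 q p + O5 q * I5 q p + O6 q * I6 q p" for q p
  proof (cases "commutes q p")
    case True
    obtain b c f g where q: "q = (b, c, f, g)" by (rule prod_cases4)
    obtain a d e h where p: "p = (a, d, e, h)" by (rule prod_cases4)
    have nn: "0 \<le> main q p" "0 \<le> O0 q * 1" "0 \<le> O1 q * I1 q p" "0 \<le> O2 q * I2 q p" "0 \<le> O3 q * I3 q p" "0 \<le> O4 q * I4 q p" "0 \<le> O5 q * I5 q p" "0 \<le> O6 q * I6 q p"
      by (auto simp: main_def O0_def O1_def I1_def O2_def I2_def O3_def I3_def O4_def I4_def O5_def I5_def O6_def I6_def q p)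
    have "main q p = 1 \<or> O0 q * 1 = 1 \<or> O1 q * I1 q p = 1 \<or> O2 q * I2 q p = 1 \<or> O3 q * I3 q p = 1 \<or> O4 q * I4 q p = 1 \<or> O5 q * I5 q p = 1 \<or> O6 q * I6 q p = 1"
      using commutes_cases[OF True[unfolded q p]] unfolding q p main_def O0_def O1_def I1_def O2_def I2_def O3_def I3_def O4_def I4_def O5_def I5_def O6_def I6_def prod.case by auto
    then show ?thesis using True nn by auto
  qed (auto simp: main_def O0_def O1_def I1_def O2_def I2_def O3_def I3_def O4_def I4_def O5_def I5_def O6_def I6_def split_def)
  have "(\<Sum>q\<in>Q. \<Sum>p\<in>Q. V q * V p * of_bool (commutes q p))
      \<le> (\<Sum>q\<in>Q. \<Sum>p\<in>Q. V q * V p * (main q p + O0 q * 1 + O1 q * I1 q p + O2 q * I2 q p + O3 q * I3 q p + O4 q * I4 q p + O5 q * I5 q p + O6 q * I6 q p))"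
    by (intro sum_mono mult_left_mono ptw mult_nonneg_nonneg V_nonneg)
  also have "\<dots> = (\<Sum>q\<in>Q. \<Sum>p\<in>Q. V q * V p * main q p) + (\<Sum>q\<in>Q. \<Sum>p\<in>Q. V q * V p * (O0 q * 1)) + (\<Sum>q\<in>Q. \<Sum>p\<in>Q. V q * V p * (O1 q * I1 q p)) + (\<Sum>q\<in>Q. \<Sum>p\<in>Q. V q * V p * (O2 q * I2 q p)) + (\<Sum>q\<in>Q. \<Sum>p\<in>Q. V q * V p * (O3 q * I3 q p)) + (\<Sum>q\<in>Q. \<Sum>p\<in>Q. V q * V p * (O4 q * I4 q p)) + (\<Sum>q\<in>Q. \<Sum>p\<in>Q. V q * V p * (O5 q * I5 q p)) + (\<Sum>q\<in>Q. \<Sum>p\<in>Q. V q * V p * (O6 q * I6 q p))"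
    by (simp only: distrib_left sum.distrib)
  finally show ?thesis using m 0 1 2 3 4 5 6 by linarith
qed

end

section \<open>From matrices to quadruples of entries\<close>

lemma matrix_commute_iff:
  fixes X Y :: "real^2^2"
  shows "X ** Y = Y ** X \<longleftrightarrow>
    X $ 1 $ 2 * Y $ 2 $ 1 = Y $ 1 $ 2 * X $ 2 $ 1
    \<and> X $ 1 $ 2 * (Y $ 2 $ 2 - Y $ 1 $ 1) = Y $ 1 $ 2 * (X $ 2 $ 2 - X $ 1 $ 1)
    \<and> X $ 2 $ 1 * (Y $ 2 $ 2 - Y $ 1 $ 1) = Y $ 2 $ 1 * (X $ 2 $ 2 - X $ 1 $ 1)"
  by (auto simp: vec_eq_iff forall_2 matrix_matrix_mult_def sum_2 algebra_simps)

lemma commuting_prob_matrix_pmf: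
  fixes \<nu> :: "real pmf"
  assumes "finite (set_pmf \<nu>)"
  shows "commuting_prob (matrix_pmf \<nu>) =
    (\<Sum>q\<in>finite_weight.Q (set_pmf \<nu>). \<Sum>p\<in>finite_weight.Q (set_pmf \<nu>).
      finite_weight.V (pmf \<nu>) q * finite_weight.V (pmf \<nu>) p * of_bool (finite_weight.commutes q p))"
proof -
  interpret finite_weight "set_pmf \<nu>" "pmf \<nu>"
    by unfold_locales (use assms in \<open>auto simp: sum_pmf_eq_1\<close>)
  define mat :: "real \<Rightarrow> real \<Rightarrow> real \<Rightarrow> real \<Rightarrow> real^2^2"
    where "mat a b c d = vector [vector [a, b], vector [c, d]]" for a b c d
  have mat: "mat a b c d $ 1 $ 1 = a" "mat a b c d $ 1 $ 2 = b" "mat a b c d $ 2 $ 1 = c" "mat a b c d $ 2 $ 2 = d"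
    for a b c d by (simp_all add: mat_def)
  have mat_eq: "mat (X $ 1 $ 1) (X $ 1 $ 2) (X $ 2 $ 1) (X $ 2 $ 2) = X" for X
    by (simp add: vec_eq_iff forall_2 mat)
  define S where "S = set_pmf (matrix_pmf \<nu>)"
  have S: "X \<in> S \<longleftrightarrow> X $ 1 $ 1 \<in> set_pmf \<nu> \<and> X $ 1 $ 2 \<in> set_pmf \<nu> \<and> X $ 2 $ 1 \<in> set_pmf \<nu> \<and> X $ 2 $ 2 \<in> set_pmf \<nu>" for X
    by (auto simp: S_def set_pmf_iff pmf_matrix_pmf)
  have "commuting_prob (matrix_pmf \<nu>) = (\<Sum>(X, Y)\<in>S \<times> S.
      pmf (matrix_pmf \<nu>) X * pmf (matrix_pmf \<nu>) Y * of_bool (X ** Y = Y ** X))"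
    by (simp add: commuting_prob_def S_def sum.cartesian_product)
  also have "\<dots> = (\<Sum>(q, p)\<in>Q \<times> Q. V q * V p * of_bool (commutes q p))"
    by (rule sum.reindex_bij_witness[where
          i = "\<lambda>((b, c, f, g), (a, d, e, h)). (mat a b c d, mat e f g h)" and
          j = "\<lambda>(X, Y). ((X $ 1 $ 2, X $ 2 $ 1, Y $ 1 $ 2, Y $ 2 $ 1), (X $ 1 $ 1, X $ 2 $ 2, Y $ 1 $ 1, Y $ 2 $ 2))"])
      (auto simp: Q_def V_def S mat mat_eq pmf_matrix_pmf matrix_commute_iff commutes_def)
  finally show ?thesis by (simp add: sum.cartesian_product)
qed

theorem theorem1p7:
  "\<exists>c>(0::real). \<exists>C>(0::real). \<forall>\<nu> :: real pmf. finite (set_pmf \<nu>) \<longrightarrow>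
     commuting_prob (matrix_pmf \<nu>) \<le> C * (l2_norm \<nu> powr (5 + c) + pmf \<nu> 0 ^ 3)"
proof (intro exI conjI allI impI)
  fix \<nu> :: "real pmf"
  assume fin\<nu>: "finite (set_pmf \<nu>)"
  interpret finite_weight "set_pmf \<nu>" "pmf \<nu>"
    by unfold_locales (use fin\<nu> in \<open>auto simp: sum_pmf_eq_1\<close>)
  \<comment> \<open>\<open>N\<close> is the square of the norm, so the saving \<open>1/2000\<close>
    in the exponent of \<open>N\<close> becomes \<open>c = 1/1000\<close>.\<close>
  have norm: "l2_norm \<nu> powr (5 + 1 / 1000) = N powr (5001 / 2000)"
    by (simp add: l2_norm_def N_def powr_powr)
  have z: "z = pmf \<nu> 0"
  proof -
    have "z = (\<Sum>a\<in>set_pmf \<nu>. if a = 0 then pmf \<nu> a else 0)"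
      unfolding z_def by (intro sum.cong) auto
    also have "\<dots> = pmf \<nu> 0" using fin\<nu> by (simp add: set_pmf_iff)
    finally show ?thesis .
  qed
  define u where "u = N powr (5001 / 2000)"
  define t where "t = z ^ 3"
  have t0: "0 \<le> t" using z_bounds by (simp add: t_def)
  have z4: "z ^ 4 \<le> t" unfolding t_def using z_bounds by (intro power_decreasing) auto
  \<comment> \<open>The mixed terms lie between the two terms of the claim: at most
    \<open>z^3\<close> if \<open>N \<le> z\<close>, and at most \<open>N^3\<close>
    otherwise.\<close>
  have zN: "z\<^sup>2 * N \<le> z ^ 3 + N powr (5001 / 2000)"
  proof (cases "N \<le> z")
    case True
    then have "z\<^sup>2 * N \<le> z\<^sup>2 * z" by (intro mult_left_mono) auto
    then show ?thesis by (simp add: power2_eq_square power3_eq_cube add_increasing2)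
  next
    case False
    then have "z\<^sup>2 * N \<le> N\<^sup>2 * N"
      using z_bounds N_pos by (intro mult_right_mono power_mono) auto
    also have "\<dots> = N powr 3" using N_pos by (simp add: power2_eq_square power3_eq_cube)
    also have "\<dots> \<le> N powr (5001 / 2000)" by (rule N_mono) simp
    finally show ?thesis using zero_le_power[OF z_bounds(1), of 3] by linarith
  qed
  have "commuting_prob (matrix_pmf \<nu>) \<le> 10 ^ 30 * u + z ^ 4 + 6 * (z\<^sup>2 * N)"
    unfolding commuting_prob_matrix_pmf[OF fin\<nu>] u_def by (rule sum_commutes_le)
  also have "\<dots> \<le> 10 ^ 30 * u + t + 6 * (t + u)"
    using z4 zN by (simp add: u_def t_def)
  also have "\<dots> \<le> 10 ^ 31 * (u + t)" using t0 by (simp add: u_def)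
  finally have "commuting_prob (matrix_pmf \<nu>) \<le> 10 ^ 31 * (N powr (5001 / 2000) + z ^ 3)"
    by (simp only: u_def t_def)
  then show "commuting_prob (matrix_pmf \<nu>) \<le> 10 ^ 31 * (l2_norm \<nu> powr (5 + 1 / 1000) + pmf \<nu> 0 ^ 3)"
    unfolding norm z .
qed auto

end
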